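(* Let $I = (a_1,b_1) \times \dots \times (a_d,b_d)$ be a bounded hyper-rectangle in $\mathbb{R}^d$. Fix a multi-index $\beta \in \mathbb{N}_0^d$. Let $\mu \in C^\beta(I)$ be bounded in $I$, and consider the covariance function $\Sigma \colon I \times I \to \mathbb{R}$ given by $$\Sigma(z,z') = \prod_{i=1}^d K_{\nu_i}(z_i - z_i'), \qquad z = (z_1,\dots,z_d),\ z' = (z_1',\dots,z_d'),$$ where $\nu_i = \beta_i + \tfrac12$ and $K_{\nu_i}$ is a Matérn covariance function with smoothness parameter $\nu_i$, for each $i = 1,\dots,d$. Then any Gaussian process $X \sim \mathcal{GP}(\mu,\Sigma)$ has a modification $\tilde X$ that satisfies $\mathbb{P}(\tilde X \in C^\beta(I)) = 1$.
   Context: For $\nu = p + \tfrac12$ with $p \in \mathbb{N}_0$, and amplitude and length-scale parameters $\sigma, \rho > 0$, the Matérn covariance function is, for $z,z' \in \mathbb{R}$, $$K_\nu(z,z') = K_\nu(z-z') = \sigma^2 \exp\left(-\frac{|z-z'|}{\rho}\right) \frac{p!}{(2p)!} \sum_{k=0}^p \frac{(2p-k)!}{(p-k)!\,k!} \left(\frac{2}{\rho}\right)^k |z-z'|^k .$$ Each factor $K_{\nu_i}$ may have its own parameters $\sigma_i, \rho_i > 0$. For multi-indices, $\alpha \le \beta$ means $\alpha_i \le \beta_i$ for every $i$. $C^\beta(I)$ denotes the set of continuous functions $c \colon I \to \mathbb{R}$ whose partial derivatives $\partial^\alpha c = \partial_{z_1}^{\alpha_1}\cdots\partial_{z_d}^{\alpha_d}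 c$ exist and are continuous in $I$ for all $\alpha \le \beta$. $X \sim \mathcal{GP}(\mu,\Sigma)$ means that $X \colon I \times \Omega \to \mathbb{R}$ is a Gaussian process on a probability space $(\Omega,\mathcal{F},\mathbb{P})$ with mean function $\mu$ and covariance function $\Sigma$. A process $\tilde X$ is a modification of $X$ if $\mathbb{P}(X(z,\omega) = \tilde X(z,\omega)) = 1$ for every $z \in I$. The notation $\tilde X \in C^\beta(I)$ means that the sample path $z \mapsto \tilde X(z,\omega)$ belongs to $C^\beta(I)$. *)

theory Defs
  imports "HOL-Probability.Probability"
begin

section \<open>Half-integer Matern covariance functions\<close>

text \<open>
  The covariance of smoothness \<open>p + 1/2\<close>, amplitude \<open>\<sigma>\<close> and length-scale \<open>\<rho>\<close>, as a function of the
  difference \<open>h = z - z'\<close>. Only half-integer smoothness occurs, so the argument is \<open>p\<close>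
  itself.
\<close>

definition matern :: "nat \<Rightarrow> real \<Rightarrow> real \<Rightarrow> real \<Rightarrow> real" where
  "matern p \<sigma> \<rho> h =
     \<sigma>\<^sup>2 * exp (- \<bar>h\<bar> / \<rho>) * (fact p / fact (2 * p)) *
     (\<Sum>k=0..p. fact (2 * p - k) / (fact (p - k) * fact k) * (2 / \<rho>) ^ k * \<bar>h\<bar> ^ k)"


section \<open>Anisotropic differentiability classes\<close>

definition partial_deriv ::
  "'n::finite \<Rightarrow> (real ^ 'n \<Rightarrow> real) \<Rightarrow> real ^ 'n \<Rightarrow> real" where
  "partial_deriv i f z = deriv (\<lambda>t. f (z + t *\<^sub>R axis i 1)) 0"

definition partial_differentiable ::
  "'n::finite \<Rightarrow> (real ^ 'n \<Rightarrow> real) \<Rightarrow> real ^ 'n \<Rightarrow> bool" where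
  "partial_differentiable i f z \<longleftrightarrow> (\<lambda>t. f (z + t *\<^sub>R axis i 1)) field_differentiable (at 0)"

text \<open>
  The order of differentiation matters a priori, so coordinates are indexed by a linearly ordered
  type. A multi-index \<open>\<alpha>\<close> is expanded into the increasing list of directions
  \<open>z\<^sub>1, \<dots>, z\<^sub>1, z\<^sub>2, \<dots>, z\<^sub>d\<close> with \<open>\<alpha> i\<close> copies of \<open>i\<close>. The operators are applied
  from the right end of that list, as in the operator product
  \<open>\<partial>\<^sub>1 ^ \<alpha> 1 \<cdots> \<partial>\<^sub>d ^ \<alpha> d\<close>.
\<close>

definition directions :: "('n::{finite,linorder} \<Rightarrow> nat) \<Rightarrow> 'n list" where
  "directions \<alpha> = concat (map (\<lambda>i. replicate (\<alpha> i) i) (sorted_list_of_set UNIV))"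

definition mixed_partial ::
  "('n \<Rightarrow> nat) \<Rightarrow> (real ^ 'n::{finite,linorder} \<Rightarrow> real) \<Rightarrow> real ^ 'n::{finite,linorder} \<Rightarrow> real" where
  "mixed_partial \<alpha> f = foldr partial_deriv (directions \<alpha>) f"

text \<open>
  Since \<^const>\<open>deriv\<close> is total, existence is a separate condition: every successive derivative must
  exist at every point of \<open>S\<close>. For open \<open>S\<close> neither this condition nor the values of the mixed
  partial derivatives on \<open>S\<close> depend on the values of \<open>f\<close> outside \<open>S\<close>.
\<close>

primrec partials_exist_on ::
  "(real ^ 'n::finite) set \<Rightarrow> 'n list \<Rightarrow> (real ^ 'n \<Rightarrow> real) \<Rightarrow> bool" where
  "partials_exist_on S [] f \<longleftrightarrow> True"
| "partials_exist_on S (i # is) f \<longleftrightarrow>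
     partials_exist_on S is f \<and> (\<forall>z\<in>S. partial_differentiable i (foldr partial_deriv is f) z)"

definition mixed_partial_exists_on ::
  "(real ^ 'n::{finite,linorder}) set \<Rightarrow> ('n \<Rightarrow> nat) \<Rightarrow>
   (real ^ 'n::{finite,linorder} \<Rightarrow> real) \<Rightarrow> bool" where
  "mixed_partial_exists_on S \<alpha> f \<longleftrightarrow> partials_exist_on S (directions \<alpha>) f"

definition C_multi ::
  "('n \<Rightarrow> nat) \<Rightarrow> (real ^ 'n::{finite,linorder}) set \<Rightarrow> (real ^ 'n::{finite,linorder} \<Rightarrow> real) set" where
  "C_multi \<beta> S = {c. continuous_on S c \<and>
     (\<forall>\<alpha>\<le>\<beta>. mixed_partial_exists_on S \<alpha> c \<and> continuous_on S (mixed_partial \<alpha> c))}"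


section \<open>Gaussian processes and modifications\<close>

text \<open>Normal law with standard deviation \<open>s\<close>; \<open>s = 0\<close> gives the point mass.\<close>

definition normal_law :: "real \<Rightarrow> real \<Rightarrow> real measure" where
  "normal_law m s = (if s = 0 then return borel m else density lborel (normal_density m s))"

text \<open>
  The finite-dimensional distributions are Gaussian, that is, every finite linear combination of
  the \<open>X z\<close> has a (possibly degenerate) normal law. In particular each \<open>X z\<close> is
  square-integrable, so the integrals for mean and covariance are genuine.
\<close>

definition gaussian_process ::
  "'w measure \<Rightarrow> 'i set \<Rightarrow> ('i \<Rightarrow> 'w \<Rightarrow> real) \<Rightarrow> ('i \<Rightarrow> real) \<Rightarrow> ('i \<Rightarrow> 'i \<Rightarrow> real) \<Rightarrow> bool" where
  "gaussian_process M I X \<mu> \<Sigma> \<longleftrightarrow>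
     prob_space M \<and>
     (\<forall>z\<in>I. X z \<in> borel_measurable M) \<and>
     (\<forall>J c. finite J \<longrightarrow> J \<subseteq> I \<longrightarrow>
        (\<exists>m s. 0 \<le> s \<and> distr M borel (\<lambda>\<omega>. \<Sum>z\<in>J. c z * X z \<omega>) = normal_law m s)) \<and>
     (\<forall>z\<in>I. (\<integral>\<omega>. X z \<omega> \<partial>M) = \<mu> z) \<and>
     (\<forall>z\<in>I. \<forall>z'\<in>I. (\<integral>\<omega>. (X z \<omega> - \<mu> z) * (X z' \<omega> - \<mu> z') \<partial>M) = \<Sigma> z z')"

definition modification ::
  "'w measure \<Rightarrow> 'i set \<Rightarrow> ('i \<Rightarrow> 'w \<Rightarrow> real) \<Rightarrow> ('i \<Rightarrow> 'w \<Rightarrow> real) \<Rightarrow> bool" where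
  "modification M I X Y \<longleftrightarrow>
     (\<forall>z\<in>I. Y z \<in> borel_measurable M) \<and>
     (\<forall>z\<in>I. \<P>(\<omega> in M. X z \<omega> = Y z \<omega>) = 1)"

end

theory Submission
  imports Defs
begin

text \<open>
  In each coordinate the Matern covariance of order \<open>p + 1/2\<close> has \<open>2p\<close> derivatives, the last of them
  locally Lipschitz: it is \<open>G\<^sub>p \<bar>h\<bar>\<close> for functions \<open>G\<^sub>p\<close>, polynomial times exponential, with
  \<open>G\<^sub>p' x = - c x G\<^sub>q x\<close>, \<open>q = p - 1\<close>. Hence the centred field can be differentiated \<open>\<beta> i\<close> times in
  direction \<open>i\<close> in mean square, each step replacing a factor \<open>k\<close> of the covariance by \<open>- k''\<close>, and all
  these fields have Lipschitz covariances. Gaussian moment bounds survive \<open>L\<^sup>2\<close> limits, so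
  Kolmogorov's chaining argument gives every mean-square derivative a modification with continuous
  paths. Almost surely, Riemann sums of one such modification along a rational segment converge to
  the increment of the modification one order below; by continuity the paths then have the
  expected classical partial derivatives.
\<close>

section \<open>Smoothness of half-integer Matern covariances\<close>

text \<open>The regularity is anisotropic because the covariance is a product: a derivative in
  direction i touches only the i-th factor, so \<open>\<beta> i\<close> derivatives are available in
  every direction at once. The last covariances are merely Lipschitz, so second moments of
  increments are only O(|s - t|). In dimension d Kolmogorov's argument wants an exponent above d,
  and moments of order 8d supply it. Gaussianity of the mean-square derivatives is never stated:
  everything lives in one L2-closed linear space on which even moments are bounded by powers of the
  second moment (\<open>moment_space\<close>). The other obstacle is that mean-square derivatives
  are determined only up to null sets, a different one for each point, so relations between paths
  can be established on countably many segments only. For these the remainder of the first-order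
  expansion must have mean square O(|t|^3), which Lipschitz covariances just give; this beats the
  2^n cells of a dyadic Riemann sum. The mean is subtracted at the start and added back path by
  path.\<close>

primrec lip_smooth :: "nat \<Rightarrow> (real \<Rightarrow> real) \<Rightarrow> bool" where
  "lip_smooth 0 f \<longleftrightarrow> (\<forall>R. \<exists>C. \<forall>x y. \<bar>x\<bar> \<le> R \<longrightarrow> \<bar>y\<bar> \<le> R \<longrightarrow> \<bar>f x - f y\<bar> \<le> C * \<bar>x - y\<bar>)"
| "lip_smooth (Suc n) f \<longleftrightarrow> (\<exists>f'. (\<forall>x. (f has_real_derivative f' x) (at x)) \<and> lip_smooth n f')"

text \<open>\<open>lip_smooth n\<close> is the class C^(n,1) in its local form. One nonnegative
  constant that is both a Lipschitz constant and a bound keeps product estimates short; the bound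
  comes from comparison with the value at 0.\<close>

lemma lip_smooth_0D:
  assumes "lip_smooth 0 f"
  obtains C where "C \<ge> 0" "\<And>x y. \<bar>x\<bar> \<le> R \<Longrightarrow> \<bar>y\<bar> \<le> R \<Longrightarrow> \<bar>f x - f y\<bar> \<le> C * \<bar>x - y\<bar>"
    "\<And>x. \<bar>x\<bar> \<le> R \<Longrightarrow> \<bar>f x\<bar> \<le> C"
proof -
  obtain C where C: "\<And>x y. \<bar>x\<bar> \<le> R \<Longrightarrow> \<bar>y\<bar> \<le> R \<Longrightarrow> \<bar>f x - f y\<bar> \<le> C * \<bar>x - y\<bar>"
    using assms by (force simp: lip_smooth.simps(1))
  \<comment> \<open>Absolute values throughout, as \<open>C\<close> may be negative, and so may
    \<open>R\<close>, in which case the claims are vacuous.\<close>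
  define D where "D = \<bar>C\<bar> + \<bar>f 0\<bar> + \<bar>C\<bar> * \<bar>R\<bar>"
  show ?thesis
  proof
    have 0: "0 \<le> \<bar>C\<bar> * \<bar>R\<bar>" by simp
    then show "D \<ge> 0" unfolding D_def by linarith
    show "\<bar>f x - f y\<bar> \<le> D * \<bar>x - y\<bar>" if "\<bar>x\<bar> \<le> R" "\<bar>y\<bar> \<le> R" for x y
    proof -
      have "C * \<bar>x - y\<bar> \<le> D * \<bar>x - y\<bar>" using 0 unfolding D_def by (intro mult_right_mono) linarith+
      with C[OF that] show ?thesis by linarith
    qed
    show "\<bar>f x\<bar> \<le> D" if x: "\<bar>x\<bar> \<le> R" for x
    proof -
      have "\<bar>f x - f 0\<bar> \<le> C * \<bar>x\<bar>" using C[of x 0] x by simp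
      also have "\<dots> \<le> \<bar>C\<bar> * \<bar>R\<bar>" using x by (intro mult_mono) auto
      finally show ?thesis by (auto simp: D_def)
    qed
  qed
qed

section \<open>Closure properties of the classes \<open>lip_smooth n\<close>\<close>

lemma lip_smooth_add: "lip_smooth n f \<Longrightarrow> lip_smooth n g \<Longrightarrow> lip_smooth n (\<lambda>x. f x + g x)"
proof (induction n arbitrary: f g)
  case 0
  show ?case unfolding lip_smooth.simps
  proof
    fix R :: real
    obtain C where C: "\<And>x y. \<bar>x\<bar> \<le> R \<Longrightarrow> \<bar>y\<bar> \<le> R \<Longrightarrow> \<bar>f x - f y\<bar> \<le> C * \<bar>x - y\<bar>"
      using lip_smooth_0D[OF 0(1)] by metis
    obtain D where D: "\<And>x y. \<bar>x\<bar> \<le> R \<Longrightarrow> \<bar>y\<bar> \<le> R \<Longrightarrow> \<bar>g x - g y\<bar> \<le> D * \<bar>x - y\<bar>"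
      using lip_smooth_0D[OF 0(2)] by metis
    show "\<exists>C. \<forall>x y. \<bar>x\<bar> \<le> R \<longrightarrow> \<bar>y\<bar> \<le> R \<longrightarrow> \<bar>f x + g x - (f y + g y)\<bar> \<le> C * \<bar>x - y\<bar>"
    proof (intro exI[of _ "C + D"] allI impI)
      fix x y assume "\<bar>x\<bar> \<le> R" "\<bar>y\<bar> \<le> R"
      from C[OF this] D[OF this] show "\<bar>f x + g x - (f y + g y)\<bar> \<le> (C + D) * \<bar>x - y\<bar>"
        by (simp add: distrib_right)
    qed
  qed
next
  case (Suc n)
  then obtain f' g' where "\<forall>x. (f has_real_derivative f' x) (at x)" "lip_smooth n f'"
    "\<forall>x. (g has_real_derivative g' x) (at x)" "lip_smooth n g'" by auto
  then show ?case using Suc.IH by (auto intro!: exI[of _ "\<lambda>x. f' x + g' x"] derivative_intros)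
qed

lemma lip_smooth_cmult: "lip_smooth n f \<Longrightarrow> lip_smooth n (\<lambda>x. c * f x)"
proof (induction n arbitrary: f)
  case 0
  show ?case unfolding lip_smooth.simps
  proof
    fix R :: real
    obtain C where C: "\<And>x y. \<bar>x\<bar> \<le> R \<Longrightarrow> \<bar>y\<bar> \<le> R \<Longrightarrow> \<bar>f x - f y\<bar> \<le> C * \<bar>x - y\<bar>"
      using lip_smooth_0D[OF 0(1)] by metis
    show "\<exists>C. \<forall>x y. \<bar>x\<bar> \<le> R \<longrightarrow> \<bar>y\<bar> \<le> R \<longrightarrow> \<bar>c * f x - c * f y\<bar> \<le> C * \<bar>x - y\<bar>"
    proof (intro exI[of _ "\<bar>c\<bar> * C"] allI impI)
      fix x y assume "\<bar>x\<bar> \<le> R" "\<bar>y\<bar> \<le> R"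
      from mult_left_mono[OF C[OF this], of "\<bar>c\<bar>"] show "\<bar>c * f x - c * f y\<bar> \<le> \<bar>c\<bar> * C * \<bar>x - y\<bar>"
        by (simp add: abs_mult[symmetric] algebra_simps)
    qed
  qed
next
  case (Suc n)
  then obtain f' where "\<forall>x. (f has_real_derivative f' x) (at x)" "lip_smooth n f'" by auto
  then show ?case unfolding lip_smooth.simps
    by (intro exI[of _ "\<lambda>x. c * f' x"] conjI allI Suc.IH DERIV_cmult) auto
qed

lemma lip_smooth_0_mult:
  assumes "lip_smooth 0 f" "lip_smooth 0 g"
  shows "lip_smooth 0 (\<lambda>x. f x * g x)"
  unfolding lip_smooth.simps
proof
  fix R :: real
  obtain C where C: "C \<ge> 0" "\<And>x y. \<bar>x\<bar> \<le> R \<Longrightarrow> \<bar>y\<bar> \<le> R \<Longrightarrow> \<bar>f x - f y\<bar> \<le> C * \<bar>x - y\<bar>"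
     "\<And>x. \<bar>x\<bar> \<le> R \<Longrightarrow> \<bar>f x\<bar> \<le> C"
    using lip_smooth_0D[OF assms(1)] by metis
  obtain D where D: "D \<ge> 0" "\<And>x y. \<bar>x\<bar> \<le> R \<Longrightarrow> \<bar>y\<bar> \<le> R \<Longrightarrow> \<bar>g x - g y\<bar> \<le> D * \<bar>x - y\<bar>"
     "\<And>x. \<bar>x\<bar> \<le> R \<Longrightarrow> \<bar>g x\<bar> \<le> D"
    using lip_smooth_0D[OF assms(2)] by metis
  show "\<exists>C. \<forall>x y. \<bar>x\<bar> \<le> R \<longrightarrow> \<bar>y\<bar> \<le> R \<longrightarrow> \<bar>f x * g x - f y * g y\<bar> \<le> C * \<bar>x - y\<bar>"
  proof (intro exI[of _ "2 * C * D"] allI impI)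
    fix x y assume xy: "\<bar>x\<bar> \<le> R" "\<bar>y\<bar> \<le> R"
    have "f x * g x - f y * g y = (f x - f y) * g x + f y * (g x - g y)" by (simp add: algebra_simps)
    also have "\<bar>\<dots>\<bar> \<le> \<bar>f x - f y\<bar> * \<bar>g x\<bar> + \<bar>f y\<bar> * \<bar>g x - g y\<bar>"
      by (metis abs_mult abs_triangle_ineq)
    also have "\<dots> \<le> (C * \<bar>x - y\<bar>) * D + C * (D * \<bar>x - y\<bar>)"
      using C D xy by (intro add_mono mult_mono) auto
    finally show "\<bar>f x * g x - f y * g y\<bar> \<le> 2 * C * D * \<bar>x - y\<bar>" by (simp add: algebra_simps)
  qed
qed

text \<open>A locally Lipschitz derivative is locally bounded, so the mean value theorem gives the
  base case; the induction step only passes to the derivative.\<close>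

lemma lip_smooth_Suc_imp: "lip_smooth (Suc n) f \<Longrightarrow> lip_smooth n f"
proof (induction n arbitrary: f)
  case 0
  then obtain f' where f': "\<And>x. (f has_real_derivative f' x) (at x)" "lip_smooth 0 f'" by auto
  show ?case unfolding lip_smooth.simps
  proof
    fix R :: real
    obtain C where C: "C \<ge> 0" "\<And>x. \<bar>x\<bar> \<le> R \<Longrightarrow> \<bar>f' x\<bar> \<le> C"
      using lip_smooth_0D[OF f'(2)] by metis
    show "\<exists>C. \<forall>x y. \<bar>x\<bar> \<le> R \<longrightarrow> \<bar>y\<bar> \<le> R \<longrightarrow> \<bar>f x - f y\<bar> \<le> C * \<bar>x - y\<bar>"
    proof (intro exI[of _ C] allI impI)
      fix x y assume xy: "\<bar>x\<bar> \<le> R" "\<bar>y\<bar> \<le> R"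
      have "norm (f x - f y) \<le> C * norm (x - y)"
      proof (rule field_differentiable_bound[of "{-R..R}" f f'])
        show "\<And>z. z \<in> {-R..R} \<Longrightarrow> (f has_real_derivative f' z) (at z within {-R..R})"
          using f'(1) has_field_derivative_at_within by blast
      qed (use C xy in auto)
      then show "\<bar>f x - f y\<bar> \<le> C * \<bar>x - y\<bar>" by simp
    qed
  qed
next
  case (Suc n)
  then show ?case by (metis lip_smooth.simps(2))
qed

lemma lip_smooth_imp_0: "lip_smooth n f \<Longrightarrow> lip_smooth 0 f"
  by (induction n) (auto dest: lip_smooth_Suc_imp simp del: lip_smooth.simps)

lemma lip_smooth_id: "lip_smooth 0 (\<lambda>x. x)"
  by (auto intro!: exI[of _ 1])

lemma lip_smooth_const: "lip_smooth 0 (\<lambda>x. c)"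
  by (auto intro!: exI[of _ 0])

text \<open>The absolute value is 1-Lipschitz and maps [-R, R] into itself.\<close>

lemma lip_smooth_0_abs_comp: "lip_smooth 0 f \<Longrightarrow> lip_smooth 0 (\<lambda>x. f \<bar>x\<bar>)"
  unfolding lip_smooth.simps
proof
  fix R :: real
  assume "\<forall>R. \<exists>C. \<forall>x y. \<bar>x\<bar> \<le> R \<longrightarrow> \<bar>y\<bar> \<le> R \<longrightarrow> \<bar>f x - f y\<bar> \<le> C * \<bar>x - y\<bar>"
  then have "lip_smooth 0 f" by simp
  then obtain C where C: "C \<ge> 0" "\<And>x y. \<bar>x\<bar> \<le> R \<Longrightarrow> \<bar>y\<bar> \<le> R \<Longrightarrow> \<bar>f x - f y\<bar> \<le> C * \<bar>x - y\<bar>"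
    using lip_smooth_0D by metis
  show "\<exists>C. \<forall>x y. \<bar>x\<bar> \<le> R \<longrightarrow> \<bar>y\<bar> \<le> R \<longrightarrow> \<bar>f \<bar>x\<bar> - f \<bar>y\<bar>\<bar> \<le> C * \<bar>x - y\<bar>"
  proof (intro exI[of _ C] allI impI)
    fix x y assume xy: "\<bar>x\<bar> \<le> R" "\<bar>y\<bar> \<le> R"
    have "\<bar>f \<bar>x\<bar> - f \<bar>y\<bar>\<bar> \<le> C * \<bar>\<bar>x\<bar> - \<bar>y\<bar>\<bar>" using C(2)[of "\<bar>x\<bar>" "\<bar>y\<bar>"] xy by simp
    also have "\<dots> \<le> C * \<bar>x - y\<bar>" using C(1) by (intro mult_left_mono) auto
    finally show "\<bar>f \<bar>x\<bar> - f \<bar>y\<bar>\<bar> \<le> C * \<bar>x - y\<bar>" .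
  qed
qed

lemma lip_smooth_0_power: "lip_smooth 0 (\<lambda>x. x ^ n)"
  by (induction n) (auto intro: lip_smooth_0_mult lip_smooth_const lip_smooth_id simp del: lip_smooth.simps)

text \<open>Here \<open>k a\<close> is (-1)^a times the derivative of \<open>f\<close> of order 2a.
  One mean-square derivative costs two derivatives of the covariance, one in each argument of k(z -
  z'), and the second argument brings the minus sign. The intermediate derivative \<open>g\<close>
  is kept for a double use of the mean value theorem.\<close>

lemma lip_smooth_chain:
  assumes "lip_smooth (2 * p) f"
  shows "\<exists>k. k 0 = f \<and> (\<forall>a\<le>p. lip_smooth 0 (k a)) \<and>
    (\<forall>a<p. \<exists>g. \<forall>x. (k a has_real_derivative g x) (at x) \<and> (g has_real_derivative - k (Suc a) x) (at x))"
  using assms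
proof (induction p arbitrary: f)
  case 0
  then show ?case by (intro exI[of _ "\<lambda>_. f"]) auto
next
  case (Suc p)
  then have "lip_smooth (Suc (Suc (2 * p))) f" by simp
  then obtain g h where g: "\<And>x. (f has_real_derivative g x) (at x)"
    and h: "\<And>x. (g has_real_derivative h x) (at x)" "lip_smooth (2 * p) h" by auto
  \<comment> \<open>The induction hypothesis is applied to minus the second derivative, which builds
    the sign into the chain.\<close>
  obtain k where k: "k 0 = (\<lambda>x. - h x)" "\<forall>a\<le>p. lip_smooth 0 (k a)"
    "\<forall>a<p. \<exists>g. \<forall>x. (k a has_real_derivative g x) (at x) \<and> (g has_real_derivative - k (Suc a) x) (at x)"
    using Suc.IH[OF lip_smooth_cmult[OF h(2), of "-1"]] by auto
  have f0: "lip_smooth 0 f" using lip_smooth_imp_0[OF Suc.prems] .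
  show ?case
  proof (intro exI[of _ "case_nat f k"] conjI allI impI)
    fix a assume "a \<le> Suc p"
    then show "lip_smooth 0 (case a of 0 \<Rightarrow> f | Suc x \<Rightarrow> k x)"
      using k(2) f0 by (auto split: nat.split simp del: lip_smooth.simps)
  next
    fix a assume "a < Suc p"
    then show "\<exists>g. \<forall>x. ((case a of 0 \<Rightarrow> f | Suc x \<Rightarrow> k x) has_real_derivative g x) (at x) \<and>
         (g has_real_derivative - (case Suc a of 0 \<Rightarrow> f | Suc x \<Rightarrow> k x) x) (at x)"
      using g h k by (cases a) auto
  qed simp
qed

section \<open>Even extensions across the origin\<close>

lemma DERIV_abs:
  fixes h :: real
  assumes "h \<noteq> 0"
  shows "(abs has_real_derivative sgn h) (at h)"
proof (cases "h > 0")
  case True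
  show ?thesis
    by (rule has_field_derivative_transform_within_open[of "\<lambda>x. x" _ _ "{0<..}"]) (use True in auto)
next
  case False
  have "((\<lambda>x. - x) has_real_derivative - 1) (at h)" by (rule derivative_eq_intros refl)+
  then have "(abs has_real_derivative - 1) (at h)"
    by (rule has_field_derivative_transform_within_open[of _ _ _ "{..<0}"])
      (use False assms in auto)
  then show ?thesis using False assms by simp
qed

text \<open>At 0 the difference quotient is \<open>G \<bar>h\<bar>\<close> itself, which is
  continuous: the factor \<open>h\<close> absorbs the kink. Elsewhere this is the product rule
  together with h sgn h = |h|.\<close>

lemma DERIV_times_abs_comp:
  fixes G G' :: "real \<Rightarrow> real"
  assumes "\<And>x. (G has_real_derivative G' x) (at x)"
  shows "((\<lambda>h. h * G \<bar>h\<bar>) has_real_derivative G \<bar>h\<bar> + \<bar>h\<bar> * G' \<bar>h\<bar>) (at h)"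
proof (cases "h = 0")
  case True
  have "isCont G 0" using assms DERIV_isCont by blast
  then have "isCont G \<bar>0\<bar>" by simp
  then have "isCont (\<lambda>h. G \<bar>h\<bar>) 0" by (rule isCont_o2[rotated]) (rule isCont_rabs[OF continuous_ident])
  then have L: "((\<lambda>h. G \<bar>h\<bar>) \<longlongrightarrow> G 0) (at 0)" by (simp add: isCont_def)
  have "eventually (\<lambda>h. G \<bar>h\<bar> = (h * G \<bar>h\<bar>) / h) (at (0::real))"
    by (simp add: eventually_at_filter)
  with L have "((\<lambda>h. (h * G \<bar>h\<bar>) / h) \<longlongrightarrow> G 0) (at 0)"
    by (rule Lim_transform_eventually)
  then show ?thesis using True by (simp add: has_field_derivative_iff)
next
  case False
  have "((\<lambda>h. h * G \<bar>h\<bar>) has_real_derivative 1 * G \<bar>h\<bar> + G' \<bar>h\<bar> * sgn h * h) (at h)"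
    by (rule DERIV_mult[OF DERIV_ident DERIV_chain2[OF assms DERIV_abs[OF False]]])
  moreover have "1 * G \<bar>h\<bar> + G' \<bar>h\<bar> * sgn h * h = G \<bar>h\<bar> + \<bar>h\<bar> * G' \<bar>h\<bar>"
  proof -
    have "sgn h * h = \<bar>h\<bar>" by (simp add: sgn_if)
    then show ?thesis by (metis mult.commute mult.assoc mult_1)
  qed
  ultimately show ?thesis by (simp only:)
qed

text \<open>The factor \<open>x\<close> makes the derivative of \<open>G\<close> vanish at 0. There
  the quotient of the composition at \<open>h\<close> is, up to sign, the quotient of
  \<open>G\<close> at \<open>\<bar>h\<bar>\<close>, so it tends to 0 too.\<close>

lemma DERIV_abs_comp:
  fixes G H :: "real \<Rightarrow> real"
  assumes "\<And>x. (G has_real_derivative x * H x) (at x)"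
  shows "((\<lambda>h. G \<bar>h\<bar>) has_real_derivative h * H \<bar>h\<bar>) (at h)"
proof (cases "h = 0")
  case True
  have "(G has_real_derivative 0) (at 0)" using assms[of 0] by simp
  then have L: "((\<lambda>h. (G h - G 0) / h) \<longlongrightarrow> 0) (at 0)" by (simp add: has_field_derivative_iff)
  have "((\<lambda>h. \<bar>(G \<bar>h\<bar> - G 0) / \<bar>h\<bar>\<bar>) \<longlongrightarrow> 0) (at 0)"
  proof -
    have "filterlim (\<lambda>h::real. \<bar>h\<bar>) (at 0) (at 0)"
      unfolding filterlim_at
      by (auto intro!: tendsto_rabs_zero tendsto_ident_at simp: eventually_at_filter)
    from tendsto_rabs_zero[OF filterlim_compose[OF L this]] show ?thesis by simp
  qed
  then have "((\<lambda>h. \<bar>(G \<bar>h\<bar> - G 0) / h\<bar>) \<longlongrightarrow> 0) (at 0)" by (simp add: abs_divide)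
  then have "((\<lambda>h. (G \<bar>h\<bar> - G 0) / h) \<longlongrightarrow> 0) (at 0)" by (rule tendsto_rabs_zero_cancel)
  then show ?thesis using True by (simp add: has_field_derivative_iff)
next
  case False
  have 2: "\<bar>h\<bar> * H \<bar>h\<bar> * sgn h = h * H \<bar>h\<bar>"
    by (metis mult.commute mult.left_commute sgn_mult_abs)
  show ?thesis using DERIV_chain2[OF assms[of "\<bar>h\<bar>"] DERIV_abs[OF False]] unfolding 2 .
qed

text \<open>With t = x / \<rho> > 0 this is, up to a constant, t^(p + 1/2) K(t), where K is the
  modified Bessel function of the second kind of order p + 1/2. The sum is a rescaled reverse Bessel
  polynomial.\<close>

definition bessel_exp :: "nat \<Rightarrow> real \<Rightarrow> real \<Rightarrow> real" where
  "bessel_exp p \<rho> x = exp (- x / \<rho>) *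
     (\<Sum>k=0..p. fact (2 * p - k) / (fact (p - k) * fact k) * (2 / \<rho>) ^ k * x ^ k)"

lemma matern_eq: "matern p \<sigma> \<rho> h = \<sigma>\<^sup>2 * (fact p / fact (2 * p)) * bessel_exp p \<rho> \<bar>h\<bar>"
  by (simp add: matern_def bessel_exp_def)

text \<open>The coefficient of x^k in S_(p+1)' - S_(p+1) / \<rho> = - (2 / \<rho>^2) x S_p, where
  S_p is the polynomial factor of \<open>bessel_exp p\<close>. The extreme coefficients, k = 0 and k
  = p + 1, are treated in \<open>DERIV_bessel_exp_Suc\<close>.\<close>

lemma bessel_exp_coeff:
  fixes \<rho> :: real
  assumes "\<rho> > 0" "1 \<le> k" "k \<le> p"
  defines "A \<equiv> (\<lambda>p k. fact (2 * p - k) / (fact (p - k) * fact k) * (2 / \<rho>) ^ k)"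
  shows "real (Suc k) * A (Suc p) (Suc k) - A (Suc p) k / \<rho> = - (2 / \<rho>\<^sup>2) * A p (k - 1)"
proof -
  obtain j where j: "k = Suc j" using assms(2) by (cases k) auto
  obtain r where r: "p = Suc j + r" using assms(3) j by (metis le_Suc_ex)
  \<comment> \<open>This resolves the truncated subtractions: with k = j + 1 and p = j + 1 + r, both
    2 (p + 1) - (k + 1) and 2 p - (k - 1) equal \<open>N\<close>.\<close>
  define N where "N = j + 2 * r + 2"
  have e: "Suc p - Suc k = r" "Suc p - k = Suc r" "2 * Suc p - Suc k = N" "2 * Suc p - k = Suc N"
     "p - j = Suc r" "2 * p - j = N" "k - 1 = j" using j r by (auto simp: N_def)
  define F :: real where "F = fact N"
  define f :: real where "f = fact r"
  define g :: real where "g = fact j"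
  define x where "x = (2 / \<rho>) ^ j"
  define u where "u = real j + 1"
  define v where "v = real j + 2"
  define w where "w = real r + 1"
  define y where "y = 1 / \<rho>"
  have pos: "f > 0" "g > 0" "u > 0" "v > 0" "w > 0" by (auto simp: f_def g_def u_def v_def w_def)
  \<comment> \<open>Over a common denominator the two terms on the left have numerators 2 w and u +
    2 w, and their difference - u cancels the factor u below.\<close>
  have N: "real N + 1 = u + 2 * w" by (simp add: N_def u_def w_def)
  have f1: "fact (Suc j) = u * g" "fact (Suc (Suc j)) = v * (u * g)" "fact (Suc r) = w * f"
    "fact (Suc N) = (u + 2 * w) * F"
    using N by (simp_all add: g_def f_def F_def u_def v_def w_def algebra_simps)
  have xs: "(2 / \<rho>) ^ Suc j = 2 * y * x" "(2 / \<rho>) ^ Suc (Suc j) = 2 * y * (2 * y * x)"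
    "2 / \<rho>\<^sup>2 = 2 * y\<^sup>2"
    by (simp_all add: x_def y_def power2_eq_square)
  have a1: "A (Suc p) (Suc k) = F / (f * (v * (u * g))) * (2 * y * (2 * y * x))"
    unfolding A_def e unfolding j f1 xs F_def f_def ..
  have a2: "A (Suc p) k = (u + 2 * w) * F / (w * f * (u * g)) * (2 * y * x)"
    unfolding A_def e unfolding j f1 xs ..
  have a3: "A p (k - 1) = F / (w * f * g) * x"
    unfolding A_def e unfolding f1 F_def g_def x_def ..
  have "real (Suc k) * A (Suc p) (Suc k) - A (Suc p) k / \<rho> =
      v * (F / (f * (v * (u * g))) * (2 * y * (2 * y * x))) - (u + 2 * w) * F / (w * f * (u * g)) * (2 * y * x) * y"
  proof -
    have "real (Suc k) = v" "A (Suc p) k / \<rho> = A (Suc p) k * y" by (simp_all add: v_def j y_def)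
    then show ?thesis unfolding a1 a2 by (simp only:)
  qed
  also have "\<dots> = - (2 * y\<^sup>2) * (F / (w * f * g) * x)"
    using pos by (simp add: divide_simps power2_eq_square) (simp add: algebra_simps)
  finally show ?thesis unfolding a3 xs .
qed

lemma DERIV_exp_neg_divide:
  "((\<lambda>x. exp (- x / \<rho>)) has_real_derivative - exp (- x / \<rho>) / \<rho>) (at x)" for \<rho> x :: real
proof -
  have "((\<lambda>x. exp (x * (- 1 / \<rho>))) has_real_derivative exp (x * (- 1 / \<rho>)) * (- 1 / \<rho>)) (at x)"
    by (intro DERIV_fun_exp DERIV_cmult_right[OF DERIV_ident, simplified])
  then show ?thesis by simp
qed

text \<open>The Bessel recurrence that the derivative of t^\<nu> K_\<nu> is - t^\<nu> K_(\<nu> - 1),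
  checked on coefficients. The factor \<open>x\<close> in the result is the one that
  \<open>DERIV_abs_comp\<close> requires.\<close>

lemma DERIV_bessel_exp_Suc:
  assumes "\<rho> > 0"
  shows "(bessel_exp (Suc p) \<rho> has_real_derivative x * (- (2 / \<rho>\<^sup>2) * bessel_exp p \<rho> x)) (at x)"
proof -
  define A :: "nat \<Rightarrow> nat \<Rightarrow> real"
    where "A = (\<lambda>p k. fact (2 * p - k) / (fact (p - k) * fact k) * (2 / \<rho>) ^ k)"
  define S where "S = (\<lambda>x. \<Sum>k=0..Suc p. A (Suc p) k * x ^ k)"
  define S' where "S' = (\<lambda>x. \<Sum>k=0..p. real (Suc k) * A (Suc p) (Suc k) * x ^ k)"
  have b: "bessel_exp p \<rho> = (\<lambda>x. exp (- x / \<rho>) * (\<Sum>k=0..p. A p k * x ^ k))" for p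
    by (simp add: bessel_exp_def A_def fun_eq_iff)
  have S: "S = (\<lambda>x. A (Suc p) 0 + (\<Sum>k=0..p. A (Suc p) (Suc k) * x ^ Suc k))"
    unfolding S_def by (simp add: sum.atLeast0_atMost_Suc_shift del: sum.cl_ivl_Suc)
  have dS: "(S has_real_derivative S' x) (at x)" for x
    unfolding S S'_def
    by (auto intro!: derivative_eq_intros sum.cong simp: algebra_simps simp del: power_Suc)
  \<comment> \<open>The coefficient of x^(p + 1), to which the derivative of S does not
    contribute.\<close>
  have top: "A (Suc p) (Suc p) / \<rho> = (2 / \<rho>\<^sup>2) * A p p"
    using assms by (simp add: A_def power2_eq_square)
  \<comment> \<open>The constant term of S' - S / \<rho> vanishes; this is what makes the derivative
    divisible by \<open>x\<close>.\<close>
  have zero: "A (Suc p) 1 = A (Suc p) 0 / \<rho>"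
  proof -
    define F :: real where "F = fact (Suc (2 * p))"
    define f :: real where "f = fact p"
    define w where "w = real p + 1"
    have pos: "f > 0" "w > 0" by (auto simp: f_def w_def)
    have *: "2 * Suc p - 1 = Suc (2 * p)" "2 * Suc p - 0 = Suc (Suc (2 * p))" "Suc p - 1 = p" "Suc p - 0 = Suc p"
      by auto
    have ff: "fact (Suc (Suc (2 * p))) = 2 * w * F" "fact (Suc p) = w * f"
      by (simp_all add: F_def f_def w_def algebra_simps)
    have "A (Suc p) 1 = F / (f * 1) * (2 / \<rho>)" "A (Suc p) 0 = 2 * w * F / (w * f * 1)"
      unfolding A_def * unfolding ff by (simp_all add: F_def f_def)
    then show ?thesis using pos assms by simp
  qed
  have "S' x - S x / \<rho> = - (2 / \<rho>\<^sup>2) * (x * (\<Sum>k=0..p. A p k * x ^ k))"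
  proof -
    have 1: "(\<Sum>k=0..p. (real (Suc k) * A (Suc p) (Suc k) - A (Suc p) k / \<rho>) * x ^ k)
        = (\<Sum>k\<in>{1..p}. (real (Suc k) * A (Suc p) (Suc k) - A (Suc p) k / \<rho>) * x ^ k)"
      by (rule sum.mono_neutral_right) (use zero in \<open>auto simp: not_less_eq_eq\<close>)
    have "S' x - S x / \<rho> = (\<Sum>k=0..p. real (Suc k) * A (Suc p) (Suc k) * x ^ k) -
        (\<Sum>k=0..p. A (Suc p) k * x ^ k) / \<rho> - A (Suc p) (Suc p) / \<rho> * x ^ Suc p"
      unfolding S_def S'_def by (simp add: add_divide_distrib)
    also have "\<dots> = (\<Sum>k=0..p. (real (Suc k) * A (Suc p) (Suc k) - A (Suc p) k / \<rho>) * x ^ k)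
         - A (Suc p) (Suc p) / \<rho> * x ^ Suc p"
      by (simp add: sum_subtractf sum_divide_distrib left_diff_distrib)
    also have "\<dots> = (\<Sum>k\<in>{1..p}. - (2 / \<rho>\<^sup>2) * A p (k - 1) * x ^ k) - (2 / \<rho>\<^sup>2) * A p p * x ^ Suc p"
      unfolding 1 top
      by (intro arg_cong2[of _ _ _ _ minus] sum.cong refl, unfold A_def)
        (use bessel_exp_coeff[OF assms] in auto)
    also have "(\<Sum>k\<in>{1..p}. - (2 / \<rho>\<^sup>2) * A p (k - 1) * x ^ k) = - (2 / \<rho>\<^sup>2) * (\<Sum>k\<in>{1..p}. A p (k - 1) * x ^ k)"
      by (simp only: sum_distrib_left mult.assoc)
    also have "- (2 / \<rho>\<^sup>2) * (\<Sum>k\<in>{1..p}. A p (k - 1) * x ^ k) - (2 / \<rho>\<^sup>2) * A p p * x ^ Suc p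
       = - (2 / \<rho>\<^sup>2) * ((\<Sum>k\<in>{1..p}. A p (k - 1) * x ^ k) + A p p * x ^ Suc p)"
      by (simp only: distrib_left mult.assoc mult_minus_left diff_conv_add_uminus)
    also have "(\<Sum>k\<in>{1..p}. A p (k - 1) * x ^ k) + A p p * x ^ Suc p = (\<Sum>k\<in>{1..Suc p}. A p (k - 1) * x ^ k)"
      by simp
    also have "\<dots> = (\<Sum>k=0..p. A p k * x ^ Suc k)"
      using sum.shift_bounds_cl_Suc_ivl[of "\<lambda>k. A p (k - 1) * x ^ k" 0 p] by simp
    also have "\<dots> = x * (\<Sum>k=0..p. A p k * x ^ k)"
      by (simp add: sum_distrib_left algebra_simps)
    finally show ?thesis .
  qed
  then have e: "exp (- x / \<rho>) * S' x - exp (- x / \<rho>) / \<rho> * S x = x * (- (2 / \<rho>\<^sup>2) * bessel_exp p \<rho> x)"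
  proof -
    assume h: "S' x - S x / \<rho> = - (2 / \<rho>\<^sup>2) * (x * (\<Sum>k=0..p. A p k * x ^ k))"
    have "exp (- x / \<rho>) * S' x - exp (- x / \<rho>) / \<rho> * S x = exp (- x / \<rho>) * (S' x - S x / \<rho>)"
      by (simp add: right_diff_distrib)
    then show ?thesis unfolding h b by (simp add: mult_ac)
  qed
  have "((\<lambda>x. exp (- x / \<rho>) * S x) has_real_derivative
      exp (- x / \<rho>) * S' x - exp (- x / \<rho>) / \<rho> * S x) (at x)"
    using DERIV_mult[OF DERIV_exp_neg_divide dS] by (simp add: mult_ac)
  then show ?thesis unfolding e by (simp add: b S_def)
qed

lemma lip_smooth_exp_abs:
  assumes "\<rho> > 0"
  shows "lip_smooth 0 (\<lambda>h. exp (- \<bar>h\<bar> / \<rho>))"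
  unfolding lip_smooth.simps
proof
  fix R :: real
  show "\<exists>C. \<forall>x y. \<bar>x\<bar> \<le> R \<longrightarrow> \<bar>y\<bar> \<le> R \<longrightarrow> \<bar>exp (- \<bar>x\<bar> / \<rho>) - exp (- \<bar>y\<bar> / \<rho>)\<bar> \<le> C * \<bar>x - y\<bar>"
  proof (intro exI[of _ "1 / \<rho>"] allI impI)
    fix x y :: real
    have "norm (exp (- \<bar>x\<bar> / \<rho>) - exp (- \<bar>y\<bar> / \<rho>)) \<le> (1 / \<rho>) * norm (\<bar>x\<bar> - \<bar>y\<bar>)"
    proof (rule field_differentiable_bound[of "{0..}" "\<lambda>x. exp (- x / \<rho>)" "\<lambda>x. - exp (- x / \<rho>) / \<rho>"])
      show "((\<lambda>x. exp (- x / \<rho>)) has_real_derivative - exp (- z / \<rho>) / \<rho>) (at z within {0..})" for z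
        by (rule has_field_derivative_at_within[OF DERIV_exp_neg_divide])
    qed (use assms in \<open>auto simp: divide_simps\<close>)
    also have "\<dots> \<le> (1 / \<rho>) * \<bar>x - y\<bar>" using assms by (intro mult_left_mono) auto
    finally show "\<bar>exp (- \<bar>x\<bar> / \<rho>) - exp (- \<bar>y\<bar> / \<rho>)\<bar> \<le> 1 / \<rho> * \<bar>x - y\<bar>" by simp
  qed
qed

text \<open>Each power of \<open>h\<close> buys one derivative of the exponential with a kink. The
  two families are proved together because they feed each other: differentiating the exponential
  turns h into |h|, and h |h| into h^2.\<close>

lemma lip_smooth_power_exp:
  assumes "\<rho> > 0"
  shows "(\<forall>i\<ge>j. lip_smooth j (\<lambda>h. h ^ i * exp (- \<bar>h\<bar> / \<rho>))) \<and>
         (\<forall>i\<ge>j. lip_smooth j (\<lambda>h. \<bar>h\<bar> * h ^ i * exp (- \<bar>h\<bar> / \<rho>)))"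
proof (induction j)
  case 0
  show ?case
    by (intro conjI allI impI lip_smooth_0_mult lip_smooth_0_power lip_smooth_exp_abs assms
        lip_smooth_0_abs_comp[OF lip_smooth_id])
next
  case (Suc j)
  define E where "E = (\<lambda>h. exp (- \<bar>h\<bar> / \<rho>))"
  have A: "lip_smooth j (\<lambda>h. h ^ i * E h)" if "i \<ge> j" for i using Suc that by (simp add: E_def)
  have B: "lip_smooth j (\<lambda>h. \<bar>h\<bar> * h ^ i * E h)" if "i \<ge> j" for i using Suc that by (simp add: E_def)
  \<comment> \<open>Away from \<open>0\<close> these are the usual derivatives; one factor \<open>h\<close> removes the singularity at \<open>0\<close>.\<close>
  have hE: "((\<lambda>h. h * E h) has_real_derivative E h - \<bar>h\<bar> * E h / \<rho>) (at h)" for h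
    using DERIV_times_abs_comp[OF DERIV_exp_neg_divide[of \<rho>], of h] by (simp add: E_def)
  have aE: "((\<lambda>h. h * \<bar>h\<bar> * E h) has_real_derivative 2 * \<bar>h\<bar> * E h - h\<^sup>2 * E h / \<rho>) (at h)" for h
  proof -
    have f: "(\<lambda>h. h * \<bar>h\<bar> * E h) = (\<lambda>h. h * (\<bar>h\<bar> * exp (- \<bar>h\<bar> / \<rho>)))" by (simp add: E_def mult_ac)
    have e: "\<bar>h\<bar> * exp (- \<bar>h\<bar> / \<rho>) + \<bar>h\<bar> * (1 * exp (- \<bar>h\<bar> / \<rho>) + (- exp (- \<bar>h\<bar> / \<rho>) / \<rho>) * \<bar>h\<bar>)
      = 2 * \<bar>h\<bar> * E h - h\<^sup>2 * E h / \<rho>"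
      by (simp add: E_def power2_eq_square algebra_simps)
    show ?thesis
      using DERIV_times_abs_comp[OF DERIV_mult[OF DERIV_ident DERIV_exp_neg_divide[of \<rho>]], of h]
      unfolding f e .
  qed
  have "lip_smooth (Suc j) (\<lambda>h. h ^ i * E h)" if i: "i \<ge> Suc j" for i
  proof -
    obtain r where r: "i = Suc r" "r \<ge> j" using i by (cases i) auto
    have "((\<lambda>h. h ^ i * E h) has_real_derivative (real r + 1) * (h ^ r * E h) + (- 1 / \<rho>) * (\<bar>h\<bar> * h ^ r * E h)) (at h)" for h
    proof -
      have f: "(\<lambda>h. h ^ i * E h) = (\<lambda>h. h ^ r * (h * E h))"
        unfolding r(1) power_Suc by (intro ext) (simp only: mult.assoc mult.left_commute)
      have e: "real r * h ^ (r - Suc 0) * (h * E h) + (E h - \<bar>h\<bar> * E h / \<rho>) * h ^ r =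
         (real r + 1) * (h ^ r * E h) + (- 1 / \<rho>) * (\<bar>h\<bar> * h ^ r * E h)"
        by (cases r) (simp_all add: algebra_simps)
      show ?thesis using DERIV_mult[OF DERIV_pow[of r] hE[of h]] unfolding f e .
    qed
    then show ?thesis unfolding lip_smooth.simps
      by (intro exI[of _ "\<lambda>h. (real r + 1) * (h ^ r * E h) + (- 1 / \<rho>) * (\<bar>h\<bar> * h ^ r * E h)"] conjI allI
          lip_smooth_add lip_smooth_cmult A B r(2)) auto
  qed
  moreover have "lip_smooth (Suc j) (\<lambda>h. \<bar>h\<bar> * h ^ i * E h)" if i: "i \<ge> Suc j" for i
  proof -
    obtain r where r: "i = Suc r" "r \<ge> j" using i by (cases i) auto
    have "((\<lambda>h. \<bar>h\<bar> * h ^ i * E h) has_real_derivative (real r + 2) * (\<bar>h\<bar> * h ^ r * E h) + (- 1 / \<rho>) * (h ^ (r + 2) * E h)) (at h)" for h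
    proof -
      have f: "(\<lambda>h. \<bar>h\<bar> * h ^ i * E h) = (\<lambda>h. h ^ r * (h * \<bar>h\<bar> * E h))"
        unfolding r(1) power_Suc by (intro ext) (simp only: mult.assoc mult.left_commute)
      have e: "real r * h ^ (r - Suc 0) * (h * \<bar>h\<bar> * E h) + (2 * \<bar>h\<bar> * E h - h\<^sup>2 * E h / \<rho>) * h ^ r =
         (real r + 2) * (\<bar>h\<bar> * h ^ r * E h) + (- 1 / \<rho>) * (h ^ (r + 2) * E h)"
        by (cases r) (simp_all add: algebra_simps power2_eq_square)
      show ?thesis using DERIV_mult[OF DERIV_pow[of r] aE[of h]] unfolding f e .
    qed
    then show ?thesis unfolding lip_smooth.simps
      by (intro exI[of _ "\<lambda>h. (real r + 2) * (\<bar>h\<bar> * h ^ r * E h) + (- 1 / \<rho>) * (h ^ (r + 2) * E h)"] conjI allI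
          lip_smooth_add lip_smooth_cmult A B) (use r in auto)
  qed
  ultimately show ?case by (simp add: E_def)
qed

text \<open>Differentiation lowers the weight 2p + i by exactly one: h^i B_p goes to multiples of
  h^(i - 1) B_p and h^(i + 1) B_(p - 1), both of weight 2p + i - 1. At p = 0 the count is that of
  \<open>lip_smooth_power_exp\<close>.\<close>

lemma lip_smooth_power_bessel_exp:
  assumes "\<rho> > 0"
  shows "n \<le> 2 * p + i \<Longrightarrow> lip_smooth n (\<lambda>h. h ^ i * bessel_exp p \<rho> \<bar>h\<bar>)"
proof (induction n arbitrary: p i)
  case 0
  have "lip_smooth 0 (\<lambda>x. bessel_exp p \<rho> \<bar>x\<bar>)"
  proof (cases p)
    case 0
    then show ?thesis using lip_smooth_exp_abs[OF assms] by (simp add: bessel_exp_def del: lip_smooth.simps)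
  next
    case (Suc q)
    have *: "lip_smooth 0 (\<lambda>x. \<Sum>k\<in>A. c k * x ^ k)" if "finite A" for A :: "nat set" and c
      using that by induction
        (auto simp del: lip_smooth.simps intro!: lip_smooth_add lip_smooth_cmult lip_smooth_0_power lip_smooth_const)
    have "lip_smooth 0 (\<lambda>x. (exp (- \<bar>x\<bar> / \<rho>)) * (\<Sum>k=0..p. fact (2 * p - k) / (fact (p - k) * fact k) * (2 / \<rho>) ^ k * \<bar>x\<bar> ^ k))"
      by (intro lip_smooth_0_mult lip_smooth_exp_abs[OF assms] *[THEN lip_smooth_0_abs_comp]) auto
    then show ?thesis by (simp add: bessel_exp_def del: lip_smooth.simps)
  qed
  then show ?case by (intro lip_smooth_0_mult lip_smooth_0_power)
next
  case (Suc n)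
  show ?case
  proof (cases p)
    case 0
    then show ?thesis using lip_smooth_power_exp[OF assms, of "Suc n"] Suc.prems
      by (simp add: bessel_exp_def del: lip_smooth.simps)
  next
    case (Suc q)
    let ?b = "\<lambda>p h. bessel_exp p \<rho> \<bar>h\<bar>"
    have D: "(?b p has_real_derivative h * (- (2 / \<rho>\<^sup>2) * ?b q h)) (at h)" for h
      unfolding Suc by (rule DERIV_abs_comp) (rule DERIV_bessel_exp_Suc[OF assms])
    show ?thesis
    proof (cases i)
      case 0
      have "lip_smooth n (\<lambda>h. - (2 / \<rho>\<^sup>2) * (h ^ 1 * ?b q h))"
        by (intro lip_smooth_cmult Suc.IH) (use Suc.prems 0 Suc in auto)
      then show ?thesis using D 0 unfolding lip_smooth.simps
        by (intro exI[of _ "\<lambda>h. - (2 / \<rho>\<^sup>2) * (h ^ 1 * ?b q h)"]) (auto simp: mult_ac)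
    next
      case (Suc r)
      have "((\<lambda>h. h ^ i * ?b p h) has_real_derivative real i * (h ^ r * ?b p h) + (- (2 / \<rho>\<^sup>2)) * (h ^ (i + 1) * ?b q h)) (at h)" for h
        using DERIV_mult[OF DERIV_pow[of i] D[of h]] by (simp add: Suc mult_ac)
      moreover have "lip_smooth n (\<lambda>h. real i * (h ^ r * ?b p h) + (- (2 / \<rho>\<^sup>2)) * (h ^ (i + 1) * ?b q h))"
        by (intro lip_smooth_add lip_smooth_cmult Suc.IH) (use Suc.prems Suc \<open>p = Suc q\<close> in auto)
      ultimately show ?thesis unfolding lip_smooth.simps by (intro exI conjI allI)
    qed
  qed
qed

lemma lip_smooth_matern:
  assumes "\<rho> > 0"
  shows "lip_smooth (2 * p) (matern p \<sigma> \<rho>)"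
  using lip_smooth_cmult[OF lip_smooth_power_bessel_exp[OF assms, of "2 * p" p 0], of "\<sigma>\<^sup>2 * (fact p / fact (2 * p))"]
  by (simp add: matern_eq[abs_def])

section \<open>Mean-square limits\<close>

text \<open>By monotone convergence the sum has a finite integral, hence is finite almost
  everywhere. This takes the place of the Borel-Cantelli lemma in the later almost sure
  arguments.\<close>

lemma AE_summable:
  fixes f :: "nat \<Rightarrow> 'a \<Rightarrow> real"
  assumes "\<And>n. integrable M (f n)" "\<And>n x. 0 \<le> f n x" "summable (\<lambda>n. integral\<^sup>L M (f n))"
  shows "AE x in M. summable (\<lambda>n. f n x)"
proof -
  have [measurable]: "f n \<in> borel_measurable M" for n using assms(1) by auto
  have "(\<integral>\<^sup>+x. (\<Sum>n. ennreal (f n x)) \<partial>M) = (\<Sum>n. \<integral>\<^sup>+x. ennreal (f n x) \<partial>M)"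
    by (intro nn_integral_suminf) auto
  also have "\<dots> = (\<Sum>n. ennreal (integral\<^sup>L M (f n)))"
    by (intro suminf_cong nn_integral_eq_integral assms) (auto simp: assms)
  also have "\<dots> = ennreal (\<Sum>n. integral\<^sup>L M (f n))"
    by (intro suminf_ennreal2 assms integral_nonneg_AE) (auto simp: assms)
  finally have "AE x in M. (\<Sum>n. ennreal (f n x)) \<noteq> \<infinity>"
    by (intro nn_integral_PInf_AE) auto
  then show ?thesis
    by eventually_elim (auto intro!: summable_suminf_not_top assms)
qed

text \<open>Fatou's lemma with bounds \<open>B n\<close> that vary with \<open>n\<close>: the moment
  bounds passed to the limit later contain second moments that merely converge.\<close>

lemma fatou_integrable:
  fixes f :: "nat \<Rightarrow> 'a \<Rightarrow> real"
  assumes f: "\<And>n. integrable M (f n)" "\<And>n x. 0 \<le> f n x" and g[measurable]: "g \<in> borel_measurable M"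
    and lim: "AE x in M. (\<lambda>n. f n x) \<longlonglongrightarrow> g x"
    and B: "\<And>n. integral\<^sup>L M (f n) \<le> B n" "B \<longlonglongrightarrow> b"
  shows "integrable M g" "integral\<^sup>L M g \<le> b"
proof -
  have [measurable]: "f n \<in> borel_measurable M" for n using f(1) by auto
  have nn: "AE x in M. 0 \<le> g x" using lim by eventually_elim (rule LIMSEQ_le_const[where a=0], auto simp: f)
  have B0: "0 \<le> B n" for n using B(1)[of n] f by (meson Bochner_Integration.integral_nonneg order_trans)
  have b0: "0 \<le> b" using B(2) B0 by (intro LIMSEQ_le_const[where a=0]) auto
  have "(\<integral>\<^sup>+x. ennreal (g x) \<partial>M) = (\<integral>\<^sup>+x. liminf (\<lambda>n. ennreal (f n x)) \<partial>M)"
    using lim by (intro nn_integral_cong_AE, eventually_elim)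
      (auto intro!: lim_imp_Liminf[symmetric])
  also have "\<dots> \<le> liminf (\<lambda>n. \<integral>\<^sup>+x. ennreal (f n x) \<partial>M)"
    by (rule nn_integral_liminf) auto
  also have "\<dots> \<le> liminf (\<lambda>n. ennreal (B n))"
    using f B by (intro Liminf_mono always_eventually allI) (auto simp: nn_integral_eq_integral intro!: ennreal_leI)
  also have "\<dots> = ennreal b" by (intro lim_imp_Liminf tendsto_ennrealI B) auto
  finally have *: "(\<integral>\<^sup>+x. ennreal (g x) \<partial>M) \<le> ennreal b" .
  show i: "integrable M g"
    unfolding integrable_iff_bounded
  proof
    have "(\<integral>\<^sup>+x. ennreal (norm (g x)) \<partial>M) = (\<integral>\<^sup>+x. ennreal (g x) \<partial>M)"
      using nn by (intro nn_integral_cong_AE, eventually_elim) auto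
    also have "\<dots> < \<infinity>" using * by (auto simp: less_top[symmetric] top_unique)
    finally show "(\<integral>\<^sup>+x. ennreal (norm (g x)) \<partial>M) < \<infinity>" .
  qed auto
  show "integral\<^sup>L M g \<le> b"
    using * nn_integral_eq_integral[OF i nn] b0 by auto
qed

section \<open>Square-integrable functions and their inner products\<close>

definition sq_integrable :: "'a measure \<Rightarrow> ('a \<Rightarrow> real) \<Rightarrow> bool" where
  "sq_integrable M f \<longleftrightarrow> f \<in> borel_measurable M \<and> integrable M (\<lambda>x. (f x)\<^sup>2)"

lemma sq_integrable_mult:
  assumes "sq_integrable M f" "sq_integrable M g"
  shows "integrable M (\<lambda>x. f x * g x)"
proof (rule Bochner_Integration.integrable_bound[where f = "\<lambda>x. (f x)\<^sup>2 + (g x)\<^sup>2"])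
  have "\<bar>u * v\<bar> \<le> u\<^sup>2 + v\<^sup>2" for u v :: real
    using zero_le_power2[of "\<bar>u\<bar> - \<bar>v\<bar>"] zero_le_mult_iff[of "\<bar>u\<bar>" "\<bar>v\<bar>"]
    by (simp add: power2_diff abs_mult)
      (use mult_nonneg_nonneg[OF abs_ge_zero abs_ge_zero, of u v] in linarith)
  then show "AE x in M. norm (f x * g x) \<le> norm ((f x)\<^sup>2 + (g x)\<^sup>2)" by simp
qed (use assms in \<open>auto simp: sq_integrable_def\<close>)

lemma sq_integrable_add:
  assumes "sq_integrable M f" "sq_integrable M g"
  shows "sq_integrable M (\<lambda>x. f x + g x)"
  using assms sq_integrable_mult[OF assms] by (auto simp: sq_integrable_def power2_sum mult.assoc)

lemma sq_integrable_cmult: "sq_integrable M f \<Longrightarrow> sq_integrable M (\<lambda>x. c * f x)"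
  by (auto simp: sq_integrable_def power_mult_distrib)

lemma sq_integrable_diff:
  assumes "sq_integrable M f" "sq_integrable M g"
  shows "sq_integrable M (\<lambda>x. f x - g x)"
  using sq_integrable_add[OF assms(1) sq_integrable_cmult[OF assms(2), of "-1"]] by simp

text \<open>The integral of (f + t g)^2 is a nonnegative quadratic in t; its value at the minimum t
  = - b / c is the inequality.\<close>

lemma integral_Cauchy_Schwarz:
  assumes "sq_integrable M f" "sq_integrable M g"
  shows "(\<integral>x. f x * g x \<partial>M)\<^sup>2 \<le> (\<integral>x. (f x)\<^sup>2 \<partial>M) * (\<integral>x. (g x)\<^sup>2 \<partial>M)"
proof -
  define a where "a = (\<integral>x. (f x)\<^sup>2 \<partial>M)"
  define b where "b = (\<integral>x. f x * g x \<partial>M)"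
  define c where "c = (\<integral>x. (g x)\<^sup>2 \<partial>M)"
  have q: "0 \<le> a + 2 * t * b + t\<^sup>2 * c" for t
  proof -
    have "0 \<le> (\<integral>x. (f x + t * g x)\<^sup>2 \<partial>M)" by simp
    also have "(\<lambda>x. (f x + t * g x)\<^sup>2) = (\<lambda>x. (f x)\<^sup>2 + 2 * t * (f x * g x) + t\<^sup>2 * (g x)\<^sup>2)"
      by (auto simp: power2_eq_square algebra_simps)
    also have "(\<integral>x. (f x)\<^sup>2 + 2 * t * (f x * g x) + t\<^sup>2 * (g x)\<^sup>2 \<partial>M) = a + 2 * t * b + t\<^sup>2 * c"
      using assms sq_integrable_mult[OF assms] by (simp add: a_def b_def c_def sq_integrable_def)
    finally show ?thesis .
  qed
  have "c \<ge> 0" by (simp add: c_def)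
  show ?thesis
  proof (cases "c = 0")
    case True
    have "b = 0"
    proof (rule ccontr)
      assume "b \<noteq> 0"
      \<comment> \<open>A linear function that is not constant takes negative values: this t makes a
        + 2 t b equal to -1.\<close>
      then show False using q[of "- (a + 1) / (2 * b)"] True by (simp add: field_simps)
    qed
    then show ?thesis using True by (simp add: a_def[symmetric] b_def[symmetric] c_def[symmetric])
  next
    case False
    with \<open>c \<ge> 0\<close> have "c > 0" by simp
    have "0 \<le> a - b\<^sup>2 / c" using q[of "- b / c"] False by (simp add: power2_eq_square)
    then have "b\<^sup>2 \<le> a * c" using \<open>c > 0\<close> by (simp add: divide_simps mult.commute split: if_splits)
    then show ?thesis by (simp add: a_def b_def c_def)
  qed
qed

text \<open>Expansion around the limits leaves three error terms, each with a factor that tends to 0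
  in L2. The local claim \<open>z\<close> disposes of all three by Cauchy-Schwarz.\<close>

lemma L2_tendsto_inner:
  assumes f: "\<And>n. sq_integrable M (f n)" "sq_integrable M f0"
    and g: "\<And>n. sq_integrable M (g n)" "sq_integrable M g0"
    and lf: "(\<lambda>n. \<integral>x. (f n x - f0 x)\<^sup>2 \<partial>M) \<longlonglongrightarrow> 0"
    and lg: "(\<lambda>n. \<integral>x. (g n x - g0 x)\<^sup>2 \<partial>M) \<longlonglongrightarrow> 0"
  shows "(\<lambda>n. \<integral>x. f n x * g n x \<partial>M) \<longlonglongrightarrow> (\<integral>x. f0 x * g0 x \<partial>M)"
proof -
  have z: "(\<lambda>n. \<integral>x. u n x * v n x \<partial>M) \<longlonglongrightarrow> 0"
    if u: "\<And>n. sq_integrable M (u n)" and v: "\<And>n. sq_integrable M (v n)"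
      and l: "(\<lambda>n. (\<integral>x. (u n x)\<^sup>2 \<partial>M) * (\<integral>x. (v n x)\<^sup>2 \<partial>M)) \<longlonglongrightarrow> 0" for u v
  proof -
    have "(\<lambda>n. (\<integral>x. u n x * v n x \<partial>M)\<^sup>2) \<longlonglongrightarrow> 0"
      by (rule tendsto_sandwich[OF _ _ tendsto_const l])
        (simp_all add: always_eventually integral_Cauchy_Schwarz u v)
    then show ?thesis by simp
  qed
  note d = sq_integrable_diff[OF f(1) f(2)] sq_integrable_diff[OF g(1) g(2)]
  have eq: "(\<integral>x. f n x * g n x \<partial>M) = (\<integral>x. (f n x - f0 x) * (g n x - g0 x) \<partial>M)
     + (\<integral>x. f0 x * (g n x - g0 x) \<partial>M) + (\<integral>x. (f n x - f0 x) * g0 x \<partial>M) + (\<integral>x. f0 x * g0 x \<partial>M)" for n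
  proof -
    have "(\<lambda>x. f n x * g n x) = (\<lambda>x. (f n x - f0 x) * (g n x - g0 x) + f0 x * (g n x - g0 x) +
       (f n x - f0 x) * g0 x + f0 x * g0 x)" by (auto simp: algebra_simps)
    then show ?thesis
      using sq_integrable_mult[OF d(1)[of n] d(2)[of n]] sq_integrable_mult[OF f(2) d(2)[of n]]
        sq_integrable_mult[OF d(1)[of n] g(2)] sq_integrable_mult[OF f(2) g(2)] by simp
  qed
  have "(\<lambda>n. (\<integral>x. (f n x - f0 x) * (g n x - g0 x) \<partial>M)
     + (\<integral>x. f0 x * (g n x - g0 x) \<partial>M) + (\<integral>x. (f n x - f0 x) * g0 x \<partial>M) + (\<integral>x. f0 x * g0 x \<partial>M)) \<longlonglongrightarrow> 0 + 0 + 0 + (\<integral>x. f0 x * g0 x \<partial>M)"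
    by (intro tendsto_add z d f g tendsto_const)
      (use tendsto_mult[OF lf lg] tendsto_mult_left[OF lg] tendsto_mult_right[OF lf] in \<open>simp_all add: mult.commute\<close>)
  then show ?thesis unfolding eq by simp
qed

lemma sq_le_double: "(u + v)\<^sup>2 \<le> 2 * u\<^sup>2 + 2 * v\<^sup>2" for u v :: real
  using zero_le_power2[of "u - v"] unfolding power2_sum power2_diff by linarith

lemma even_power_divide_nonneg: "0 < e \<Longrightarrow> 0 \<le> x ^ (2 * k) / e ^ j" for x e :: real
  by (simp add: power_mult)

text \<open>If |x| > e, then multiplying |x| by (|x| / e)^(2m + 1) can only enlarge it. This is a
  pointwise form of Markov's inequality: a threshold that can be summed, plus an even power whose
  mean is under control.\<close>

lemma abs_le_add_power:
  fixes x e :: real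
  assumes "0 < e"
  shows "\<bar>x\<bar> \<le> e + x ^ (2 * Suc m) / e ^ (2 * m + 1)"
proof (cases "\<bar>x\<bar> \<le> e")
  case True
  have "0 \<le> x ^ (2 * Suc m) / e ^ (2 * m + 1)" by (rule even_power_divide_nonneg[OF assms])
  with True show ?thesis by linarith
next
  case False
  have "\<bar>x\<bar> * e ^ (2 * m + 1) \<le> \<bar>x\<bar> * \<bar>x\<bar> ^ (2 * m + 1)"
    using False assms by (intro mult_left_mono power_mono) auto
  also have "\<dots> = \<bar>x\<bar> ^ (2 * Suc m)" by simp
  also have "\<dots> = x ^ (2 * Suc m)" by (intro power_even_abs) simp
  finally have "\<bar>x\<bar> \<le> x ^ (2 * Suc m) / e ^ (2 * m + 1)" using assms by (simp add: pos_le_divide_eq)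
  with assms show ?thesis by linarith
qed

text \<open>The abstract shadow of a Gaussian Hilbert space. No law occurs in it, only moment
  bounds, so mean-square derivatives inherit what chaining needs as soon as they are L2 limits of
  members. \<open>V\<close> consists of functions, not classes: every square-integrable version of a
  limit belongs to it.\<close>

locale moment_space = prob_space M for M :: "'w measure" +
  fixes V :: "('w \<Rightarrow> real) set" and K :: "nat \<Rightarrow> real"
  assumes sq: "\<And>Y. Y \<in> V \<Longrightarrow> sq_integrable M Y"
    and add: "\<And>Y Z. Y \<in> V \<Longrightarrow> Z \<in> V \<Longrightarrow> (\<lambda>x. Y x + Z x) \<in> V"
    and cmult: "\<And>Y c. Y \<in> V \<Longrightarrow> (\<lambda>x. c * Y x) \<in> V"
    and closed: "\<And>f Y. (\<And>n. f n \<in> V) \<Longrightarrow> sq_integrable M Y \<Longrightarrow>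
        (\<lambda>n. \<integral>x. (f n x - Y x)\<^sup>2 \<partial>M) \<longlonglongrightarrow> 0 \<Longrightarrow> Y \<in> V"
    and K_nonneg: "0 \<le> K r"
    and integrable_moment: "\<And>Y r. Y \<in> V \<Longrightarrow> integrable M (\<lambda>x. (Y x) ^ (2 * r))"
    and moment: "\<And>Y r. Y \<in> V \<Longrightarrow> (\<integral>x. (Y x) ^ (2 * r) \<partial>M) \<le> K r * (\<integral>x. (Y x)\<^sup>2 \<partial>M) ^ r"
begin

lemma diff: "Y \<in> V \<Longrightarrow> Z \<in> V \<Longrightarrow> (\<lambda>x. Y x - Z x) \<in> V"
  using add[OF _ cmult[of Z "-1"]] by simp

lemma prod_integrable: "Y \<in> V \<Longrightarrow> Z \<in> V \<Longrightarrow> integrable M (\<lambda>x. Y x * Z x)"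
  by (intro sq_integrable_mult sq)

lemma sum: "finite A \<Longrightarrow> A \<noteq> {} \<Longrightarrow> (\<And>i. i \<in> A \<Longrightarrow> f i \<in> V) \<Longrightarrow> (\<lambda>x. \<Sum>i\<in>A. f i x) \<in> V"
  by (induction A rule: finite_ne_induct) (auto intro: add)

lemma sq_diff: "Y \<in> V \<Longrightarrow> Z \<in> V \<Longrightarrow>
  (\<integral>x. (Y x - Z x)\<^sup>2 \<partial>M) = (\<integral>x. Y x * Y x \<partial>M) - 2 * (\<integral>x. Y x * Z x \<partial>M) + (\<integral>x. Z x * Z x \<partial>M)"
proof -
  assume YZ: "Y \<in> V" "Z \<in> V"
  have "(\<lambda>x. (Y x - Z x)\<^sup>2) = (\<lambda>x. Y x * Y x - 2 * (Y x * Z x) + Z x * Z x)"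
    by (auto simp: power2_eq_square algebra_simps)
  then show ?thesis using prod_integrable[OF YZ] prod_integrable[OF YZ(1) YZ(1)] prod_integrable[OF YZ(2) YZ(2)]
    by simp
qed

text \<open>The geometric rate makes the whole sequence converge almost everywhere, without passing
  to a subsequence, so \<open>lim\<close> supplies a measurable limit. Convergence in L2 then
  follows from Fatou's lemma in the second index.\<close>

lemma L2_Cauchy_limit:
  assumes f: "\<And>n. f n \<in> V" and C: "\<And>n m. (\<integral>x. (f n x - f m x)\<^sup>2 \<partial>M) \<le> C * ((1/2) ^ n + (1/2) ^ m)"
  shows "\<exists>Y\<in>V. (AE x in M. (\<lambda>n. f n x) \<longlonglongrightarrow> Y x) \<and> (\<lambda>n. \<integral>x. (f n x - Y x)\<^sup>2 \<partial>M) \<longlonglongrightarrow> 0"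
proof -
  have fm[measurable]: "f n \<in> borel_measurable M" for n using sq[OF f] by (auto simp: sq_integrable_def)
  have int: "integrable M (\<lambda>x. (f n x - f m x)\<^sup>2)" for n m
    using sq[OF diff[OF f f]] by (auto simp: sq_integrable_def)
  \<comment> \<open>The weight 4/3 is a compromise: (4/3) (1/2) < 1 keeps the integrals summable,
    and its reciprocal gives the summable threshold in |x| <= (3/4)^n + (4/3)^n x^2.\<close>
  have "AE x in M. summable (\<lambda>n. (4/3) ^ n * (f (Suc n) x - f n x)\<^sup>2)"
  proof (rule AE_summable)
    show "summable (\<lambda>n. \<integral>x. (4/3) ^ n * (f (Suc n) x - f n x)\<^sup>2 \<partial>M)"
    proof (rule summable_comparison_test')
      show "summable (\<lambda>n. (3 / 2 * C) * (2/3) ^ n)" by (intro summable_mult summable_geometric) simp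
      show "norm (\<integral>x. (4/3) ^ n * (f (Suc n) x - f n x)\<^sup>2 \<partial>M) \<le> (3 / 2 * C) * (2/3) ^ n" for n
      proof -
        have "(\<integral>x. (4/3) ^ n * (f (Suc n) x - f n x)\<^sup>2 \<partial>M) \<le> (4/3) ^ n * (C * ((1/2) ^ Suc n + (1/2) ^ n))"
          using C[of "Suc n" n] by simp
        also have "\<dots> = (3 / 2 * C) * ((4/3) ^ n * (1/2) ^ n)" by (simp add: algebra_simps)
        also have "(4/3) ^ n * (1/2) ^ n = (2/3 :: real) ^ n" by (simp flip: power_mult_distrib)
        finally show ?thesis by (simp add: abs_mult)
      qed
    qed
  qed (use int in auto)
  then have conv: "AE x in M. convergent (\<lambda>n. f n x)"
  proof eventually_elim
    case (elim x)
    have "summable (\<lambda>n. f (Suc n) x - f n x)"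
    proof (rule summable_comparison_test')
      show "summable (\<lambda>n. (3/4) ^ n + (4/3) ^ n * (f (Suc n) x - f n x)\<^sup>2)"
        by (intro summable_add elim summable_geometric) simp
      show "norm (f (Suc n) x - f n x) \<le> (3/4) ^ n + (4/3) ^ n * (f (Suc n) x - f n x)\<^sup>2" for n
        using abs_le_add_power[of "(3/4) ^ n" "f (Suc n) x - f n x" 0]
        by (simp add: power_divide power2_eq_square mult_ac)
    qed
    then have "convergent (\<lambda>n. \<Sum>i<n. f (Suc i) x - f i x)"
      by (rule summable_iff_convergent[THEN iffD1])
    then have "convergent (\<lambda>n. f n x - f 0 x)"
      by (simp add: sum_lessThan_telescope[of "\<lambda>n. f n x"] del: sum_subtractf)
    from convergent_add[OF this convergent_const[of "f 0 x"]]
    show "convergent (\<lambda>n. f n x)" by simp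
  qed
  define Y where "Y = (\<lambda>x. lim (\<lambda>n. f n x))"
  have [measurable]: "Y \<in> borel_measurable M" unfolding Y_def by measurable
  have lim: "AE x in M. (\<lambda>n. f n x) \<longlonglongrightarrow> Y x"
    using conv by eventually_elim (simp add: Y_def convergent_LIMSEQ_iff)
  have F: "integrable M (\<lambda>x. (f n x - Y x)\<^sup>2)" "(\<integral>x. (f n x - Y x)\<^sup>2 \<partial>M) \<le> C * ((1/2)^n + 0)" for n
  proof -
    have l: "AE x in M. (\<lambda>m. (f n x - f m x)\<^sup>2) \<longlonglongrightarrow> (f n x - Y x)\<^sup>2"
      using lim by eventually_elim (intro tendsto_intros)
    have c: "(\<lambda>m. C * ((1/2)^n + (1/2)^m)) \<longlonglongrightarrow> C * ((1/2)^n + 0)"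
      by (intro tendsto_intros LIMSEQ_power_zero) auto
    show "integrable M (\<lambda>x. (f n x - Y x)\<^sup>2)" "(\<integral>x. (f n x - Y x)\<^sup>2 \<partial>M) \<le> C * ((1/2)^n + 0)"
      using fatou_integrable[OF int _ _ l C c] by auto
  qed
  \<comment> \<open>\<open>Y\<close> is recovered as \<open>f 0\<close> minus an error already known
    to be square-integrable.\<close>
  have "sq_integrable M (\<lambda>x. f 0 x - (f 0 x - Y x))"
    by (rule sq_integrable_diff[OF sq[OF f]]) (use F in \<open>auto simp: sq_integrable_def\<close>)
  then have Y2: "sq_integrable M Y" by simp
  have t: "(\<lambda>n. \<integral>x. (f n x - Y x)\<^sup>2 \<partial>M) \<longlonglongrightarrow> 0"
  proof (rule tendsto_sandwich[OF _ _ tendsto_const])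
    show "(\<lambda>n. C * ((1/2)^n + 0)) \<longlonglongrightarrow> 0"
      by (rule tendsto_eq_intros LIMSEQ_power_zero refl | simp)+
  qed (use F in auto)
  from closed[OF f Y2 t] lim t show ?thesis by blast
qed

end

section \<open>Continuous modifications\<close>

text \<open>The nets are the midpoints of dyadic cells: corners of cells may lie on the boundary of
  the open box, midpoints never do. The map \<open>\<pi> n\<close> sends a point to the midpoint of
  its cell.\<close>

lemma dyadic_nets:
  fixes a b :: "real ^ 'n::finite"
  assumes ab: "\<And>i. a $ i < b $ i"
  obtains net :: "nat \<Rightarrow> (real ^ 'n) set" and \<pi> :: "nat \<Rightarrow> real ^ 'n \<Rightarrow> real ^ 'n"
  where "\<And>n. finite (net n)" "\<And>n. card (net n) \<le> (2 ^ CARD('n)) ^ n" "\<And>n. net n \<subseteq> box a b"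
    "\<And>n z. z \<in> box a b \<Longrightarrow> \<pi> n z \<in> net n"
    "\<And>n z. z \<in> box a b \<Longrightarrow> norm (\<pi> n z - z) \<le> norm (b - a) * (1/2) ^ n"
proof -
  define pt :: "nat \<Rightarrow> ('n \<Rightarrow> nat) \<Rightarrow> real ^ 'n"
    where "pt = (\<lambda>n k. \<chi> i. a $ i + (b $ i - a $ i) * ((real (k i) + 1/2) / 2 ^ n))"
  define ix :: "nat \<Rightarrow> real ^ 'n \<Rightarrow> 'n \<Rightarrow> nat"
    where "ix = (\<lambda>n z i. nat \<lfloor>2 ^ n * ((z $ i - a $ i) / (b $ i - a $ i))\<rfloor>)"
  define I :: "nat \<Rightarrow> ('n \<Rightarrow> nat) set" where "I = (\<lambda>n. UNIV \<rightarrow>\<^sub>E {..<2 ^ n})"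
  have fin: "finite (I n)" and card: "card (I n) = (2 ^ n) ^ CARD('n)" for n
    by (simp_all add: I_def finite_PiE card_PiE)
  have box: "pt n k \<in> box a b" if "k \<in> I n" for n k
  proof -
    have "a $ i < pt n k $ i \<and> pt n k $ i < b $ i" for i
    proof -
      have "k i < 2 ^ n" using that by (auto simp: I_def)
      then have "real (Suc (k i)) \<le> real (2 ^ n)" unfolding of_nat_le_iff by simp
      then have "real (k i) + 1 \<le> 2 ^ n" by simp
      then have "0 < (real (k i) + 1/2) / 2 ^ n" "(real (k i) + 1/2) / 2 ^ n < 1" by (auto simp: divide_simps)
      moreover have "0 < b $ i - a $ i" using ab by simp
      ultimately have "0 < (b $ i - a $ i) * ((real (k i) + 1/2) / 2 ^ n)"
        "(b $ i - a $ i) * ((real (k i) + 1/2) / 2 ^ n) < (b $ i - a $ i) * 1"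
        by (intro mult_pos_pos mult_strict_left_mono; simp)+
      then show ?thesis by (simp add: pt_def)
    qed
    then show ?thesis by (simp add: mem_box_cart)
  qed
  have ixb: "ix n z \<in> I n" and near: "norm (pt n (ix n z) - z) \<le> norm (b - a) * (1/2) ^ n" if z: "z \<in> box a b" for n z
  proof -
    define u where "u = (\<lambda>i. (z $ i - a $ i) / (b $ i - a $ i))"
    have u: "0 < u i" "u i < 1" "z $ i = a $ i + (b $ i - a $ i) * u i" for i
      using z ab[of i] by (auto simp: u_def mem_box_cart)
    have fl: "real (ix n z i) \<le> 2 ^ n * u i" "2 ^ n * u i < real (ix n z i) + 1" for i
    proof -
      have "0 \<le> \<lfloor>2 ^ n * u i\<rfloor>" using u(1)[of i] by simp
      then have "real (ix n z i) = of_int \<lfloor>2 ^ n * u i\<rfloor>" by (simp add: ix_def u_def)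
      then show "real (ix n z i) \<le> 2 ^ n * u i" "2 ^ n * u i < real (ix n z i) + 1" by linarith+
    qed
    have lt: "real (ix n z i) < 2 ^ n" for i
    proof -
      have "2 ^ n * u i < 2 ^ n * 1" using u(2)[of i] by (intro mult_strict_left_mono) auto
      with fl(1)[of i] show ?thesis by linarith
    qed
    have "ix n z i < 2 ^ n" for i
    proof -
      have "real (ix n z i) < real (2 ^ n)" using lt[of i] by simp
      then show ?thesis unfolding of_nat_less_iff .
    qed
    then show "ix n z \<in> I n" by (auto simp: I_def PiE_UNIV_domain)
    have "norm (pt n (ix n z) - z) \<le> norm ((1/2) ^ n *\<^sub>R (b - a))"
    proof (rule norm_le_componentwise_cart)
      fix i
      have e: "(pt n (ix n z) - z) $ i = (b $ i - a $ i) * ((real (ix n z i) + 1/2) / 2 ^ n - u i)"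
        by (simp add: pt_def u(3)[of i] algebra_simps)
      have "\<bar>(real (ix n z i) + 1/2) / 2 ^ n - u i\<bar> = \<bar>real (ix n z i) + 1/2 - 2 ^ n * u i\<bar> / 2 ^ n"
        by (simp add: field_simps abs_divide)
      also have "\<dots> \<le> 1 / 2 ^ n" using fl[of i] by (intro divide_right_mono) auto
      finally have "\<bar>(real (ix n z i) + 1/2) / 2 ^ n - u i\<bar> \<le> (1/2) ^ n" by (simp add: power_divide)
      from mult_left_mono[OF this, of "\<bar>b $ i - a $ i\<bar>"]
      show "norm ((pt n (ix n z) - z) $ i) \<le> norm (((1/2) ^ n *\<^sub>R (b - a)) $ i)"
        unfolding e by (simp add: abs_mult mult.commute)
    qed
    then show "norm (pt n (ix n z) - z) \<le> norm (b - a) * (1/2) ^ n" by (simp add: mult.commute)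
  qed
  show ?thesis
  proof (rule that[of "\<lambda>n. pt n ` I n" "\<lambda>n z. pt n (ix n z)"])
    show "card (pt n ` I n) \<le> (2 ^ CARD('n)) ^ n" for n
      using card_image_le[OF fin[of n], of "pt n"] unfolding card by (simp flip: power_mult add: mult.commute)
  qed (use fin box ixb near in auto)
qed

text \<open>The deterministic half of chaining. The values at successive projections of a point form
  a Cauchy sequence with tail bounded by \<open>R n\<close>, uniformly in the point, and nearby
  points have close projections at the matching level. The 3 in the hypothesis counts two projection
  errors and the distance between the points.\<close>

lemma chaining_continuous:
  fixes f :: "'a::real_normed_vector \<Rightarrow> real"
  assumes c: "c > 0"
    and net: "\<And>n z. z \<in> T \<Longrightarrow> \<pi> n z \<in> net n" "\<And>n z. z \<in> T \<Longrightarrow> norm (\<pi> n z - z) \<le> c * (1/2) ^ n"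
    and B: "summable B" "\<And>n. B n \<ge> 0"
    and f: "\<And>n s t. s \<in> net n \<union> net (Suc n) \<Longrightarrow> t \<in> net n \<union> net (Suc n) \<Longrightarrow> norm (s - t) \<le> 3 * c * (1/2) ^ n \<Longrightarrow>
       \<bar>f s - f t\<bar> \<le> B n"
  shows "continuous_on T (\<lambda>z. lim (\<lambda>n. f (\<pi> n z)))"
proof -
  define R where "R = (\<lambda>n. \<Sum>k. B (k + n))"
  define y where "y = (\<lambda>z. lim (\<lambda>n. f (\<pi> n z)))"
  have step: "\<bar>f (\<pi> (Suc n) z) - f (\<pi> n z)\<bar> \<le> B n" if z: "z \<in> T" for z n
  proof (rule f)
    have "norm (\<pi> (Suc n) z - \<pi> n z) \<le> norm (\<pi> (Suc n) z - z) + norm (\<pi> n z - z)"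
      using norm_triangle_ineq4[of "\<pi> (Suc n) z - z" "\<pi> n z - z"] by simp
    also have "\<dots> \<le> c * (1/2) ^ Suc n + c * (1/2) ^ n" by (intro add_mono net z)
    also have "\<dots> \<le> 3 * c * (1/2) ^ n" using c by simp
    finally show "norm (\<pi> (Suc n) z - \<pi> n z) \<le> 3 * c * (1/2) ^ n" .
  qed (use net z in auto)
  have diff: "\<bar>f (\<pi> (n + k) z) - f (\<pi> n z)\<bar> \<le> R n" if z: "z \<in> T" for z n k
  proof -
    have "\<bar>f (\<pi> (n + k) z) - f (\<pi> n z)\<bar> \<le> (\<Sum>j<k. B (j + n))"
    proof (induction k)
      case (Suc k)
      then show ?case using step[OF z, of "n + k"] by (simp add: add.commute)
    qed simp
    also have "\<dots> \<le> R n" unfolding R_def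
      by (intro sum_le_suminf B summable_ignore_initial_segment) auto
    finally show ?thesis .
  qed
  have R0: "R \<longlonglongrightarrow> 0"
    unfolding R_def by (rule suminf_exist_split2) (rule B)
  have conv: "(\<lambda>n. f (\<pi> n z)) \<longlonglongrightarrow> y z" if z: "z \<in> T" for z
  proof -
    have "Cauchy (\<lambda>n. f (\<pi> n z))"
    proof (rule metric_CauchyI)
      fix e :: real assume "e > 0"
      then have "eventually (\<lambda>n. R n < e / 2) sequentially" using R0 by (intro order_tendstoD(2)) auto
      then obtain N where N: "R N < e / 2" by (auto simp: eventually_sequentially)
      show "\<exists>M. \<forall>m\<ge>M. \<forall>n\<ge>M. dist (f (\<pi> m z)) (f (\<pi> n z)) < e"
      proof (intro exI[of _ N] allI impI)
        fix m n assume "N \<le> m" "N \<le> n"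
        then have "\<bar>f (\<pi> m z) - f (\<pi> N z)\<bar> \<le> R N" "\<bar>f (\<pi> n z) - f (\<pi> N z)\<bar> \<le> R N"
          using diff[OF z, of N "m - N"] diff[OF z, of N "n - N"] by auto
        with N show "dist (f (\<pi> m z)) (f (\<pi> n z)) < e" by (auto simp: dist_real_def abs_if split: if_splits)
      qed
    qed
    then show ?thesis by (simp add: y_def Cauchy_convergent convergent_LIMSEQ_iff[symmetric])
  qed
  have close: "\<bar>y z - f (\<pi> n z)\<bar> \<le> R n" if z: "z \<in> T" for z n
  proof (rule LIMSEQ_le_const2)
    show "(\<lambda>k. \<bar>f (\<pi> (n + k) z) - f (\<pi> n z)\<bar>) \<longlonglongrightarrow> \<bar>y z - f (\<pi> n z)\<bar>"
      using LIMSEQ_ignore_initial_segment[OF conv[OF z], of n] by (intro tendsto_intros) (simp add: add.commute)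
  qed (use diff[OF z] in auto)
  have "continuous_on T y"
    unfolding continuous_on_iff
  proof (intro ballI allI impI)
    fix z and e :: real assume z: "z \<in> T" and e: "e > 0"
    have "(\<lambda>n. 2 * R n + B n) \<longlonglongrightarrow> 2 * 0 + 0"
      by (intro tendsto_intros R0 summable_LIMSEQ_zero B)
    then have "eventually (\<lambda>n. 2 * R n + B n < e) sequentially" using e by (intro order_tendstoD(2)) auto
    then obtain n where n: "2 * R n + B n < e" by (auto simp: eventually_sequentially)
    show "\<exists>d>0. \<forall>x'\<in>T. dist x' z < d \<longrightarrow> dist (y x') (y z) < e"
    \<comment> \<open>For points this close, \<open>f\<close> changes by at most \<open>B n\<close>
      between the level-n projections, and passing to the limits costs \<open>R n\<close> on either
      side.\<close>
    proof (intro exI[of _ "c * (1/2) ^ n"] conjI ballI impI)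
      fix w assume w: "w \<in> T" "dist w z < c * (1/2) ^ n"
      have "\<bar>f (\<pi> n w) - f (\<pi> n z)\<bar> \<le> B n"
      proof (rule f)
        have "norm (\<pi> n w - \<pi> n z) = norm ((\<pi> n w - w) + (w - z) - (\<pi> n z - z))" by simp
        also have "\<dots> \<le> norm (\<pi> n w - w) + norm (w - z) + norm (\<pi> n z - z)"
          by (rule order_trans[OF norm_triangle_ineq4 add_right_mono[OF norm_triangle_ineq]])
        also have "\<dots> \<le> c * (1/2) ^ n + c * (1/2) ^ n + c * (1/2) ^ n"
          using w by (intro add_mono net z) (auto simp: dist_norm)
        finally show "norm (\<pi> n w - \<pi> n z) \<le> 3 * c * (1/2) ^ n" by simp
      qed (use net z w in auto)
      then show "dist (y w) (y z) < e" using close[OF z, of n] close[OF w(1), of n] n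
        by (auto simp: dist_real_def)
    qed (use c in auto)
  qed
  then show ?thesis by (simp add: y_def)
qed

section \<open>Kolmogorov's criterion in a moment space\<close>

context moment_space
begin

text \<open>At level n there are O(4^(dn)) pairs of neighbouring net points, too many for second
  moments of size 2^(-n). Moments of order 2 (m + 1) are O(2^(-n (m + 1))), so a large m wins over
  the number of pairs.\<close>

theorem continuous_modification:
  fixes a b :: "real ^ 'n::finite" and Z :: "real ^ 'n \<Rightarrow> 'w \<Rightarrow> real"
  assumes ab: "\<And>i. a $ i < b $ i"
    and Z: "\<And>z. z \<in> box a b \<Longrightarrow> Z z \<in> V"
    and C: "C \<ge> 0"
    and L: "\<And>s t. s \<in> box a b \<Longrightarrow> t \<in> box a b \<Longrightarrow> (\<integral>x. (Z s x - Z t x)\<^sup>2 \<partial>M) \<le> C * norm (s - t)"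
  shows "\<exists>Y. (\<forall>z\<in>box a b. Y z \<in> borel_measurable M \<and> (AE x in M. Y z x = Z z x)) \<and>
    (AE x in M. continuous_on (box a b) (\<lambda>z. Y z x))"
proof -
  obtain net \<pi> where net: "\<And>n. finite (net n)" "\<And>n. card (net n) \<le> (2 ^ CARD('n)) ^ n" "\<And>n. net n \<subseteq> box a b"
    and \<pi>: "\<And>n z. z \<in> box a b \<Longrightarrow> \<pi> n z \<in> net n"
      "\<And>n z. z \<in> box a b \<Longrightarrow> norm (\<pi> n z - z) \<le> norm (b - a) * (1/2) ^ n"
    by (rule dyadic_nets[OF ab]) (rule that)
  define c where "c = norm (b - a)"
  have c: "c > 0" using ab unfolding c_def by (metis zero_less_norm_iff right_minus_eq less_irrefl)
  define N where "N = (\<lambda>n. net n \<union> net (Suc n))"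
  define P where "P = (\<lambda>n. {(s, t) \<in> N n \<times> N n. norm (s - t) \<le> 3 * c * (1/2) ^ n})"
  define D :: real where "D = 2 ^ CARD('n)"
  \<comment> \<open>Half the moment order is m + 1 = 4d. It exceeds the 2d that stems from counting
    pairs and leaves room for the thresholds \<open>e n\<close>.\<close>
  define m where "m = 4 * CARD('n) - 1"
  have m: "Suc m = 4 * CARD('n)" using zero_less_card_finite[where 'a='n] by (simp add: m_def)
  \<comment> \<open>The ratio must be below 1 for summability, and its eighth power above 1/4 to
    make \<open>q\<close> < 1 below.\<close>
  define e :: "nat \<Rightarrow> real" where "e = (\<lambda>n. (9/10) ^ n)"
  have e: "e n > 0" for n by (simp add: e_def)
  have Nb: "N n \<subseteq> box a b" "finite (N n)" for n using net by (auto simp: N_def)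
  have Pf: "finite (P n)" for n by (rule finite_subset[of _ "N n \<times> N n"]) (use Nb in \<open>auto simp: P_def\<close>)
  have Pb: "s \<in> box a b" "t \<in> box a b" if "(s, t) \<in> P n" for s t n using that Nb(1)[of n] by (auto simp: P_def)
  have D1: "D \<ge> 1" by (simp add: D_def)
  have Pc: "real (card (P n)) \<le> 4 * D\<^sup>2 * (D\<^sup>2) ^ n" for n
  proof -
    have "real (card (net n)) \<le> D ^ n" for n
      using of_nat_mono[OF net(2)[of n], where 'a=real] by (simp add: D_def)
    moreover have "D ^ n \<le> D ^ Suc n" for n using D1 by (intro power_increasing) auto
    ultimately have "real (card (net n)) \<le> D ^ Suc n" "real (card (net (Suc n))) \<le> D ^ Suc n"
      using order_trans by blast+
    moreover have "real (card (N n)) \<le> real (card (net n)) + real (card (net (Suc n)))"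
      unfolding N_def of_nat_add[symmetric] of_nat_le_iff by (rule card_Un_le)
    ultimately have "real (card (N n)) \<le> 2 * D ^ Suc n" by linarith
    then have "real (card (N n)) ^ 2 \<le> (2 * D ^ Suc n)\<^sup>2" by (intro power_mono) auto
    moreover have "card (P n) \<le> card (N n \<times> N n)" by (rule card_mono) (use Nb in \<open>auto simp: P_def\<close>)
    then have "real (card (P n)) \<le> real (card (N n)) ^ 2"
      by (simp add: card_cartesian_product power2_eq_square flip: of_nat_mult)
    ultimately show ?thesis by (simp add: power_mult_distrib power2_eq_square algebra_simps)
  qed
  \<comment> \<open>The sum over all pairs dominates the maximum, so a single summable sequence
    controls every increment at once.\<close>
  define S where "S = (\<lambda>n x. \<Sum>(s, t)\<in>P n. (Z s x - Z t x) ^ (2 * Suc m) / e n ^ (2 * m + 1))"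
  have Sint: "integrable M (\<lambda>x. S n x)" for n
    unfolding S_def split_def
    by (intro Bochner_Integration.integrable_sum integrable_divide integrable_moment diff Z)
      (auto dest: Pb)
  have S0: "S n x \<ge> 0" for n x unfolding S_def split_def
    by (intro sum_nonneg even_power_divide_nonneg e)
  define q where "q = D\<^sup>2 * (1/2) ^ Suc m / (9/10) ^ (2 * m + 1)"
  define A where "A = K (Suc m) * (C * (3 * c)) ^ Suc m"
  have A0: "A \<ge> 0" using C c by (auto simp: A_def K_nonneg)
  have ES: "(\<integral>x. S n x \<partial>M) \<le> 4 * D\<^sup>2 * A * q ^ n" for n
  proof -
    define w where "w = ((1/2) ^ n) ^ Suc m / e n ^ (2 * m + 1)"
    have w0: "w \<ge> 0" using e[of n] by (simp add: w_def)
    have wq: "(D\<^sup>2) ^ n * w = q ^ n"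
    proof -
      have "((1/2 :: real) ^ n) ^ Suc m = ((1/2) ^ Suc m) ^ n" "((9/10 :: real) ^ n) ^ (2 * m + 1) = ((9/10) ^ (2 * m + 1)) ^ n"
        by (simp_all only: power_mult[symmetric] mult.commute)
      then show ?thesis unfolding w_def e_def q_def by (simp only: power_divide power_mult_distrib times_divide_eq_right)
    qed
    have "(\<integral>x. S n x \<partial>M) = (\<Sum>(s, t)\<in>P n. \<integral>x. (Z s x - Z t x) ^ (2 * Suc m) / e n ^ (2 * m + 1) \<partial>M)"
      unfolding S_def split_def
      by (intro Bochner_Integration.integral_sum integrable_divide integrable_moment diff Z)
        (auto dest: Pb)
    also have "\<dots> \<le> (\<Sum>(s, t)\<in>P n. A * w)"
      unfolding split_def
    proof (rule sum_mono)
      fix p assume "p \<in> P n"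
      then obtain s t where p: "p = (s, t)" "s \<in> box a b" "t \<in> box a b" "norm (s - t) \<le> 3 * c * (1/2) ^ n"
        using Pb[of _ _ n] by (cases p) (auto simp: P_def)
      have "(\<integral>x. (Z s x - Z t x) ^ (2 * Suc m) \<partial>M) \<le> K (Suc m) * (\<integral>x. (Z s x - Z t x)\<^sup>2 \<partial>M) ^ Suc m"
        by (intro moment diff Z p)
      also have "\<dots> \<le> K (Suc m) * (C * (3 * c * (1/2) ^ n)) ^ Suc m"
        by (intro mult_left_mono power_mono order_trans[OF L[OF p(2,3)]] K_nonneg C p) auto
      also have "\<dots> = A * ((1/2) ^ n) ^ Suc m"
        unfolding A_def by (simp add: power_mult_distrib mult_ac)
      finally have "(\<integral>x. (Z s x - Z t x) ^ (2 * Suc m) \<partial>M) / e n ^ (2 * m + 1) \<le> A * w"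
        unfolding w_def using e[of n] by (simp add: divide_right_mono)
      then show "(\<integral>x. (Z (fst p) x - Z (snd p) x) ^ (2 * Suc m) / e n ^ (2 * m + 1) \<partial>M) \<le> A * w"
        by (simp add: p(1))
    qed
    also have "\<dots> = real (card (P n)) * (A * w)" by (simp add: split_def)
    also have "\<dots> \<le> (4 * D\<^sup>2 * (D\<^sup>2) ^ n) * (A * w)"
      by (intro mult_right_mono Pc mult_nonneg_nonneg A0 w0)
    also have "\<dots> = 4 * D\<^sup>2 * A * ((D\<^sup>2) ^ n * w)" by (simp only: mult_ac)
    finally show ?thesis unfolding wq .
  qed
  have q: "0 \<le> q" "q < 1"
  proof -
    show "0 \<le> q" by (simp add: q_def)
    \<comment> \<open>One more factor 9/10 in the denominator turns every exponent into a multiple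
      of d.\<close>
    have "q \<le> D\<^sup>2 * (1/2) ^ Suc m / (9/10) ^ (2 * Suc m)"
      unfolding q_def by (intro divide_left_mono power_decreasing mult_nonneg_nonneg mult_pos_pos) auto
    also have "\<dots> = (4 * (1/2) ^ 4 / (9/10) ^ 8) ^ CARD('n)"
    proof -
      have "D\<^sup>2 = 4 ^ CARD('n)" using power_mult[of "2::real" 2 "CARD('n)"] by (simp add: D_def power_mult[symmetric] mult.commute)
      moreover have "(1/2 :: real) ^ Suc m = ((1/2) ^ 4) ^ CARD('n)" unfolding m power_mult ..
      moreover have "(9/10 :: real) ^ (2 * Suc m) = ((9/10) ^ 8) ^ CARD('n)"
        unfolding m by (simp only: power_mult[symmetric]) simp
      ultimately show ?thesis by (simp only: power_divide power_mult_distrib)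
    qed
    also have "\<dots> < 1" using zero_less_card_finite[where 'a='n]
      by (intro power_less_one_iff[THEN iffD2]) (auto simp: power_divide)
    finally show "q < 1" .
  qed
  have AES: "AE x in M. summable (\<lambda>n. S n x)"
  proof (rule AE_summable[OF Sint S0])
    show "summable (\<lambda>n. \<integral>x. S n x \<partial>M)"
      by (rule summable_comparison_test'[OF summable_mult[OF summable_geometric]])
        (use q ES S0 in auto)
  qed
  \<comment> \<open>\<open>lim\<close> is total, so \<open>Y\<close> is defined and measurable
    without first removing a null set.\<close>
  define Y where "Y = (\<lambda>z x. lim (\<lambda>n. Z (\<pi> n z) x))"
  have \<pi>b: "\<pi> n z \<in> box a b" if "z \<in> box a b" for n z using \<pi>(1)[OF that] net(3) by auto
  have Zm: "Z z \<in> borel_measurable M" if "z \<in> box a b" for z using sq[OF Z[OF that]] by (simp add: sq_integrable_def)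
  have "Y z \<in> borel_measurable M" if z: "z \<in> box a b" for z
  proof -
    have [measurable]: "Z (\<pi> n z) \<in> borel_measurable M" for n by (intro Zm \<pi>b z)
    show ?thesis unfolding Y_def by measurable
  qed
  moreover have "AE x in M. Y z x = Z z x" if z: "z \<in> box a b" for z
  proof -
    \<comment> \<open>The projections approach \<open>z\<close> at a geometric rate, so almost
      surely the values there converge to that of \<open>Z z\<close>, and the limit is a
      modification.\<close>
    have "AE x in M. summable (\<lambda>n. (Z (\<pi> n z) x - Z z x)\<^sup>2)"
    proof (rule AE_summable)
      show "integrable M (\<lambda>x. (Z (\<pi> n z) x - Z z x)\<^sup>2)" for n
        using sq[OF diff[OF Z[OF \<pi>b[OF z]] Z[OF z]]] by (simp add: sq_integrable_def)
      show "summable (\<lambda>n. \<integral>x. (Z (\<pi> n z) x - Z z x)\<^sup>2 \<partial>M)"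
      proof (rule summable_comparison_test')
        show "summable (\<lambda>n. \<bar>C\<bar> * c * (1/2) ^ n)" by (intro summable_mult summable_geometric) simp
        fix n
        have "(\<integral>x. (Z (\<pi> n z) x - Z z x)\<^sup>2 \<partial>M) \<le> C * norm (\<pi> n z - z)" by (intro L \<pi>b z)
        also have "\<dots> \<le> \<bar>C\<bar> * (c * (1/2) ^ n)" using \<pi>(2)[OF z, of n] by (intro mult_mono) (auto simp: c_def)
        finally show "norm (\<integral>x. (Z (\<pi> n z) x - Z z x)\<^sup>2 \<partial>M) \<le> \<bar>C\<bar> * c * (1/2) ^ n" by simp
      qed
    qed simp
    then show ?thesis
    proof eventually_elim
      case (elim x)
      from summable_LIMSEQ_zero[OF this] have "(\<lambda>n. Z (\<pi> n z) x - Z z x) \<longlonglongrightarrow> 0"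
        by (simp add: power_tendsto_0_iff)
      then have "(\<lambda>n. Z (\<pi> n z) x) \<longlonglongrightarrow> Z z x" by (rule LIM_zero_cancel)
      then show ?case by (simp add: Y_def limI)
    qed
  qed
  moreover have "AE x in M. continuous_on (box a b) (\<lambda>z. Y z x)"
    using AES
  proof eventually_elim
    case (elim x)
    show ?case unfolding Y_def
    proof (rule chaining_continuous[where c=c and net=net and B="\<lambda>n. e n + S n x"])
      show "summable (\<lambda>n. e n + S n x)" unfolding e_def by (intro summable_add elim summable_geometric) simp
      show "0 \<le> e n + S n x" for n using e[of n] S0[of n x] by simp
      fix n s t assume st: "s \<in> net n \<union> net (Suc n)" "t \<in> net n \<union> net (Suc n)" "norm (s - t) \<le> 3 * c * (1/2) ^ n"
      then have P: "(s, t) \<in> P n" by (simp add: P_def N_def)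
      have "\<bar>Z s x - Z t x\<bar> \<le> e n + (Z s x - Z t x) ^ (2 * Suc m) / e n ^ (2 * m + 1)"
        by (rule abs_le_add_power) (rule e)
      also have "(Z s x - Z t x) ^ (2 * Suc m) / e n ^ (2 * m + 1) \<le> S n x"
      proof -
        have "(\<lambda>(s, t). (Z s x - Z t x) ^ (2 * Suc m) / e n ^ (2 * m + 1)) (s, t) \<le> S n x"
          unfolding S_def by (rule member_le_sum[OF P _ Pf]) (auto simp only: split_def intro!: even_power_divide_nonneg e)
        then show ?thesis by (simp only: prod.case)
      qed
      finally show "\<bar>Z s x - Z t x\<bar> \<le> e n + S n x" by simp
    qed (use c \<pi> c_def in auto)
  qed
  ultimately show ?thesis by blast
qed

end

section \<open>Mean-square derivatives\<close>

text \<open>One form for both signs of the step; the intermediate point is located by its distance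
  from \<open>x\<close>.\<close>

lemma mvt_signed:
  fixes f f' :: "real \<Rightarrow> real"
  assumes "\<And>x. (f has_real_derivative f' x) (at x)"
  shows "\<exists>\<xi>. \<bar>\<xi> - x\<bar> \<le> \<bar>t\<bar> \<and> f (x + t) - f x = t * f' \<xi>"
proof -
  consider "t = 0" | "t > 0" | "t < 0" by linarith
  then show ?thesis
  proof cases
    case 1
    then show ?thesis by (intro exI[of _ x]) simp
  next
    case 2
    have "\<exists>z>x. z < x + t \<and> f (x + t) - f x = (x + t - x) * f' z"
      by (rule MVT2) (use 2 assms in simp_all)
    then obtain z where "x < z" "z < x + t" "f (x + t) - f x = (x + t - x) * f' z" by blast
    then show ?thesis by (intro exI[of _ z]) simp
  next
    case 3
    have "\<exists>z>x + t. z < x \<and> f x - f (x + t) = (x - (x + t)) * f' z"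
      by (rule MVT2) (use 3 assms in simp_all)
    then obtain z where "x + t < z" "z < x" "f x - f (x + t) = (x - (x + t)) * f' z" by blast
    then show ?thesis by (intro exI[of _ z]) simp
  qed
qed

text \<open>The numerator of the covariance of two difference quotients with steps t and s. The mean
  value theorem is used first in the step t and then for \<open>g\<close> with step -s, whose sign
  cancels the one in \<open>- h\<close>.\<close>

lemma second_difference:
  fixes k g h :: "real \<Rightarrow> real"
  assumes k: "\<And>x. (k has_real_derivative g x) (at x)" and g: "\<And>x. (g has_real_derivative - h x) (at x)"
  shows "\<exists>\<eta>. \<bar>\<eta> - u\<bar> \<le> \<bar>s\<bar> + \<bar>t\<bar> \<and> k (u + t - s) - k (u + t) - k (u - s) + k u = t * s * h \<eta>"
proof -
  have "((\<lambda>x. k (x - s) - k x) has_real_derivative g (x - s) * 1 - g x) (at x)" for x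
    by (intro DERIV_diff DERIV_chain2[where f=k] k)
      (use DERIV_diff[OF DERIV_ident DERIV_const, of s x] in simp)
  then have "((\<lambda>x. k (x - s) - k x) has_real_derivative g (x - s) - g x) (at x)" for x by simp
  from mvt_signed[of "\<lambda>x. k (x - s) - k x" "\<lambda>x. g (x - s) - g x" u t, OF this] obtain \<xi> where \<xi>: "\<bar>\<xi> - u\<bar> \<le> \<bar>t\<bar>"
     "(k (u + t - s) - k (u + t)) - (k (u - s) - k u) = t * (g (\<xi> - s) - g \<xi>)" by blast
  from mvt_signed[of g "\<lambda>x. - h x" \<xi> "- s", OF g] obtain \<eta> where \<eta>: "\<bar>\<eta> - \<xi>\<bar> \<le> \<bar>s\<bar>"
     "g (\<xi> - s) - g \<xi> = s * h \<eta>" by auto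
  show ?thesis
    by (intro exI[of _ \<eta>] conjI) (use \<xi> \<eta> in \<open>auto simp: algebra_simps\<close>)
qed

text \<open>By stationarity the mean square of Z s - Z t is twice the covariance at 0 minus twice
  that at s - t, so a comparison with 0 is the estimate to prove. One factor is split off at a
  time.\<close>

lemma prod_lipschitz_at_0:
  fixes k :: "'n::finite \<Rightarrow> real \<Rightarrow> real"
  assumes "\<And>i. lip_smooth 0 (k i)" and "finite A"
  shows "\<exists>C\<ge>0. \<forall>w :: real ^ 'n. norm w \<le> R \<longrightarrow> \<bar>(\<Prod>i\<in>A. k i (w $ i)) - (\<Prod>i\<in>A. k i 0)\<bar> \<le> C * norm w"
  using assms(2)
proof induction
  case empty
  then show ?case by (intro exI[of _ 0]) simp
next
  case (insert j A)
  then obtain C where C: "C \<ge> 0" "\<And>w :: real ^ 'n. norm w \<le> R \<Longrightarrow> \<bar>(\<Prod>i\<in>A. k i (w $ i)) - (\<Prod>i\<in>A. k i 0)\<bar> \<le> C * norm w"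
    by blast
  obtain D where D: "D \<ge> 0" "\<And>x y. \<bar>x\<bar> \<le> \<bar>R\<bar> \<Longrightarrow> \<bar>y\<bar> \<le> \<bar>R\<bar> \<Longrightarrow> \<bar>k j x - k j y\<bar> \<le> D * \<bar>x - y\<bar>"
     "\<And>x. \<bar>x\<bar> \<le> \<bar>R\<bar> \<Longrightarrow> \<bar>k j x\<bar> \<le> D"
    using lip_smooth_0D[OF assms(1)[of j], of "\<bar>R\<bar>"] by metis
  define p where "p = (\<lambda>w :: real ^ 'n. \<Prod>i\<in>A. k i (w $ i))"
  define q where "q = (\<Prod>i\<in>A. k i 0)"
  show ?case
  proof (intro exI[of _ "D * C + D * \<bar>q\<bar>"] conjI allI impI)
    fix w :: "real ^ 'n" assume w: "norm w \<le> R"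
    have wj: "\<bar>w $ j\<bar> \<le> norm w" using component_le_norm_cart[of w j] by simp
    have "(\<Prod>i\<in>insert j A. k i (w $ i)) - (\<Prod>i\<in>insert j A. k i 0) = k j (w $ j) * (p w - q) + (k j (w $ j) - k j 0) * q"
      using insert by (simp add: p_def q_def algebra_simps)
    also have "\<bar>\<dots>\<bar> \<le> \<bar>k j (w $ j)\<bar> * \<bar>p w - q\<bar> + \<bar>k j (w $ j) - k j 0\<bar> * \<bar>q\<bar>"
      by (rule order_trans[OF abs_triangle_ineq]) (simp add: abs_mult)
    also have "\<dots> \<le> D * (C * norm w) + (D * norm w) * \<bar>q\<bar>"
    proof (intro add_mono mult_mono)
      show "\<bar>k j (w $ j)\<bar> \<le> D" using D(3) wj w by simp
      show "\<bar>p w - q\<bar> \<le> C * norm w" using C(2)[OF w] by (simp add: p_def q_def)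
      have "\<bar>k j (w $ j) - k j 0\<bar> \<le> D * \<bar>w $ j\<bar>" using D(2)[of "w $ j" 0] wj w by simp
      also have "\<dots> \<le> D * norm w" using wj D(1) by (intro mult_left_mono)
      finally show "\<bar>k j (w $ j) - k j 0\<bar> \<le> D * norm w" .
    qed (use C D in auto)
    finally show "\<bar>(\<Prod>i\<in>insert j A. k i (w $ i)) - (\<Prod>i\<in>insert j A. k i 0)\<bar> \<le> (D * C + D * \<bar>q\<bar>) * norm w"
      by (simp add: algebra_simps)
  qed (use C D in auto)
qed

section \<open>Differentiation in mean square\<close>

context moment_space
begin

text \<open>Differences of points of the box stay in the ball of radius |b - a|, so the local
  Lipschitz bounds of the factors apply.\<close>

lemma product_covariance_lipschitz:
  fixes a b :: "real ^ 'n::finite"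
  assumes Z: "\<And>z. z \<in> box a b \<Longrightarrow> Z z \<in> V"
    and cov: "\<And>z z'. z \<in> box a b \<Longrightarrow> z' \<in> box a b \<Longrightarrow> (\<integral>x. Z z x * Z z' x \<partial>M) = (\<Prod>i\<in>UNIV. k i (z $ i - z' $ i))"
    and k: "\<And>i. lip_smooth 0 (k i)"
  shows "\<exists>C\<ge>0. \<forall>s\<in>box a b. \<forall>t\<in>box a b. (\<integral>x. (Z s x - Z t x)\<^sup>2 \<partial>M) \<le> C * norm (s - t)"
proof -
  obtain C where C: "C \<ge> 0" "\<And>w :: real ^ 'n. norm w \<le> norm (b - a) \<Longrightarrow>
      \<bar>(\<Prod>i\<in>UNIV. k i (w $ i)) - (\<Prod>i\<in>UNIV. k i 0)\<bar> \<le> C * norm w"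
    using prod_lipschitz_at_0[where k=k and A=UNIV and R="norm (b - a)"] k by auto
  show ?thesis
  proof (intro exI[of _ "2 * C"] conjI ballI)
    fix s t assume st: "s \<in> box a b" "t \<in> box a b"
    have "norm (s - t) \<le> norm (b - a)"
    proof (rule norm_le_componentwise_cart)
      fix i
      have "a $ i < s $ i" "s $ i < b $ i" "a $ i < t $ i" "t $ i < b $ i" using st by (auto simp: mem_box_cart)
      then show "norm ((s - t) $ i) \<le> norm ((b - a) $ i)" by simp
    qed
    from C(2)[OF this] show "(\<integral>x. (Z s x - Z t x)\<^sup>2 \<partial>M) \<le> 2 * C * norm (s - t)"
      unfolding sq_diff[OF Z[OF st(1)] Z[OF st(2)]] cov[OF st] cov[OF st(1) st(1)] cov[OF st(2) st(2)] by simp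
  qed (use C in simp)
qed

text \<open>Covariances of difference quotients tend to the product in which \<open>k j\<close> is
  replaced by its negative second derivative \<open>\<kappa>\<close>, with an error linear in |s| +
  |t|. Hence the squared L2 distance of two quotients is O(|s| + |t|); the error of the quotient
  with step t, multiplied by t^2, gives the cube.\<close>

lemma L2_derivative:
  fixes a b :: "real ^ 'n::finite"
  assumes Z: "\<And>z. z \<in> box a b \<Longrightarrow> Z z \<in> V"
    and cov: "\<And>z z'. z \<in> box a b \<Longrightarrow> z' \<in> box a b \<Longrightarrow> (\<integral>x. Z z x * Z z' x \<partial>M) = (\<Prod>i\<in>UNIV. k i (z $ i - z' $ i))"
    and k: "\<And>x. (k j has_real_derivative g x) (at x)" "\<And>x. (g has_real_derivative - \<kappa> x) (at x)"
    and \<kappa>: "lip_smooth 0 \<kappa>"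
  shows "\<exists>Z'. (\<forall>z\<in>box a b. Z' z \<in> V) \<and>
    (\<forall>z\<in>box a b. \<forall>z'\<in>box a b. (\<integral>x. Z' z x * Z' z' x \<partial>M) = (\<Prod>i\<in>UNIV. (k(j := \<kappa>)) i (z $ i - z' $ i))) \<and>
    (\<exists>C\<ge>0. \<forall>z\<in>box a b. \<forall>t. z + t *\<^sub>R axis j 1 \<in> box a b \<longrightarrow>
       (\<integral>x. (Z (z + t *\<^sub>R axis j 1) x - Z z x - t * Z' z x)\<^sup>2 \<partial>M) \<le> C * \<bar>t\<bar> ^ 3)"
proof -
  define e :: "real ^ 'n" where "e = axis j 1"
  have e: "e $ j = 1" "\<And>i. i \<noteq> j \<Longrightarrow> e $ i = 0" by (auto simp: e_def axis_def)
  define W where "W = b $ j - a $ j"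
  \<comment> \<open>Radius 3 W: the difference of the base points is at most W, and each of the two
    steps, also at most W, can move the intermediate point.\<close>
  obtain L where L: "L \<ge> 0" "\<And>x y. \<bar>x\<bar> \<le> 3 * W \<Longrightarrow> \<bar>y\<bar> \<le> 3 * W \<Longrightarrow> \<bar>\<kappa> x - \<kappa> y\<bar> \<le> L * \<bar>x - y\<bar>"
    using lip_smooth_0D[OF \<kappa>, of "3 * W"] by metis
  define R where "R = (\<lambda>z z' :: real ^ 'n. \<Prod>i\<in>UNIV - {j}. k i (z $ i - z' $ i))"
  define D where "D = (\<lambda>t z x. (1 / t) * (Z (z + t *\<^sub>R e) x - Z z x))"
  have DV: "D t z \<in> V" if "z \<in> box a b" "z + t *\<^sub>R e \<in> box a b" for t z
    unfolding D_def by (intro cmult diff Z that)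
  have W: "\<bar>t\<bar> \<le> W" if "z \<in> box a b" "z + t *\<^sub>R e \<in> box a b" for t z
  proof -
    have "a $ j < z $ j" "z $ j < b $ j" "a $ j < z $ j + t" "z $ j + t < b $ j"
      using that[unfolded mem_box_cart, THEN spec[of _ j]] by (simp_all add: e(1))
    then show ?thesis unfolding W_def by linarith
  qed
  have split: "(\<Prod>i\<in>UNIV. k i (z $ i - z' $ i)) = k j (z $ j - z' $ j) * R z z'" for z z'
    unfolding R_def by (rule prod.remove) auto
  have R_shift: "R (z + t *\<^sub>R e) z' = R z z'" "R z (z' + t *\<^sub>R e) = R z z'" for z z' t
    unfolding R_def by (simp_all add: e cong: prod.cong_simp)
  have covD: "\<bar>(\<integral>x. D t z x * D s z' x \<partial>M) - R z z' * \<kappa> (z $ j - z' $ j)\<bar> \<le> \<bar>R z z'\<bar> * L * (\<bar>s\<bar> + \<bar>t\<bar>)"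
    if z: "z \<in> box a b" "z + t *\<^sub>R e \<in> box a b" "z' \<in> box a b" "z' + s *\<^sub>R e \<in> box a b" "t \<noteq> 0" "s \<noteq> 0" for t s z z'
  proof -
    define u where "u = z $ j - z' $ j"
    obtain \<eta> where \<eta>: "\<bar>\<eta> - u\<bar> \<le> \<bar>s\<bar> + \<bar>t\<bar>"
      "k j (u + t - s) - k j (u + t) - k j (u - s) + k j u = t * s * \<kappa> \<eta>"
      using second_difference[where u=u and s=s and t=t, OF k] by blast
    have eq: "(\<integral>x. D t z x * D s z' x \<partial>M) = R z z' * \<kappa> \<eta>"
    proof -
      have jj: "(z + t *\<^sub>R e) $ j - (z' + s *\<^sub>R e) $ j = u + t - s" "(z + t *\<^sub>R e) $ j - z' $ j = u + t"
          "z $ j - (z' + s *\<^sub>R e) $ j = u - s" by (simp_all add: u_def e(1))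
      have fac: "p * r - v * r - w * r + y * r = r * (p - v - w + y)" for p r v w y :: real
        by (simp add: algebra_simps)
      note i = prod_integrable[OF Z[OF z(2)] Z[OF z(4)]] prod_integrable[OF Z[OF z(2)] Z[OF z(3)]]
          prod_integrable[OF Z[OF z(1)] Z[OF z(4)]] prod_integrable[OF Z[OF z(1)] Z[OF z(3)]]
      have "D t z x * D s z' x = (1 / (t * s)) * (Z (z + t *\<^sub>R e) x * Z (z' + s *\<^sub>R e) x
          - Z (z + t *\<^sub>R e) x * Z z' x - Z z x * Z (z' + s *\<^sub>R e) x + Z z x * Z z' x)" for x
      proof -
        have 1: "D t z x * D s z' x = (1 / (t * s)) * ((Z (z + t *\<^sub>R e) x - Z z x) * (Z (z' + s *\<^sub>R e) x - Z z' x))"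
          by (simp add: D_def)
        have 2: "(Z (z + t *\<^sub>R e) x - Z z x) * (Z (z' + s *\<^sub>R e) x - Z z' x) = Z (z + t *\<^sub>R e) x * Z (z' + s *\<^sub>R e) x
          - Z (z + t *\<^sub>R e) x * Z z' x - Z z x * Z (z' + s *\<^sub>R e) x + Z z x * Z z' x"
          by (simp only: left_diff_distrib right_diff_distrib diff_diff_eq2 diff_add_eq)
        show ?thesis unfolding 1 2 ..
      qed
      then have "(\<integral>x. D t z x * D s z' x \<partial>M) = (\<integral>x. (1 / (t * s)) * (Z (z + t *\<^sub>R e) x * Z (z' + s *\<^sub>R e) x
          - Z (z + t *\<^sub>R e) x * Z z' x - Z z x * Z (z' + s *\<^sub>R e) x + Z z x * Z z' x) \<partial>M)"
        by (simp only:)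
      also have "\<dots> = (1 / (t * s)) * ((\<integral>x. Z (z + t *\<^sub>R e) x * Z (z' + s *\<^sub>R e) x \<partial>M)
          - (\<integral>x. Z (z + t *\<^sub>R e) x * Z z' x \<partial>M) - (\<integral>x. Z z x * Z (z' + s *\<^sub>R e) x \<partial>M) + (\<integral>x. Z z x * Z z' x \<partial>M))"
        using i by (simp only: integral_mult_right_zero Bochner_Integration.integral_add Bochner_Integration.integral_diff
            Bochner_Integration.integrable_diff)
      also have "\<dots> = (1 / (t * s)) * (R z z' * (k j (u + t - s) - k j (u + t) - k j (u - s) + k j u))"
        unfolding cov[OF z(2) z(4)] cov[OF z(2) z(3)] cov[OF z(1) z(4)] cov[OF z(1) z(3)] split R_shift jj
          u_def[symmetric] fac ..
      also have "\<dots> = R z z' * \<kappa> \<eta>" unfolding \<eta>(2) using z(5,6) by simp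
      finally show ?thesis .
    qed
    have "a $ j < z $ j" "z $ j < b $ j" "a $ j < z' $ j" "z' $ j < b $ j"
      using z(1,3) by (simp_all add: mem_box_cart)
    then have "\<bar>u\<bar> \<le> W" unfolding u_def W_def by linarith
    then have "\<bar>\<kappa> \<eta> - \<kappa> u\<bar> \<le> L * \<bar>\<eta> - u\<bar>" using \<eta>(1) W[OF z(1,2)] W[OF z(3,4)] by (intro L) auto
    also have "\<dots> \<le> L * (\<bar>s\<bar> + \<bar>t\<bar>)" using \<eta>(1) L(1) by (intro mult_left_mono)
    finally have "\<bar>R z z'\<bar> * \<bar>\<kappa> \<eta> - \<kappa> u\<bar> \<le> \<bar>R z z'\<bar> * (L * (\<bar>s\<bar> + \<bar>t\<bar>))" by (intro mult_left_mono) auto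
    then show ?thesis unfolding eq u_def[symmetric] by (simp add: abs_mult right_diff_distrib[symmetric] mult.assoc)
  qed
  define R0 where "R0 = (\<Prod>i\<in>UNIV - {j}. k i 0)"
  \<comment> \<open>With G = |R0| L, the three covariances are within 2 G |t|, G (|s| + |t|) and 2 G
    |s| of a common value; the middle one counts twice, and the total is 4 G (|t| + |s|).\<close>
  define B where "B = 4 * \<bar>R0\<bar> * L"
  have B0: "B \<ge> 0" using L by (simp add: B_def)
  have Dd: "(\<integral>x. (D t z x - D s z x)\<^sup>2 \<partial>M) \<le> B * (\<bar>t\<bar> + \<bar>s\<bar>)"
    if z: "z \<in> box a b" "z + t *\<^sub>R e \<in> box a b" "z + s *\<^sub>R e \<in> box a b" "t \<noteq> 0" "s \<noteq> 0" for t s z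
  proof -
    have R: "R z z = R0" by (simp add: R_def R0_def)
    define G where "G = \<bar>R0\<bar> * L"
    define k0 where "k0 = R0 * \<kappa> (z $ j - z $ j)"
    have c: "\<bar>(\<integral>x. D t z x * D t z x \<partial>M) - k0\<bar> \<le> G * (\<bar>t\<bar> + \<bar>t\<bar>)"
       "\<bar>(\<integral>x. D t z x * D s z x \<partial>M) - k0\<bar> \<le> G * (\<bar>s\<bar> + \<bar>t\<bar>)"
       "\<bar>(\<integral>x. D s z x * D s z x \<partial>M) - k0\<bar> \<le> G * (\<bar>s\<bar> + \<bar>s\<bar>)"
      using covD[OF z(1,2) z(1,2) z(4,4)] covD[OF z(1,2) z(1,3) z(4,5)] covD[OF z(1,3) z(1,3) z(5,5)]
      unfolding R k0_def G_def by simp_all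
    have "(\<integral>x. (D t z x - D s z x)\<^sup>2 \<partial>M) \<le> G * (\<bar>t\<bar> + \<bar>t\<bar>) + 2 * (G * (\<bar>s\<bar> + \<bar>t\<bar>)) + G * (\<bar>s\<bar> + \<bar>s\<bar>)"
      unfolding sq_diff[OF DV[OF z(1,2)] DV[OF z(1,3)]] using c by linarith
    also have "\<dots> = B * (\<bar>t\<bar> + \<bar>s\<bar>)" unfolding B_def G_def by (simp add: algebra_simps)
    finally show ?thesis .
  qed
  \<comment> \<open>Half the room below the upper face, shrunk geometrically: shifted points stay in
    the open box, and the rate fits \<open>L2_Cauchy_limit\<close>.\<close>
  define h where "h = (\<lambda>(z :: real ^ 'n) n. (b $ j - z $ j) / 2 * (1/2) ^ n)"
  have h: "h z n \<noteq> 0" "z + h z n *\<^sub>R e \<in> box a b" "\<bar>h z n\<bar> \<le> W * (1/2) ^ n" if z: "z \<in> box a b" for z n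
  proof -
    have zj: "a $ j < z $ j" "z $ j < b $ j" using z by (auto simp: mem_box_cart)
    show "h z n \<noteq> 0" using zj by (simp add: h_def)
    have "(1/2 :: real) ^ n \<le> 1" by (simp add: power_le_one)
    then have "(b $ j - z $ j) / 2 * (1/2) ^ n \<le> (b $ j - z $ j) / 2 * 1"
      using zj by (intro mult_left_mono) auto
    then have "h z n \<le> (b $ j - z $ j) / 2" by (simp add: h_def)
    moreover have "h z n > 0" using zj by (simp add: h_def)
    ultimately have hz: "0 < h z n" "z $ j + h z n \<le> z $ j + (b $ j - z $ j) / 2" by simp_all
    have "z $ j + (b $ j - z $ j) / 2 < b $ j" using zj by (simp add: field_simps)
    with hz(2) have hz2: "z $ j + h z n < b $ j" by (rule le_less_trans)
    show "z + h z n *\<^sub>R e \<in> box a b"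
      unfolding mem_box_cart
    proof
      fix i
      have "a $ i < z $ i" "z $ i < b $ i" using z by (auto simp: mem_box_cart)
      then show "a $ i < (z + h z n *\<^sub>R e) $ i \<and> (z + h z n *\<^sub>R e) $ i < b $ i"
        using hz(1) hz2 e by (cases "i = j") auto
    qed
    show "\<bar>h z n\<bar> \<le> W * (1/2) ^ n" using zj unfolding h_def abs_mult W_def
      by (intro mult_mono) auto
  qed
  have hlim: "h z \<longlonglongrightarrow> 0" for z
    unfolding h_def by (intro tendsto_mult_right_zero LIMSEQ_power_zero) simp
  have "\<exists>Y\<in>V. (\<lambda>n. \<integral>x. (D (h z n) z x - Y x)\<^sup>2 \<partial>M) \<longlonglongrightarrow> 0" if z: "z \<in> box a b" for z
  proof -
    have "(\<integral>x. (D (h z n) z x - D (h z m) z x)\<^sup>2 \<partial>M) \<le> (B * W) * ((1/2) ^ n + (1/2) ^ m)" for n m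
    proof -
      have "(\<integral>x. (D (h z n) z x - D (h z m) z x)\<^sup>2 \<partial>M) \<le> B * (\<bar>h z n\<bar> + \<bar>h z m\<bar>)"
        by (intro Dd z h)
      also have "\<dots> \<le> B * (W * (1/2) ^ n + W * (1/2) ^ m)"
        by (intro mult_left_mono add_mono h z B0)
      finally show ?thesis by (simp add: algebra_simps)
    qed
    from L2_Cauchy_limit[OF DV[OF z h(2)[OF z]] this] show ?thesis by blast
  qed
  then have "\<forall>z\<in>box a b. \<exists>Y. Y \<in> V \<and> (\<lambda>n. \<integral>x. (D (h z n) z x - Y x)\<^sup>2 \<partial>M) \<longlonglongrightarrow> 0"
    by (simp add: Bex_def)
  from bchoice[OF this] obtain Z' where
    "\<forall>z\<in>box a b. Z' z \<in> V \<and> (\<lambda>n. \<integral>x. (D (h z n) z x - Z' z x)\<^sup>2 \<partial>M) \<longlonglongrightarrow> 0" ..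
  then have Z': "\<And>z. z \<in> box a b \<Longrightarrow> Z' z \<in> V"
    "\<And>z. z \<in> box a b \<Longrightarrow> (\<lambda>n. \<integral>x. (D (h z n) z x - Z' z x)\<^sup>2 \<partial>M) \<longlonglongrightarrow> 0"
    by simp_all
  have cov': "(\<integral>x. Z' z x * Z' z' x \<partial>M) = (\<Prod>i\<in>UNIV. (k(j := \<kappa>)) i (z $ i - z' $ i))"
    if z: "z \<in> box a b" "z' \<in> box a b" for z z'
  proof -
    \<comment> \<open>The new covariance is found by computing one limit twice, by L2 continuity and
      by \<open>covD\<close>.\<close>
    have l1: "(\<lambda>n. \<integral>x. D (h z n) z x * D (h z' n) z' x \<partial>M) \<longlonglongrightarrow> (\<integral>x. Z' z x * Z' z' x \<partial>M)"
      by (intro L2_tendsto_inner sq DV Z' z h)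
    have "(\<lambda>n. (\<integral>x. D (h z n) z x * D (h z' n) z' x \<partial>M) - R z z' * \<kappa> (z $ j - z' $ j)) \<longlonglongrightarrow> 0"
    proof (rule tendsto_rabs_zero_cancel, rule tendsto_sandwich[OF _ _ tendsto_const])
      show "\<forall>\<^sub>F n in sequentially. \<bar>(\<integral>x. D (h z n) z x * D (h z' n) z' x \<partial>M) - R z z' * \<kappa> (z $ j - z' $ j)\<bar>
         \<le> \<bar>R z z'\<bar> * L * (\<bar>h z' n\<bar> + \<bar>h z n\<bar>)"
        by (intro always_eventually allI covD z h)
      show "(\<lambda>n. \<bar>R z z'\<bar> * L * (\<bar>h z' n\<bar> + \<bar>h z n\<bar>)) \<longlonglongrightarrow> 0"
        by (intro tendsto_mult_right_zero tendsto_add_zero tendsto_rabs_zero hlim)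
    qed simp
    then have "(\<lambda>n. \<integral>x. D (h z n) z x * D (h z' n) z' x \<partial>M) \<longlonglongrightarrow> R z z' * \<kappa> (z $ j - z' $ j)"
      by (rule LIM_zero_cancel)
    from LIMSEQ_unique[OF l1 this] show ?thesis
      using prod.remove[of UNIV j "\<lambda>i. (k(j := \<kappa>)) i (z $ i - z' $ i)"] by (simp add: R_def)
  qed
  have err: "(\<integral>x. (Z (z + t *\<^sub>R e) x - Z z x - t * Z' z x)\<^sup>2 \<partial>M) \<le> B * \<bar>t\<bar> ^ 3"
    if z: "z \<in> box a b" "z + t *\<^sub>R e \<in> box a b" for z t
  proof (cases "t = 0")
    case False
    \<comment> \<open>The quotient with step t stays fixed while the other step tends to 0, which
      carries \<open>Dd\<close> over to the derivative.\<close>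
    have V1: "(\<lambda>x. D t z x - D (h z n) z x) \<in> V" for n by (intro diff DV z h)
    have V2: "(\<lambda>x. D t z x - Z' z x) \<in> V" by (intro diff DV z Z')
    have c: "(\<lambda>n. \<integral>x. ((D t z x - D (h z n) z x) - (D t z x - Z' z x))\<^sup>2 \<partial>M) \<longlonglongrightarrow> 0"
    proof -
      have "(u - v - (u - w))\<^sup>2 = (v - w)\<^sup>2" for u v w :: real
        by (simp add: power2_eq_square algebra_simps)
      then show ?thesis using Z'(2)[OF z(1)] by (simp only:)
    qed
    have "(\<lambda>n. \<integral>x. (D t z x - D (h z n) z x) * (D t z x - D (h z n) z x) \<partial>M)
       \<longlonglongrightarrow> (\<integral>x. (D t z x - Z' z x) * (D t z x - Z' z x) \<partial>M)"
      by (rule L2_tendsto_inner[OF sq[OF V1] sq[OF V2] sq[OF V1] sq[OF V2] c c])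
    then have l: "(\<lambda>n. \<integral>x. (D t z x - D (h z n) z x)\<^sup>2 \<partial>M) \<longlonglongrightarrow> (\<integral>x. (D t z x - Z' z x)\<^sup>2 \<partial>M)"
      by (simp add: power2_eq_square)
    have "(\<lambda>n. B * (\<bar>t\<bar> + \<bar>h z n\<bar>)) \<longlonglongrightarrow> B * (\<bar>t\<bar> + \<bar>0\<bar>)"
      by (intro tendsto_intros hlim)
    from LIMSEQ_le[OF l this] have *: "(\<integral>x. (D t z x - Z' z x)\<^sup>2 \<partial>M) \<le> B * \<bar>t\<bar>"
      using Dd[OF z(1) z(2) h(2)[OF z(1)] False h(1)[OF z(1)]] by auto
    have "(\<lambda>x. (Z (z + t *\<^sub>R e) x - Z z x - t * Z' z x)\<^sup>2) = (\<lambda>x. t\<^sup>2 * (D t z x - Z' z x)\<^sup>2)"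
      using False by (simp add: D_def power_mult_distrib[symmetric] right_diff_distrib)
    then have "(\<integral>x. (Z (z + t *\<^sub>R e) x - Z z x - t * Z' z x)\<^sup>2 \<partial>M) = t\<^sup>2 * (\<integral>x. (D t z x - Z' z x)\<^sup>2 \<partial>M)"
      by simp
    also have "\<dots> \<le> t\<^sup>2 * (B * \<bar>t\<bar>)" by (intro mult_left_mono *) auto
    also have "\<dots> = B * \<bar>t\<bar> ^ 3"
    proof -
      have "\<bar>t\<bar> ^ 3 = \<bar>t\<bar>\<^sup>2 * \<bar>t\<bar>" unfolding power3_eq_cube power2_eq_square ..
      then show ?thesis by simp
    qed
    finally show ?thesis .
  qed simp
  show ?thesis unfolding e_def[symmetric]
    by (rule exI[of _ Z'], intro conjI exI[of _ B] ballI allI impI Z'(1) cov' err B0)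
qed

text \<open>The error is a sum of 2^n remainders with second moments at most C (|T| / 2^n)^3.
  Cauchy-Schwarz costs a factor 2^n, so the error has second moment at most C |T|^3 2^(-n), which is
  summable.\<close>

lemma riemann_sum_AE:
  fixes a b :: "real ^ 'n::finite"
  assumes Z: "\<And>z. z \<in> box a b \<Longrightarrow> Z z \<in> V" and Z': "\<And>z. z \<in> box a b \<Longrightarrow> Z' z \<in> V"
    and C: "C \<ge> 0" "\<And>z t. z \<in> box a b \<Longrightarrow> z + t *\<^sub>R e \<in> box a b \<Longrightarrow>
       (\<integral>x. (Z (z + t *\<^sub>R e) x - Z z x - t * Z' z x)\<^sup>2 \<partial>M) \<le> C * \<bar>t\<bar> ^ 3"
    and z: "z \<in> box a b" "z + T *\<^sub>R e \<in> box a b"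
  shows "AE x in M. (\<lambda>n. \<Sum>i<2 ^ n. (T / 2 ^ n) * Z' (z + (real i * (T / 2 ^ n)) *\<^sub>R e) x) \<longlonglongrightarrow> Z (z + T *\<^sub>R e) x - Z z x"
proof -
  define p where "p = (\<lambda>n i. z + (real i * (T / 2 ^ n)) *\<^sub>R e)"
  define r where "r = (\<lambda>n i x. Z (p n (Suc i)) x - Z (p n i) x - (T / 2 ^ n) * Z' (p n i) x)"
  have ps: "p n (Suc i) = p n i + (T / 2 ^ n) *\<^sub>R e" for n i
    by (simp add: p_def algebra_simps add_divide_distrib scaleR_add_left)
  \<comment> \<open>Grid points are convex combinations of the end points. The index 2^n is included
    since each remainder reaches to the next grid point.\<close>
  have pb: "p n i \<in> box a b" if "i \<le> 2 ^ n" for n i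
  proof -
    have "real i \<le> 2 ^ n" using that by (metis of_nat_le_iff of_nat_numeral of_nat_power)
    then have "(1 - real i / 2 ^ n) *\<^sub>R z + (real i / 2 ^ n) *\<^sub>R (z + T *\<^sub>R e) \<in> box a b"
      using z by (intro convexD[OF convex_box(2)]) auto
    moreover have "(1 - real i / 2 ^ n) *\<^sub>R z + (real i / 2 ^ n) *\<^sub>R (z + T *\<^sub>R e) = p n i"
      by (simp add: p_def algebra_simps)
    ultimately show ?thesis by simp
  qed
  have rV: "r n i \<in> V" if "i < 2 ^ n" for n i
    unfolding r_def using that by (intro diff cmult Z Z' pb) auto
  have rsum: "(\<Sum>i<2 ^ n. r n i x) = Z (z + T *\<^sub>R e) x - Z z x - (\<Sum>i<2 ^ n. (T / 2 ^ n) * Z' (p n i) x)" for n x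
  proof -
    have "(\<Sum>i<2 ^ n. r n i x) = (\<Sum>i<2 ^ n. Z (p n (Suc i)) x - Z (p n i) x) - (\<Sum>i<2 ^ n. (T / 2 ^ n) * Z' (p n i) x)"
      unfolding r_def by (rule sum_subtractf)
    also have "(\<Sum>i<2 ^ n. Z (p n (Suc i)) x - Z (p n i) x) = Z (p n (2 ^ n)) x - Z (p n 0) x"
      by (rule sum_lessThan_telescope)
    finally show ?thesis by (simp add: p_def)
  qed
  have sV: "(\<lambda>x. \<Sum>i<2 ^ n. r n i x) \<in> V" for n by (intro sum rV) (auto simp: lessThan_empty_iff)
  have "AE x in M. summable (\<lambda>n. (\<Sum>i<2 ^ n. r n i x)\<^sup>2)"
  proof (rule AE_summable)
    show "integrable M (\<lambda>x. (\<Sum>i<2 ^ n. r n i x)\<^sup>2)" for n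
      using sq[OF sV] by (simp add: sq_integrable_def)
    show "summable (\<lambda>n. \<integral>x. (\<Sum>i<2 ^ n. r n i x)\<^sup>2 \<partial>M)"
    proof (rule summable_comparison_test')
      show "summable (\<lambda>n. C * \<bar>T\<bar> ^ 3 * (1/2) ^ n)" by (intro summable_mult summable_geometric) simp
      fix n
      have i2: "integrable M (\<lambda>x. (r n i x)\<^sup>2)" if "i < 2 ^ n" for i
        using sq[OF rV[OF that]] by (simp add: sq_integrable_def)
      have "(\<integral>x. (\<Sum>i<2 ^ n. r n i x)\<^sup>2 \<partial>M) \<le> (\<integral>x. (\<Sum>i<2 ^ n. (r n i x)\<^sup>2) * 2 ^ n \<partial>M)"
      proof (rule integral_mono)
        show "(\<Sum>i<2 ^ n. r n i x)\<^sup>2 \<le> (\<Sum>i<2 ^ n. (r n i x)\<^sup>2) * 2 ^ n" for x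
          using sum_squared_le_sum_of_squares[of "\<lambda>i. r n i x" "{..<2 ^ n}"] by simp
      qed (use sq[OF sV] i2 in \<open>auto simp: sq_integrable_def\<close>)
      also have "\<dots> = (\<Sum>i<2 ^ n. \<integral>x. (r n i x)\<^sup>2 \<partial>M) * 2 ^ n"
        using i2 by (simp add: Bochner_Integration.integral_sum)
      also have "\<dots> \<le> (\<Sum>i<(2::nat) ^ n. C * \<bar>T / 2 ^ n\<bar> ^ 3) * 2 ^ n"
      proof (intro mult_right_mono sum_mono)
        fix i assume "i \<in> {..<(2::nat) ^ n}"
        then show "(\<integral>x. (r n i x)\<^sup>2 \<partial>M) \<le> C * \<bar>T / 2 ^ n\<bar> ^ 3"
          using C(2)[of "p n i" "T / 2 ^ n"] pb[of i n] pb[of "Suc i" n] by (simp add: r_def ps)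
      qed simp
      also have "\<dots> = C * \<bar>T\<bar> ^ 3 * (1/2) ^ n"
        by (simp add: power_divide abs_divide power3_eq_cube)
      finally show "norm (\<integral>x. (\<Sum>i<2 ^ n. r n i x)\<^sup>2 \<partial>M) \<le> C * \<bar>T\<bar> ^ 3 * (1/2) ^ n" by simp
    qed
  qed simp
  then show ?thesis
  proof eventually_elim
    case (elim x)
    have "(\<lambda>n. \<Sum>i<2 ^ n. r n i x) \<longlonglongrightarrow> 0"
      using summable_LIMSEQ_zero[OF elim] by (simp add: power_tendsto_0_iff)
    from tendsto_diff[OF tendsto_const[of "Z (z + T *\<^sub>R e) x - Z z x"] this]
    show ?case unfolding rsum by (simp add: p_def)
  qed
qed

end

section \<open>Anisotropic differentiability of paths\<close>

text \<open>The head is the least coordinate with a positive exponent, so deleting it lowers that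
  exponent by one. Inductions along the list thus stay among multi-indices below \<beta>.\<close>

lemma directions_Cons:
  assumes "directions \<alpha> = i # is"
  shows "\<alpha> i > 0" "is = directions (\<alpha>(i := \<alpha> i - 1))"
proof -
  \<comment> \<open>The sorted list of all coordinates is generalised to any distinct list, for the
    sake of induction.\<close>
  have *: "\<alpha> i > 0 \<and> i \<in> set xs \<and> is = concat (map (\<lambda>l. replicate ((\<alpha>(i := \<alpha> i - 1)) l) l) xs)"
    if "distinct xs" "concat (map (\<lambda>l. replicate (\<alpha> l) l) xs) = i # is" for xs
    using that
  proof (induction xs)
    case (Cons y ys)
    show ?case
    proof (cases "\<alpha> y")
      case 0
      then have "concat (map (\<lambda>l. replicate (\<alpha> l) l) ys) = i # is" using Cons.prems by simp
      then have IH: "\<alpha> i > 0" "i \<in> set ys" "is = concat (map (\<lambda>l. replicate ((\<alpha>(i := \<alpha> i - 1)) l) l) ys)"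
        using Cons.IH Cons.prems by simp_all
      then show ?thesis using 0 Cons.prems by auto
    next
      case (Suc m)
      then have i: "i = y" "is = replicate m y @ concat (map (\<lambda>l. replicate (\<alpha> l) l) ys)" using Cons.prems by auto
      have m: "map (\<lambda>l. replicate ((\<alpha>(y := m)) l) l) ys = map (\<lambda>l. replicate (\<alpha> l) l) ys"
        by (rule map_cong) (use Cons.prems in auto)
      have e: "\<alpha>(i := \<alpha> i - 1) = \<alpha>(y := m)" using i Suc by simp
      have "concat (map (\<lambda>l. replicate ((\<alpha>(y := m)) l) l) (y # ys)) = is"
        unfolding i(2) list.map concat.simps m by simp
      then show ?thesis unfolding e using i(1) Suc by simp
    qed
  qed simp
  from *[of "sorted_list_of_set UNIV"] assms
  show "\<alpha> i > 0" "is = directions (\<alpha>(i := \<alpha> i - 1))" by (auto simp: directions_def)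
qed

text \<open>Covariances of derivative fields depend on a list of directions only through these
  counts.\<close>

lemma count_list_directions: "count_list (directions \<alpha>) j = \<alpha> j"
proof -
  have r: "count_list (replicate m i) j = (if i = j then m else 0)" for m i by (induction m) auto
  have "count_list (concat (map (\<lambda>i. replicate (\<alpha> i) i) xs)) j = (if j \<in> set xs then \<alpha> j else 0)"
    if "distinct xs" for xs
    using that by (induction xs) (auto simp: r)
  from this[of "sorted_list_of_set UNIV"] show ?thesis by (simp add: directions_def)
qed

lemma directions_0: "directions (\<lambda>_. 0) = []"
  by (simp add: directions_def)

lemma open_line_vimage:
  fixes S :: "(real ^ 'n::finite) set"
  assumes "open S"
  shows "open {t. z + t *\<^sub>R v \<in> S}"
proof -
  have "open ((\<lambda>t. z + t *\<^sub>R v) -` S)" by (intro open_vimage assms continuous_intros)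
  then show ?thesis by (simp add: vimage_def)
qed

text \<open>A criterion free of iterated \<open>deriv\<close>: candidates for all derivatives are
  given, each differentiating to the next. As \<open>S\<close> is open, a derivative along a line
  only sees values in \<open>S\<close>, so agreement on \<open>S\<close> carries the
  induction.\<close>

lemma C_multi_family:
  fixes f :: "real ^ 'n::{finite,linorder} \<Rightarrow> real" and F :: "'n list \<Rightarrow> real ^ 'n::{finite,linorder} \<Rightarrow> real"
  assumes S: "open S"
    and cont: "\<And>\<alpha>. \<alpha> \<le> \<beta> \<Longrightarrow> continuous_on S (F (directions \<alpha>))"
    and deriv: "\<And>\<alpha> i is z. \<alpha> \<le> \<beta> \<Longrightarrow> directions \<alpha> = i # is \<Longrightarrow> z \<in> S \<Longrightarrow>
       ((\<lambda>t. F is (z + t *\<^sub>R axis i 1)) has_real_derivative F (i # is) z) (at 0)"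
    and f: "\<And>z. z \<in> S \<Longrightarrow> f z = F [] z"
  shows "f \<in> C_multi \<beta> S"
proof -
  have main: "partials_exist_on S ds f \<and> (\<forall>z\<in>S. foldr partial_deriv ds f z = F ds z)"
    if "\<alpha> \<le> \<beta>" "directions \<alpha> = ds" for \<alpha> ds
    using that
  proof (induction ds arbitrary: \<alpha>)
    case Nil
    then show ?case using f by simp
  next
    case (Cons i ds)
    have "\<alpha>(i := \<alpha> i - 1) \<le> \<alpha>" by (auto simp: le_fun_def)
    then have "\<alpha>(i := \<alpha> i - 1) \<le> \<beta>" using Cons.prems(1) by (rule order_trans)
    from Cons.IH[OF this directions_Cons(2)[OF Cons.prems(2), symmetric]]
    have IH: "partials_exist_on S ds f" "\<And>z. z \<in> S \<Longrightarrow> foldr partial_deriv ds f z = F ds z" by auto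
    have d: "((\<lambda>t. foldr partial_deriv ds f (z + t *\<^sub>R axis i 1)) has_real_derivative F (i # ds) z) (at 0)"
      if z: "z \<in> S" for z
      by (rule has_field_derivative_transform_within_open[OF deriv[OF Cons.prems z] open_line_vimage[OF S, of z "axis i 1"]])
        (use z IH(2) in auto)
    then show ?case
      using IH(1) d DERIV_imp_deriv[OF d]
      by (auto simp: partial_differentiable_def partial_deriv_def[of i] field_differentiable_def)
  qed
  have "continuous_on S (mixed_partial \<alpha> f)" if "\<alpha> \<le> \<beta>" for \<alpha>
    using continuous_on_cong[THEN iffD2, OF refl _ cont[OF that], of "mixed_partial \<alpha> f"] main[OF that refl]
    by (simp add: mixed_partial_def)
  moreover have "continuous_on S f"
    using continuous_on_cong[THEN iffD2, OF refl _ cont[of "\<lambda>_. 0"], of f] f by (simp add: directions_0 le_fun_def)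
  ultimately show ?thesis using main by (auto simp: C_multi_def mixed_partial_exists_on_def)
qed

lemma C_multi_DERIV:
  fixes \<mu> :: "real ^ 'n::{finite,linorder} \<Rightarrow> real"
  assumes "\<mu> \<in> C_multi \<beta> S" "\<alpha> \<le> \<beta>" "directions \<alpha> = i # is" "z \<in> S"
  shows "((\<lambda>t. foldr partial_deriv is \<mu> (z + t *\<^sub>R axis i 1)) has_real_derivative foldr partial_deriv (i # is) \<mu> z) (at 0)"
proof -
  have "partials_exist_on S (i # is) \<mu>"
    using assms(1,2) unfolding C_multi_def mixed_partial_exists_on_def assms(3)[symmetric] by blast
  then show ?thesis using assms(4)
    by (auto simp: partial_differentiable_def partial_deriv_def field_differentiable_derivI)
qed

text \<open>Over a short segment near z0 a Riemann sum is t times an average of values of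
  \<open>g\<close>, all within \<epsilon> of g z0. So increments of \<open>f\<close> from points of
  \<open>Q\<close> over rational lengths t differ from t g z0 by at most |t| \<epsilon>, and
  continuity of \<open>f\<close> extends this to all short segments from z0.\<close>

lemma DERIV_of_riemann_sums:
  fixes f g :: "'a::real_normed_vector \<Rightarrow> real"
  assumes S: "open S" and f: "continuous_on S f" and g: "continuous_on S g" and e: "norm e \<le> 1"
    and Q: "\<And>z r. z \<in> S \<Longrightarrow> r > 0 \<Longrightarrow> \<exists>q\<in>Q. dist q z < r"
    and lim: "\<And>z t. z \<in> Q \<Longrightarrow> t \<in> \<rat> \<Longrightarrow> (\<And>s. \<bar>s\<bar> \<le> \<bar>t\<bar> \<Longrightarrow> z + s *\<^sub>R e \<in> S) \<Longrightarrow>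
      (\<lambda>n. \<Sum>i<2 ^ n. (t / 2 ^ n) * g (z + (real i * (t / 2 ^ n)) *\<^sub>R e)) \<longlonglongrightarrow> f (z + t *\<^sub>R e) - f z"
    and z0: "z0 \<in> S"
  shows "((\<lambda>t. f (z0 + t *\<^sub>R e)) has_real_derivative g z0) (at 0)"
proof -
  have bound: "\<exists>r>0. \<forall>t. \<bar>t\<bar> < r \<longrightarrow> \<bar>f (z0 + t *\<^sub>R e) - f z0 - t * g z0\<bar> \<le> \<bar>t\<bar> * \<epsilon>" if \<epsilon>: "\<epsilon> > 0" for \<epsilon>
  proof -
    have "isCont g z0" using g S z0 continuous_on_eq_continuous_at by blast
    then obtain r1 where r1: "r1 > 0" "\<And>w. dist w z0 < r1 \<Longrightarrow> \<bar>g w - g z0\<bar> < \<epsilon>"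
      using \<epsilon> unfolding continuous_at_eps_delta by (metis dist_commute dist_real_def dist_norm)
    obtain r2 where r2: "r2 > 0" "ball z0 r2 \<subseteq> S" using S z0 open_contains_ball by blast
    define r where "r = min r1 r2"
    have r: "r > 0" "\<And>w. dist w z0 < r \<Longrightarrow> \<bar>g w - g z0\<bar> \<le> \<epsilon>" "\<And>w. dist w z0 < r \<Longrightarrow> w \<in> S"
      using r1 r2 by (auto simp: r_def dist_commute less_imp_le subset_eq)
    have "\<bar>f (z0 + t *\<^sub>R e) - f z0 - t * g z0\<bar> \<le> \<bar>t\<bar> * \<epsilon>" if t: "\<bar>t\<bar> < r" for t
    proof -
      have "\<forall>n. \<exists>q. q \<in> Q \<and> dist q z0 < inverse (real (Suc n))" using Q[OF z0] by (meson inverse_positive_iff_positive of_nat_0_less_iff zero_less_Suc)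
      then obtain zs where zs: "\<And>n. zs n \<in> Q" "\<And>n. dist (zs n) z0 < inverse (real (Suc n))" by metis
      have "\<forall>n. \<exists>q\<in>\<rat>. \<bar>q - t\<bar> < inverse (real (Suc n))"
      proof
        fix n
        obtain q where "q \<in> \<rat>" "t < q" "q < t + inverse (real (Suc n))"
          using Rats_dense_in_real[of t "t + inverse (real (Suc n))"] by auto
        then show "\<exists>q\<in>\<rat>. \<bar>q - t\<bar> < inverse (real (Suc n))" by (intro bexI[of _ q]) auto
      qed
      then obtain ts where ts: "\<And>n. ts n \<in> \<rat>" "\<And>n. \<bar>ts n - t\<bar> < inverse (real (Suc n))" by metis
      have zl: "zs \<longlonglongrightarrow> z0"
        by (rule metric_tendsto_imp_tendsto[OF LIMSEQ_inverse_real_of_nat])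
          (use zs(2) in \<open>auto intro!: always_eventually less_imp_le\<close>)
      have tl: "ts \<longlonglongrightarrow> t"
        by (rule metric_tendsto_imp_tendsto[OF LIMSEQ_inverse_real_of_nat])
          (use ts(2) in \<open>auto intro!: always_eventually less_imp_le simp: dist_real_def\<close>)
      have inS: "z0 + t *\<^sub>R e \<in> S"
      proof (rule r(3))
        have "\<bar>t\<bar> * norm e \<le> \<bar>t\<bar>" using mult_left_mono[OF e, of "\<bar>t\<bar>"] by simp
        then show "dist (z0 + t *\<^sub>R e) z0 < r" using t by (simp add: dist_norm)
      qed
      have fc: "isCont f z0" "isCont f (z0 + t *\<^sub>R e)" using f S z0 inS continuous_on_eq_continuous_at by blast+
      have l: "(\<lambda>n. \<bar>f (zs n + ts n *\<^sub>R e) - f (zs n) - ts n * g z0\<bar>) \<longlonglongrightarrow> \<bar>f (z0 + t *\<^sub>R e) - f z0 - t * g z0\<bar>"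
        by (intro tendsto_intros isCont_tendsto_compose[OF fc(1)] isCont_tendsto_compose[OF fc(2)] zl tl)
      have l2: "(\<lambda>n. \<bar>ts n\<bar> * \<epsilon>) \<longlonglongrightarrow> \<bar>t\<bar> * \<epsilon>" by (intro tendsto_intros tl)
      \<comment> \<open>This sum bounds the distance from z0 of all points on the n-th segment, so
        eventually the whole segment lies in the small ball.\<close>
      have "(\<lambda>n. dist (zs n) z0 + \<bar>ts n\<bar>) \<longlonglongrightarrow> dist z0 z0 + \<bar>t\<bar>" by (intro tendsto_intros zl tl)
      then have "\<forall>\<^sub>F n in sequentially. dist (zs n) z0 + \<bar>ts n\<bar> < r" using t by (intro order_tendstoD(2)) auto
      then have "\<forall>\<^sub>F n in sequentially. \<bar>f (zs n + ts n *\<^sub>R e) - f (zs n) - ts n * g z0\<bar> \<le> \<bar>ts n\<bar> * \<epsilon>"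
      proof eventually_elim
        case (elim n)
        have near: "dist (zs n + s *\<^sub>R e) z0 < r" if s: "\<bar>s\<bar> \<le> \<bar>ts n\<bar>" for s
        proof -
          have "dist (zs n + s *\<^sub>R e) z0 \<le> dist (zs n + s *\<^sub>R e) (zs n) + dist (zs n) z0" by (rule dist_triangle)
          also have "dist (zs n + s *\<^sub>R e) (zs n) = \<bar>s\<bar> * norm e" by (simp add: dist_norm)
          also have "\<dots> \<le> \<bar>s\<bar>" using mult_left_mono[OF e, of "\<bar>s\<bar>"] by simp
          finally show ?thesis using s elim by linarith
        qed
        have L: "(\<lambda>N. \<Sum>i<2 ^ N. (ts n / 2 ^ N) * g (zs n + (real i * (ts n / 2 ^ N)) *\<^sub>R e)) \<longlonglongrightarrow> f (zs n + ts n *\<^sub>R e) - f (zs n)"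
          by (rule lim[OF zs(1) ts(1)]) (use near r(3) in auto)
        have "\<bar>(\<Sum>i<2 ^ N. (ts n / 2 ^ N) * g (zs n + (real i * (ts n / 2 ^ N)) *\<^sub>R e)) - ts n * g z0\<bar> \<le> \<bar>ts n\<bar> * \<epsilon>" for N
        proof -
          have "ts n * g z0 = (\<Sum>i<(2::nat) ^ N. (ts n / 2 ^ N) * g z0)" by simp
          then have "\<bar>(\<Sum>i<2 ^ N. (ts n / 2 ^ N) * g (zs n + (real i * (ts n / 2 ^ N)) *\<^sub>R e)) - ts n * g z0\<bar>
             = \<bar>\<Sum>i<2 ^ N. (ts n / 2 ^ N) * (g (zs n + (real i * (ts n / 2 ^ N)) *\<^sub>R e) - g z0)\<bar>"
            by (simp only: sum_subtractf[symmetric] right_diff_distrib)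
          also have "\<dots> \<le> (\<Sum>i<(2::nat) ^ N. \<bar>ts n / 2 ^ N\<bar> * \<epsilon>)"
          proof (rule order_trans[OF sum_abs], rule sum_mono)
            fix i assume "i \<in> {..<(2::nat) ^ N}"
            then have "real i \<le> real (2 ^ N)" unfolding of_nat_le_iff by simp
            then have "real i / 2 ^ N \<le> 1" by simp
            then have "(real i / 2 ^ N) * \<bar>ts n\<bar> \<le> 1 * \<bar>ts n\<bar>" by (rule mult_right_mono) simp
            then have "\<bar>real i * (ts n / 2 ^ N)\<bar> \<le> \<bar>ts n\<bar>" by (simp add: abs_mult)
            from r(2)[OF near[OF this]]
            show "\<bar>(ts n / 2 ^ N) * (g (zs n + (real i * (ts n / 2 ^ N)) *\<^sub>R e) - g z0)\<bar> \<le> \<bar>ts n / 2 ^ N\<bar> * \<epsilon>"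
              unfolding abs_mult by (rule mult_left_mono) simp
          qed
          also have "\<dots> = \<bar>ts n\<bar> * \<epsilon>" by simp
          finally show ?thesis .
        qed
        then show ?case
          by (intro LIMSEQ_le_const2[OF tendsto_rabs[OF tendsto_diff[OF L tendsto_const]]]) auto
      qed
      with l l2 show ?thesis by (intro tendsto_le[OF _ l2 l]) auto
    qed
    with r(1) show ?thesis by blast
  qed
  show ?thesis unfolding DERIV_def LIM_def
  proof (intro allI impI)
    fix \<epsilon> :: real assume \<epsilon>: "0 < \<epsilon>"
    then obtain r where r: "r > 0" "\<And>t. \<bar>t\<bar> < r \<Longrightarrow> \<bar>f (z0 + t *\<^sub>R e) - f z0 - t * g z0\<bar> \<le> \<bar>t\<bar> * (\<epsilon> / 2)"
      using bound[of "\<epsilon> / 2"] by auto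
    show "\<exists>s>0. \<forall>x. x \<noteq> 0 \<and> dist x 0 < s \<longrightarrow> dist ((f (z0 + (0 + x) *\<^sub>R e) - f (z0 + 0 *\<^sub>R e)) / x) (g z0) < \<epsilon>"
    proof (intro exI[of _ r] conjI allI impI r(1))
      fix x :: real assume x: "x \<noteq> 0 \<and> dist x 0 < r"
      have "\<bar>(f (z0 + x *\<^sub>R e) - f z0) / x - g z0\<bar> = \<bar>f (z0 + x *\<^sub>R e) - f z0 - x * g z0\<bar> / \<bar>x\<bar>"
        using x by (simp add: abs_divide[symmetric] diff_divide_distrib)
      also have "\<dots> \<le> \<epsilon> / 2" using r(2)[of x] x by (simp add: divide_le_eq mult.commute)
      also have "\<dots> < \<epsilon>" using \<epsilon> by simp
      finally show "dist ((f (z0 + (0 + x) *\<^sub>R e) - f (z0 + 0 *\<^sub>R e)) / x) (g z0) < \<epsilon>" by (simp add: dist_real_def)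
    qed
  qed
qed

section \<open>All derivative fields and their paths\<close>

context moment_space
begin

theorem matern_field_modification:
  fixes a b :: "real ^ 'n::{finite,linorder}"
    and X :: "real ^ 'n::{finite,linorder} \<Rightarrow> 'w \<Rightarrow> real"
  assumes ab: "\<And>i. a $ i < b $ i" and \<rho>: "\<And>i. \<rho> i > 0"
    and \<mu>: "\<mu> \<in> C_multi \<beta> (box a b)"
    and X: "\<And>z. z \<in> box a b \<Longrightarrow> X z \<in> V"
    and cov: "\<And>z z'. z \<in> box a b \<Longrightarrow> z' \<in> box a b \<Longrightarrow>
       (\<integral>x. X z x * X z' x \<partial>M) = (\<Prod>i\<in>UNIV. matern (\<beta> i) (\<sigma> i) (\<rho> i) (z $ i - z' $ i))"
  shows "\<exists>Y. (\<forall>z\<in>box a b. Y z \<in> borel_measurable M \<and> (AE x in M. Y z x = X z x)) \<and>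
    (AE x in M. (\<lambda>z. \<mu> z + Y z x) \<in> C_multi \<beta> (box a b))"
proof -
  have "\<forall>i. \<exists>k. k 0 = matern (\<beta> i) (\<sigma> i) (\<rho> i) \<and> (\<forall>c\<le>\<beta> i. lip_smooth 0 (k c)) \<and>
    (\<forall>c<\<beta> i. \<exists>g. \<forall>x. (k c has_real_derivative g x) (at x) \<and> (g has_real_derivative - k (Suc c) x) (at x))"
    using lip_smooth_chain[OF lip_smooth_matern[OF \<rho>]] by blast
  from choice[OF this] obtain k where k: "\<And>i. k i 0 = matern (\<beta> i) (\<sigma> i) (\<rho> i)"
    "\<And>i c. c \<le> \<beta> i \<Longrightarrow> lip_smooth 0 (k i c)"
    "\<And>i c. c < \<beta> i \<Longrightarrow> \<exists>g. \<forall>x. (k i c has_real_derivative g x) (at x) \<and> (g has_real_derivative - k i (Suc c) x) (at x)"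
    by blast
  \<comment> \<open>Only the counts are restricted, not the order of the directions: this is
    inherited by tails, and the lists remain countable.\<close>
  define adm where "adm = (\<lambda>is. \<forall>i. count_list is i \<le> \<beta> i)"
  define fld where "fld = (\<lambda>is Z. (\<forall>z\<in>box a b. Z z \<in> V) \<and> (\<forall>z\<in>box a b. \<forall>z'\<in>box a b.
     (\<integral>x. Z z x * Z z' x \<partial>M) = (\<Prod>i\<in>UNIV. k i (count_list is i) (z $ i - z' $ i))))"
  define stp where "stp = (\<lambda>i is Z Z'. fld (i # is) Z' \<and>
    (\<exists>C\<ge>0. \<forall>z\<in>box a b. \<forall>t. z + t *\<^sub>R axis i 1 \<in> box a b \<longrightarrow>
       (\<integral>x. (Z (z + t *\<^sub>R axis i 1) x - Z z x - t * Z' z x)\<^sup>2 \<partial>M) \<le> C * \<bar>t\<bar> ^ 3))"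
  \<comment> \<open>The choice is made along the list, so each derivative field is attached by
    \<open>stp\<close> to the very field chosen for the tail. Separate choices for each list would
    lose this link.\<close>
  define F where "F = rec_list X (\<lambda>i is Z. SOME Z'. stp i is Z Z')"
  have F_Nil: "F [] = X" and F_Cons: "F (i # is) = (SOME Z'. stp i is (F is) Z')" for i "is"
    by (simp_all add: F_def)
  have adm_tl: "adm is" if "adm (i # is)" for i "is"
    unfolding adm_def
  proof
    fix l
    have "count_list is l \<le> count_list (i # is) l" by simp
    also have "\<dots> \<le> \<beta> l" using that unfolding adm_def by blast
    finally show "count_list is l \<le> \<beta> l" .
  qed
  have ex: "\<exists>Z'. stp i is Z Z'" if adm: "adm (i # is)" and Z: "fld is Z" for i "is" Z
  proof -
    have "Suc (count_list is i) \<le> \<beta> i" using adm[unfolded adm_def, THEN spec[of _ i]] by simp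
    then have c: "count_list is i < \<beta> i" by simp
    then obtain g where g: "\<And>x. (k i (count_list is i) has_real_derivative g x) (at x)"
        "\<And>x. (g has_real_derivative - k i (Suc (count_list is i)) x) (at x)" using k(3) by blast
    have upd: "((\<lambda>l. k l (count_list is l))(i := k i (Suc (count_list is i)))) l = k l (count_list (i # is) l)" for l
      by simp
    have Z1: "\<And>z. z \<in> box a b \<Longrightarrow> Z z \<in> V"
      and Z2: "\<And>z z'. z \<in> box a b \<Longrightarrow> z' \<in> box a b \<Longrightarrow>
        (\<integral>x. Z z x * Z z' x \<partial>M) = (\<Prod>i\<in>UNIV. k i (count_list is i) (z $ i - z' $ i))"
      using Z by (simp_all add: fld_def)
    have kS: "lip_smooth 0 (k i (Suc (count_list is i)))" by (rule k(2)) (use c in simp)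
    show ?thesis
      using L2_derivative[of a b Z "\<lambda>l. k l (count_list is l)" i g "k i (Suc (count_list is i))", OF Z1 Z2 g kS]
      unfolding stp_def fld_def upd by blast
  qed
  have fldX: "fld [] X" using X cov k(1) by (simp add: fld_def)
  have fld: "adm is \<Longrightarrow> fld is (F is)" for "is"
  proof (induction "is")
    case Nil
    then show ?case using fldX by (simp add: F_Nil)
  next
    case (Cons i "is")
    from Cons.IH[OF adm_tl[OF Cons.prems]] have "\<exists>Z'. stp i is (F is) Z'" by (rule ex[OF Cons.prems])
    then have "stp i is (F is) (F (i # is))" unfolding F_Cons by (rule someI_ex)
    then show ?case by (simp add: stp_def)
  qed
  have stp: "stp i is (F is) (F (i # is))" if "adm (i # is)" for i "is"
    unfolding F_Cons by (rule someI_ex[OF ex[OF that fld[OF adm_tl[OF that]]]])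
  have FV: "F is z \<in> V" if "adm is" "z \<in> box a b" for "is" z using fld[OF that(1)] that(2) by (simp add: fld_def)
  \<comment> \<open>Vacuous for lists that are not admissible, so that a single choice function
    covers all lists.\<close>
  have "\<forall>is. \<exists>Y. adm is \<longrightarrow> (\<forall>z\<in>box a b. Y z \<in> borel_measurable M \<and> (AE x in M. Y z x = F is z x)) \<and>
    (AE x in M. continuous_on (box a b) (\<lambda>z. Y z x))"
  proof
    fix "is"
    show "\<exists>Y. adm is \<longrightarrow> (\<forall>z\<in>box a b. Y z \<in> borel_measurable M \<and> (AE x in M. Y z x = F is z x)) \<and>
      (AE x in M. continuous_on (box a b) (\<lambda>z. Y z x))"
    proof (cases "adm is")
      case True
      have Z1: "\<And>z. z \<in> box a b \<Longrightarrow> F is z \<in> V"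
        and Z2: "\<And>z z'. z \<in> box a b \<Longrightarrow> z' \<in> box a b \<Longrightarrow>
          (\<integral>x. F is z x * F is z' x \<partial>M) = (\<Prod>i\<in>UNIV. k i (count_list is i) (z $ i - z' $ i))"
        using fld[OF True] by (simp_all add: fld_def)
      have kl: "\<And>i. lip_smooth 0 (k i (count_list is i))" by (rule k(2)) (use True in \<open>simp add: adm_def\<close>)
      obtain C where C: "C \<ge> 0" "\<forall>s\<in>box a b. \<forall>t\<in>box a b. (\<integral>x. (F is s x - F is t x)\<^sup>2 \<partial>M) \<le> C * norm (s - t)"
        using product_covariance_lipschitz[of a b "F is" "\<lambda>i. k i (count_list is i)", OF Z1 Z2 kl] by blast
      then have L: "\<And>s t. s \<in> box a b \<Longrightarrow> t \<in> box a b \<Longrightarrow> (\<integral>x. (F is s x - F is t x)\<^sup>2 \<partial>M) \<le> C * norm (s - t)" by blast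
      show ?thesis using continuous_modification[of a b "F is" C, OF ab Z1 C(1) L] by blast
    qed simp
  qed
  from choice[OF this] obtain Y where
    Y: "\<And>is z. adm is \<Longrightarrow> z \<in> box a b \<Longrightarrow> Y is z \<in> borel_measurable M"
      "\<And>is z. adm is \<Longrightarrow> z \<in> box a b \<Longrightarrow> AE x in M. Y is z x = F is z x"
      "\<And>is. adm is \<Longrightarrow> AE x in M. continuous_on (box a b) (\<lambda>z. Y is z x)"
    by blast
  obtain D :: "(real ^ 'n::{finite,linorder}) set" where D: "countable D" "\<And>S. open S \<Longrightarrow> S \<noteq> {} \<Longrightarrow> \<exists>d\<in>D. d \<in> S"
    using countable_dense_exists by blast
  define Q where "Q = D \<inter> box a b"
  have Qd: "\<exists>q\<in>Q. dist q z < r" if "z \<in> box a b" "r > 0" for z r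
  proof -
    have "open (ball z r \<inter> box a b)" "z \<in> ball z r \<inter> box a b"
      using that by (auto intro: open_box)
    then have "open (ball z r \<inter> box a b)" "ball z r \<inter> box a b \<noteq> {}" by blast+
    from D(2)[OF this] show ?thesis by (auto simp: Q_def dist_commute)
  qed
  define R where "R = (\<lambda>i is z t x. (\<lambda>n. \<Sum>j<2 ^ n. (t / 2 ^ n) * Y (i # is) (z + (real j * (t / 2 ^ n)) *\<^sub>R axis i 1) x)
     \<longlonglongrightarrow> Y is (z + t *\<^sub>R axis i 1) x - Y is z x)"
  have R: "AE x in M. R i is z t x" if adm: "adm (i # is)" and z: "z \<in> box a b" "z + t *\<^sub>R axis i 1 \<in> box a b" for i "is" z t
  proof -
    have adm': "adm is" by (rule adm_tl[OF adm])
    obtain C where C: "C \<ge> 0" "\<And>z t. z \<in> box a b \<Longrightarrow> z + t *\<^sub>R axis i 1 \<in> box a b \<Longrightarrow>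
       (\<integral>x. (F is (z + t *\<^sub>R axis i 1) x - F is z x - t * F (i # is) z x)\<^sup>2 \<partial>M) \<le> C * \<bar>t\<bar> ^ 3"
      using stp[OF adm] unfolding stp_def by blast
    have A: "AE x in M. (\<lambda>n. \<Sum>j<2 ^ n. (t / 2 ^ n) * F (i # is) (z + (real j * (t / 2 ^ n)) *\<^sub>R axis i 1) x)
       \<longlonglongrightarrow> F is (z + t *\<^sub>R axis i 1) x - F is z x"
      by (rule riemann_sum_AE[OF FV[OF adm'] FV[OF adm] C z])
    have pb: "z + (real j * (t / 2 ^ n)) *\<^sub>R axis i 1 \<in> box a b" if "j < 2 ^ n" for j n
    proof -
      have "real j \<le> real (2 ^ n)" unfolding of_nat_le_iff using that by simp
      then have "(1 - real j / 2 ^ n) *\<^sub>R z + (real j / 2 ^ n) *\<^sub>R (z + t *\<^sub>R axis i 1) \<in> box a b"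
        using z by (intro convexD[OF convex_box(2)]) auto
      moreover have "(1 - real j / 2 ^ n) *\<^sub>R z + (real j / 2 ^ n) *\<^sub>R (z + t *\<^sub>R axis i 1) = z + (real j * (t / 2 ^ n)) *\<^sub>R axis i 1"
        by (simp add: algebra_simps)
      ultimately show ?thesis by simp
    qed
    \<comment> \<open>The null set on which the modification differs from the field depends on the
      point, but one segment has only countably many grid points.\<close>
    have B: "AE x in M. \<forall>n. \<forall>j\<in>{..<2 ^ n}. Y (i # is) (z + (real j * (t / 2 ^ n)) *\<^sub>R axis i 1) x =
        F (i # is) (z + (real j * (t / 2 ^ n)) *\<^sub>R axis i 1) x"
      unfolding AE_all_countable
      by (intro allI AE_ball_countable' Y(2)[OF adm] pb) (auto intro: countable_finite)
    show ?thesis using A B Y(2)[OF adm' z(1)] Y(2)[OF adm' z(2)]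
      by eventually_elim (simp add: R_def)
  qed
  \<comment> \<open>Countability of this index set lets the exceptional sets of all segments merge
    into one null set.\<close>
  define I where "I = {(i, is, z, t). adm (i # is) \<and> z \<in> Q \<and> t \<in> \<rat> \<and> z + t *\<^sub>R axis i 1 \<in> box a b}"
  have cI: "countable I"
  proof (rule countable_subset)
    show "I \<subseteq> UNIV \<times> UNIV \<times> Q \<times> (\<rat> :: real set)" by (auto simp: I_def)
    show "countable (UNIV \<times> UNIV \<times> Q \<times> (\<rat> :: real set) :: ('n \<times> 'n list \<times> (real ^ 'n::{finite,linorder}) \<times> real) set)"
      using D(1) countable_rat by (intro countable_SIGMA) (auto simp: Q_def intro: countable_finite countableI_type)
  qed
  have AR: "AE x in M. \<forall>p\<in>I. (case p of (i, is, z, t) \<Rightarrow> R i is z t x)"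
  proof (rule AE_ball_countable'[OF _ cI])
    fix p assume "p \<in> I"
    then obtain i "is" z t where p: "p = (i, is, z, t)" "adm (i # is)" "z \<in> box a b" "z + t *\<^sub>R axis i 1 \<in> box a b"
      unfolding I_def Q_def by blast
    show "AE x in M. (case p of (i, is, z, t) \<Rightarrow> R i is z t x)" using R[OF p(2-4)] by (simp add: p(1))
  qed
  have AC: "AE x in M. \<forall>is\<in>{is. adm is}. continuous_on (box a b) (\<lambda>z. Y is z x)"
    by (rule AE_ball_countable') (auto intro: Y(3))
  have adm_dir: "adm (directions \<alpha>)" if "\<alpha> \<le> \<beta>" for \<alpha>
    using that by (simp add: adm_def count_list_directions le_fun_def)
  have "AE x in M. (\<lambda>z. \<mu> z + Y [] z x) \<in> C_multi \<beta> (box a b)"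
    using AR AC
  proof eventually_elim
    case (elim x)
    have cY: "continuous_on (box a b) (\<lambda>z. Y is z x)" if "adm is" for "is" using elim(2) that by simp
    show ?case
    \<comment> \<open>The candidates are the iterated partial derivatives of the mean plus the paths
      of the modified derivative fields.\<close>
    proof (rule C_multi_family[where F="\<lambda>is z. foldr partial_deriv is \<mu> z + Y is z x"])
      show "open (box a b)" by (rule open_box)
      show "continuous_on (box a b) (\<lambda>z. foldr partial_deriv (directions \<alpha>) \<mu> z + Y (directions \<alpha>) z x)" if "\<alpha> \<le> \<beta>" for \<alpha>
      proof (intro continuous_on_add cY adm_dir that)
        show "continuous_on (box a b) (foldr partial_deriv (directions \<alpha>) \<mu>)"
          using \<mu> that unfolding C_multi_def mixed_partial_def by blast
      qed
      fix \<alpha> i "is" z assume \<alpha>: "\<alpha> \<le> \<beta>" "directions \<alpha> = i # is" and z: "z \<in> box a b"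
      have adm: "adm (i # is)" using adm_dir[OF \<alpha>(1)] \<alpha>(2) by simp
      have "((\<lambda>t. Y is (z + t *\<^sub>R axis i 1) x) has_real_derivative Y (i # is) z x) (at 0)"
      proof (rule DERIV_of_riemann_sums[where f="\<lambda>z. Y is z x" and g="\<lambda>z. Y (i # is) z x" and Q=Q and S="box a b"])
        show "\<exists>q\<in>Q. dist q z < r" if "z \<in> box a b" "r > 0" for z r by (rule Qd[OF that])
        fix w :: "real ^ 'n::{finite,linorder}" and t :: real
        assume w: "w \<in> Q" "t \<in> \<rat>" "\<And>s. \<bar>s\<bar> \<le> \<bar>t\<bar> \<Longrightarrow> w + s *\<^sub>R axis i 1 \<in> box a b"
        have "(i, is, w, t) \<in> I" using w adm by (simp add: I_def)
        with elim(1) have "R i is w t x" by blast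
        then show "(\<lambda>n. \<Sum>j<2 ^ n. (t / 2 ^ n) * Y (i # is) (w + (real j * (t / 2 ^ n)) *\<^sub>R axis i 1) x)
           \<longlonglongrightarrow> Y is (w + t *\<^sub>R axis i 1) x - Y is w x" by (simp only: R_def)
      qed (use z cY adm adm_tl[OF adm] in \<open>auto simp: open_box norm_axis_1\<close>)
      with C_multi_DERIV[OF \<mu> \<alpha> z]
      show "((\<lambda>t. foldr partial_deriv is \<mu> (z + t *\<^sub>R axis i 1) + Y is (z + t *\<^sub>R axis i 1) x) has_real_derivative
          foldr partial_deriv (i # is) \<mu> z + Y (i # is) z x) (at 0)"
        by (rule DERIV_add)
    qed simp
  qed
  moreover have "adm []" by (simp add: adm_def)
  ultimately show ?thesis using Y(1,2)[of "[]"] unfolding F_Nil by (intro exI[of _ "Y []"]) simp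
qed

end

section \<open>Gaussian processes\<close>

text \<open>The double factorial (2r - 1)!!, which is the moment of order 2r of the standard normal
  law.\<close>

definition normal_moment_const :: "nat \<Rightarrow> real" where
  "normal_moment_const r = fact (2 * r) / (2 ^ r * fact r)"

lemma normal_law_moments:
  assumes U: "U \<in> borel_measurable M" and P: "prob_space M" and s: "0 \<le> s" and d: "distr M borel U = normal_law m s"
  shows "integrable M U" "integral\<^sup>L M U = m"
    "integrable M (\<lambda>x. (U x - m) ^ (2 * r))"
    "(\<integral>x. (U x - m) ^ (2 * r) \<partial>M) = normal_moment_const r * (s\<^sup>2) ^ r"
proof -
  interpret prob_space M by (rule P)
  have int: "integrable M (\<lambda>x. f (U x)) \<longleftrightarrow> integrable (normal_law m s) f" if "f \<in> borel_measurable borel" for f :: "real \<Rightarrow> real"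
    unfolding d[symmetric] using U that by (rule integrable_distr_eq[symmetric])
  have eq: "(\<integral>x. f (U x) \<partial>M) = integral\<^sup>L (normal_law m s) f" if "f \<in> borel_measurable borel" for f :: "real \<Rightarrow> real"
    unfolding d[symmetric] using U that by (rule integral_distr[symmetric])
  have law: "integrable (normal_law m s) (\<lambda>x. x) \<and> integral\<^sup>L (normal_law m s) (\<lambda>x. x) = m \<and>
    integrable (normal_law m s) (\<lambda>x. (x - m) ^ (2 * r)) \<and>
    integral\<^sup>L (normal_law m s) (\<lambda>x. (x - m) ^ (2 * r)) = normal_moment_const r * (s\<^sup>2) ^ r"
  proof (cases "s = 0")
    case True
    have i: "integrable (return borel m) f" if f: "f \<in> borel_measurable borel" for f :: "real \<Rightarrow> real"
    proof (rule integrableI_bounded)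
      have "(\<lambda>x. ennreal (norm (f x))) \<in> borel_measurable borel" using f by measurable
      then show "(\<integral>\<^sup>+x. ennreal (norm (f x)) \<partial>return borel m) < \<infinity>"
        by (subst nn_integral_return) auto
    qed (use f in simp)
    have N: "normal_law m s = return borel m" using True by (simp add: normal_law_def)
    have e: "integral\<^sup>L (return borel m) f = f m" if "f \<in> borel_measurable borel" for f :: "real \<Rightarrow> real"
      by (rule integral_return) (use that in auto)
    \<comment> \<open>For r = 0 this rests on 0 ^ 0 = 1 on both sides; for r > 0 both sides
      vanish.\<close>
    have "(m - m) ^ (2 * r) = normal_moment_const r * (s\<^sup>2) ^ r"
      using True by (cases "r = 0") (auto simp: normal_moment_const_def zero_power)
    then show ?thesis unfolding N by (simp add: i e)
  next
    case False
    with s have s: "s > 0" by simp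
    have N: "normal_law m s = density lborel (\<lambda>x. ennreal (normal_density m s x))"
      using s by (simp add: normal_law_def)
    have i: "integrable (normal_law m s) f \<longleftrightarrow> integrable lborel (\<lambda>x. normal_density m s x * f x)"
      if "f \<in> borel_measurable borel" for f :: "real \<Rightarrow> real"
      unfolding N using that by (subst integrable_density) auto
    have e: "integral\<^sup>L (normal_law m s) f = integral\<^sup>L lborel (\<lambda>x. normal_density m s x * f x)"
      if "f \<in> borel_measurable borel" for f :: "real \<Rightarrow> real"
      unfolding N using that by (subst integral_density) auto
    have "fact (2 * r) / ((2 / s\<^sup>2) ^ r * fact r) = normal_moment_const r * (s\<^sup>2) ^ r"
      using s by (simp add: normal_moment_const_def power_divide)
    then have r: "has_bochner_integral lborel (\<lambda>x. normal_density m s x * (x - m) ^ (2 * r)) (normal_moment_const r * (s\<^sup>2) ^ r)"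
      using normal_moment_even[OF s, of m r] by (simp only:)
    have 1: "(\<lambda>x::real. x) \<in> borel_measurable borel" "(\<lambda>x::real. (x - m) ^ (2 * r)) \<in> borel_measurable borel"
      by measurable
    show ?thesis
      unfolding i[OF 1(1)] i[OF 1(2)] e[OF 1(1)] e[OF 1(2)]
      using normal_moment_nz_1[OF s, of m] r by (simp add: has_bochner_integral_iff)
  qed
  show "integrable M U" using int[of "\<lambda>x. x"] law by simp
  show "integral\<^sup>L M U = m" using eq[of "\<lambda>x. x"] law by simp
  show "integrable M (\<lambda>x. (U x - m) ^ (2 * r))" using int[of "\<lambda>x. (x - m) ^ (2 * r)"] law by simp
  show "(\<integral>x. (U x - m) ^ (2 * r) \<partial>M) = normal_moment_const r * (s\<^sup>2) ^ r"
    using eq[of "\<lambda>x. (x - m) ^ (2 * r)"] law by simp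
qed

section \<open>The Gaussian Hilbert space of the process\<close>

definition centred_span :: "'i set \<Rightarrow> ('i \<Rightarrow> 'w \<Rightarrow> real) \<Rightarrow> ('i \<Rightarrow> real) \<Rightarrow> ('w \<Rightarrow> real) set" where
  "centred_span I X \<mu> = {(\<lambda>\<omega>. \<Sum>z\<in>J. c z * (X z \<omega> - \<mu> z)) | J c. finite J \<and> J \<subseteq> I}"

lemma centred_span_single: "z \<in> I \<Longrightarrow> (\<lambda>\<omega>. X z \<omega> - \<mu> z) \<in> centred_span I X \<mu>"
  unfolding centred_span_def by (intro CollectI exI[of _ "{z}"] exI[of _ "\<lambda>_. 1"]) simp

lemma centred_span_cmult: "L \<in> centred_span I X \<mu> \<Longrightarrow> (\<lambda>\<omega>. c * L \<omega>) \<in> centred_span I X \<mu>"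
proof -
  assume "L \<in> centred_span I X \<mu>"
  then obtain J d where J: "L = (\<lambda>\<omega>. \<Sum>z\<in>J. d z * (X z \<omega> - \<mu> z))" "finite J" "J \<subseteq> I"
    by (auto simp: centred_span_def)
  show ?thesis unfolding centred_span_def
    by (intro CollectI exI[of _ J] exI[of _ "\<lambda>z. c * d z"]) (simp add: J sum_distrib_left mult.assoc)
qed

lemma centred_span_add:
  assumes "L \<in> centred_span I X \<mu>" "L' \<in> centred_span I X \<mu>"
  shows "(\<lambda>\<omega>. L \<omega> + L' \<omega>) \<in> centred_span I X \<mu>"
proof -
  obtain J d where J: "L = (\<lambda>\<omega>. \<Sum>z\<in>J. d z * (X z \<omega> - \<mu> z))" "finite J" "J \<subseteq> I"
    using assms(1) by (auto simp: centred_span_def)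
  obtain J' d' where J': "L' = (\<lambda>\<omega>. \<Sum>z\<in>J'. d' z * (X z \<omega> - \<mu> z))" "finite J'" "J' \<subseteq> I"
    using assms(2) by (auto simp: centred_span_def)
  \<comment> \<open>Both coefficient families are extended by 0, so that they add up on the overlap
    of \<open>J\<close> and \<open>J'\<close>.\<close>
  define c where "c = (\<lambda>z. (if z \<in> J then d z else 0) + (if z \<in> J' then d' z else 0))"
  have "L \<omega> + L' \<omega> = (\<Sum>z\<in>J \<union> J'. c z * (X z \<omega> - \<mu> z))" for \<omega>
  proof -
    have "L \<omega> = (\<Sum>z\<in>J \<union> J'. (if z \<in> J then d z else 0) * (X z \<omega> - \<mu> z))"
      unfolding J(1) by (rule sum.mono_neutral_cong_left) (use J J' in auto)
    moreover have "L' \<omega> = (\<Sum>z\<in>J \<union> J'. (if z \<in> J' then d' z else 0) * (X z \<omega> - \<mu> z))"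
      unfolding J'(1) by (rule sum.mono_neutral_cong_left) (use J J' in auto)
    ultimately show ?thesis by (simp add: c_def distrib_right sum.distrib)
  qed
  then show ?thesis unfolding centred_span_def
    by (intro CollectI exI[of _ "J \<union> J'"] exI[of _ c]) (use J J' in auto)
qed

text \<open>A member of the span is a normal variable minus its mean, once the parameter
  \<open>m\<close> of its law is identified by linearity of the integral. Even moments are then
  exact multiples of powers of the variance.\<close>

lemma gaussian_process_span_moments:
  assumes gp: "gaussian_process M I X \<mu> \<Sigma>" and L: "L \<in> centred_span I X \<mu>"
  shows "L \<in> borel_measurable M" "integrable M (\<lambda>x. (L x) ^ (2 * r))"
    "(\<integral>x. (L x) ^ (2 * r) \<partial>M) = normal_moment_const r * (\<integral>x. (L x)\<^sup>2 \<partial>M) ^ r"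
proof -
  interpret prob_space M using gp by (simp add: gaussian_process_def)
  have Xm[measurable]: "\<And>z. z \<in> I \<Longrightarrow> X z \<in> borel_measurable M" using gp by (simp add: gaussian_process_def)
  have law: "\<And>J c. finite J \<Longrightarrow> J \<subseteq> I \<Longrightarrow> \<exists>m s. 0 \<le> s \<and> distr M borel (\<lambda>\<omega>. \<Sum>z\<in>J. c z * X z \<omega>) = normal_law m s"
    using gp by (simp add: gaussian_process_def)
  have mean: "\<And>z. z \<in> I \<Longrightarrow> (\<integral>\<omega>. X z \<omega> \<partial>M) = \<mu> z" using gp by (simp add: gaussian_process_def)
  have Xint: "integrable M (X z)" if z: "z \<in> I" for z
  proof -
    have "\<exists>m s. 0 \<le> s \<and> distr M borel (X z) = normal_law m s"
      using law[of "{z}" "\<lambda>_. 1"] z by simp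
    then obtain m s where "0 \<le> s" "distr M borel (X z) = normal_law m s" by blast
    from normal_law_moments(1)[OF Xm[OF z] prob_space_axioms this] show ?thesis .
  qed
  obtain J c where J: "L = (\<lambda>\<omega>. \<Sum>z\<in>J. c z * (X z \<omega> - \<mu> z))" "finite J" "J \<subseteq> I"
    using L by (auto simp: centred_span_def)
  define U where "U = (\<lambda>\<omega>. \<Sum>z\<in>J. c z * X z \<omega>)"
  have Um: "U \<in> borel_measurable M" unfolding U_def using J by (intro borel_measurable_sum borel_measurable_times) (auto intro: Xm)
  obtain m s where ms: "0 \<le> s" "distr M borel U = normal_law m s" using law[OF J(2,3), of c] by (auto simp: U_def)
  note nm = normal_law_moments[OF Um prob_space_axioms ms]
  have "m = (\<Sum>z\<in>J. c z * \<mu> z)"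
  proof -
    have "m = (\<integral>\<omega>. U \<omega> \<partial>M)" using nm(2) by simp
    also have "\<dots> = (\<Sum>z\<in>J. \<integral>\<omega>. c z * X z \<omega> \<partial>M)"
      unfolding U_def by (intro Bochner_Integration.integral_sum integrable_mult_right) (use J Xint in auto)
    also have "\<dots> = (\<Sum>z\<in>J. c z * \<mu> z)" using J mean by (intro sum.cong) auto
    finally show ?thesis .
  qed
  then have LU: "L = (\<lambda>x. U x - m)" by (simp add: J(1) U_def right_diff_distrib sum_subtractf)
  show "L \<in> borel_measurable M" unfolding LU using Um by simp
  show "integrable M (\<lambda>x. (L x) ^ (2 * r))" unfolding LU by (rule nm(3))
  \<comment> \<open>For r = 1 the constant is 1, which identifies the variance parameter of the law
    with the second moment.\<close>
  have "(\<integral>x. (L x)\<^sup>2 \<partial>M) = s\<^sup>2" using nm(4)[of 1] by (simp add: LU normal_moment_const_def)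
  then show "(\<integral>x. (L x) ^ (2 * r) \<partial>M) = normal_moment_const r * (\<integral>x. (L x)\<^sup>2 \<partial>M) ^ r"
    using nm(4)[of r] by (simp add: LU)
qed

definition L2_closure :: "'w measure \<Rightarrow> ('w \<Rightarrow> real) set \<Rightarrow> ('w \<Rightarrow> real) set" where
  "L2_closure M S = {Y. sq_integrable M Y \<and> (\<forall>\<epsilon>>0. \<exists>L\<in>S. (\<integral>x. (L x - Y x)\<^sup>2 \<partial>M) < \<epsilon>)}"

text \<open>Moments of a member of the closure are obtained by Fatou's lemma along approximants from
  the span that also converge almost everywhere. The moment identity of the span thereby becomes an
  inequality, the form that \<open>moment_space\<close> records.\<close>

lemma gaussian_process_moment_space:
  assumes gp: "gaussian_process M I X \<mu> \<Sigma>"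
  shows "moment_space M (L2_closure M (centred_span I X \<mu>)) normal_moment_const"
    "\<And>z. z \<in> I \<Longrightarrow> (\<lambda>\<omega>. X z \<omega> - \<mu> z) \<in> L2_closure M (centred_span I X \<mu>)"
proof -
  interpret prob_space M using gp by (simp add: gaussian_process_def)
  define S where "S = centred_span I X \<mu>"
  define V where "V = L2_closure M S"
  note mom = gaussian_process_span_moments[OF gp, folded S_def]
  have Sq: "sq_integrable M L" if "L \<in> S" for L
    using mom(1)[OF that] mom(2)[OF that, of 1] by (simp add: sq_integrable_def)
  have Vq: "sq_integrable M Y" if "Y \<in> V" for Y using that by (simp add: V_def L2_closure_def)
  have Vap: "\<exists>L\<in>S. (\<integral>x. (L x - Y x)\<^sup>2 \<partial>M) < \<epsilon>" if "Y \<in> V" "\<epsilon> > 0" for Y \<epsilon>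
    using that by (simp add: V_def L2_closure_def)
  have double: "(\<integral>x. (f x + g x)\<^sup>2 \<partial>M) \<le> 2 * (\<integral>x. (f x)\<^sup>2 \<partial>M) + 2 * (\<integral>x. (g x)\<^sup>2 \<partial>M)"
    if "sq_integrable M f" "sq_integrable M g" for f g
  proof -
    have "(\<integral>x. (f x + g x)\<^sup>2 \<partial>M) \<le> (\<integral>x. 2 * (f x)\<^sup>2 + 2 * (g x)\<^sup>2 \<partial>M)"
      using that sq_integrable_add[OF that] by (intro integral_mono) (auto simp: sq_integrable_def sq_le_double)
    also have "\<dots> = 2 * (\<integral>x. (f x)\<^sup>2 \<partial>M) + 2 * (\<integral>x. (g x)\<^sup>2 \<partial>M)"
      using that by (simp add: sq_integrable_def)
    finally show ?thesis .
  qed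
  have seq: "\<exists>L. (\<forall>n. L n \<in> S) \<and> (\<lambda>n. \<integral>x. (L n x - Y x)\<^sup>2 \<partial>M) \<longlonglongrightarrow> 0 \<and> (AE x in M. (\<lambda>n. L n x) \<longlonglongrightarrow> Y x)"
    if Y: "Y \<in> V" for Y
  proof -
    \<comment> \<open>Summable errors 2^(-n) add almost everywhere convergence to convergence in
      L2.\<close>
    have "\<forall>n. \<exists>L. L \<in> S \<and> (\<integral>x. (L x - Y x)\<^sup>2 \<partial>M) < (1/2) ^ n"
    proof
      fix n
      have "(0 :: real) < (1/2) ^ n" by simp
      from Vap[OF Y this] show "\<exists>L. L \<in> S \<and> (\<integral>x. (L x - Y x)\<^sup>2 \<partial>M) < (1/2) ^ n" by (simp only: Bex_def)
    qed
    from choice[OF this] obtain L where L: "\<And>n. L n \<in> S" "\<And>n. (\<integral>x. (L n x - Y x)\<^sup>2 \<partial>M) < (1/2) ^ n" by auto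
    have "(\<lambda>n. \<integral>x. (L n x - Y x)\<^sup>2 \<partial>M) \<longlonglongrightarrow> 0"
      by (rule tendsto_sandwich[OF _ _ tendsto_const LIMSEQ_power_zero[of "1/2"]])
        (auto intro!: always_eventually less_imp_le[OF L(2)])
    moreover have "AE x in M. summable (\<lambda>n. (L n x - Y x)\<^sup>2)"
    proof (rule AE_summable)
      show "integrable M (\<lambda>x. (L n x - Y x)\<^sup>2)" for n
        using sq_integrable_diff[OF Sq[OF L(1)] Vq[OF Y]] by (simp add: sq_integrable_def)
      show "summable (\<lambda>n. \<integral>x. (L n x - Y x)\<^sup>2 \<partial>M)"
        by (rule summable_comparison_test'[OF summable_geometric[of "1/2"]])
          (auto intro!: less_imp_le[OF L(2)])
    qed simp
    then have "AE x in M. (\<lambda>n. L n x) \<longlonglongrightarrow> Y x"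
    proof eventually_elim
      case (elim x)
      from summable_LIMSEQ_zero[OF this] have "(\<lambda>n. L n x - Y x) \<longlonglongrightarrow> 0" by (simp add: power_tendsto_0_iff)
      then show ?case by (rule LIM_zero_cancel)
    qed
    ultimately show ?thesis using L(1) by blast
  qed
  have "moment_space M V normal_moment_const"
  proof (unfold_locales)
    show "sq_integrable M Y" if "Y \<in> V" for Y by (rule Vq[OF that])
    show "(\<lambda>x. Y x + Z x) \<in> V" if YZ: "Y \<in> V" "Z \<in> V" for Y Z
      unfolding V_def L2_closure_def
    proof (intro CollectI conjI allI impI)
      show "sq_integrable M (\<lambda>x. Y x + Z x)" by (intro sq_integrable_add Vq YZ)
      fix \<epsilon> :: real assume "\<epsilon> > 0"
      \<comment> \<open>Two errors, each doubled by \<open>double\<close>, hence a quarter for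
        each.\<close>
      then have "\<epsilon> / 4 > 0" by simp
      from Vap[OF YZ(1) this] Vap[OF YZ(2) this] obtain L L' where L: "L \<in> S" "L' \<in> S"
        "(\<integral>x. (L x - Y x)\<^sup>2 \<partial>M) < \<epsilon> / 4" "(\<integral>x. (L' x - Z x)\<^sup>2 \<partial>M) < \<epsilon> / 4" by blast
      have "(\<integral>x. ((L x - Y x) + (L' x - Z x))\<^sup>2 \<partial>M) < \<epsilon>"
        using double[OF sq_integrable_diff[OF Sq[OF L(1)] Vq[OF YZ(1)]] sq_integrable_diff[OF Sq[OF L(2)] Vq[OF YZ(2)]]] L(3,4)
        by linarith
      moreover have "(L x - Y x) + (L' x - Z x) = (L x + L' x) - (Y x + Z x)" for x by simp
      ultimately have "(\<integral>x. ((L x + L' x) - (Y x + Z x))\<^sup>2 \<partial>M) < \<epsilon>" by (simp only:)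
      then show "\<exists>L\<in>S. (\<integral>x. (L x - (Y x + Z x))\<^sup>2 \<partial>M) < \<epsilon>"
        by (intro bexI[of _ "\<lambda>x. L x + L' x"]) (use centred_span_add[OF L(1,2)[unfolded S_def]] in \<open>simp_all add: S_def\<close>)
    qed
    show "(\<lambda>x. c * Y x) \<in> V" if Y: "Y \<in> V" for Y c
      unfolding V_def L2_closure_def
    proof (intro CollectI conjI allI impI)
      show "sq_integrable M (\<lambda>x. c * Y x)" by (intro sq_integrable_cmult Vq Y)
      fix \<epsilon> :: real assume \<epsilon>: "\<epsilon> > 0"
      \<comment> \<open>The added 1 avoids a division by 0 and keeps the final inequality
        strict.\<close>
      define \<delta> where "\<delta> = \<epsilon> / (c\<^sup>2 + 1)"
      have c: "0 < c\<^sup>2 + 1" using zero_le_power2[of c] by linarith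
      then have \<delta>: "\<delta> > 0" "(c\<^sup>2 + 1) * \<delta> = \<epsilon>" using \<epsilon> by (simp_all add: \<delta>_def)
      from Vap[OF Y \<delta>(1)] obtain L where L: "L \<in> S" "(\<integral>x. (L x - Y x)\<^sup>2 \<partial>M) < \<delta>" by blast
      have "(c * u - c * v)\<^sup>2 = c\<^sup>2 * (u - v)\<^sup>2" for u v :: real
        unfolding right_diff_distrib[symmetric] by (rule power_mult_distrib)
      then have "(\<integral>x. (c * L x - c * Y x)\<^sup>2 \<partial>M) = c\<^sup>2 * (\<integral>x. (L x - Y x)\<^sup>2 \<partial>M)" by simp
      moreover have "c\<^sup>2 * (\<integral>x. (L x - Y x)\<^sup>2 \<partial>M) \<le> c\<^sup>2 * \<delta>" using L(2) by (intro mult_left_mono) auto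
      moreover have "c\<^sup>2 * \<delta> + \<delta> = \<epsilon>" using \<delta>(2) by (simp add: distrib_right)
      ultimately have "(\<integral>x. (c * L x - c * Y x)\<^sup>2 \<partial>M) < \<epsilon>" using \<delta>(1) by linarith
      then show "\<exists>L\<in>S. (\<integral>x. (L x - c * Y x)\<^sup>2 \<partial>M) < \<epsilon>"
        by (intro bexI[of _ "\<lambda>x. c * L x"]) (use centred_span_cmult[OF L(1)[unfolded S_def]] in \<open>simp_all add: S_def\<close>)
    qed
    show "Y \<in> V" if f: "\<And>n. f n \<in> V" and Y: "sq_integrable M Y" and l: "(\<lambda>n. \<integral>x. (f n x - Y x)\<^sup>2 \<partial>M) \<longlonglongrightarrow> 0" for f Y
      unfolding V_def L2_closure_def
    proof (intro CollectI conjI allI impI Y)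
      fix \<epsilon> :: real assume "\<epsilon> > 0"
      then have \<epsilon>: "\<epsilon> / 4 > 0" by simp
      obtain n where n: "(\<integral>x. (f n x - Y x)\<^sup>2 \<partial>M) < \<epsilon> / 4"
        using order_tendstoD(2)[OF l \<epsilon>] by (auto simp: eventually_sequentially)
      obtain L where L: "L \<in> S" "(\<integral>x. (L x - f n x)\<^sup>2 \<partial>M) < \<epsilon> / 4" using Vap[OF f \<epsilon>] by blast
      have "(\<integral>x. ((L x - f n x) + (f n x - Y x))\<^sup>2 \<partial>M) < \<epsilon>"
        using double[OF sq_integrable_diff[OF Sq[OF L(1)] Vq[OF f[of n]]] sq_integrable_diff[OF Vq[OF f[of n]] Y]] L(2) n
        by linarith
      then show "\<exists>L\<in>S. (\<integral>x. (L x - Y x)\<^sup>2 \<partial>M) < \<epsilon>" using L(1) by auto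
    qed
    show "0 \<le> normal_moment_const r" for r by (simp add: normal_moment_const_def)
    fix Y r assume Y: "Y \<in> V"
    obtain L where L: "\<And>n. L n \<in> S" "(\<lambda>n. \<integral>x. (L n x - Y x)\<^sup>2 \<partial>M) \<longlonglongrightarrow> 0" "AE x in M. (\<lambda>n. L n x) \<longlonglongrightarrow> Y x"
      using seq[OF Y] by blast
    have "(\<lambda>n. \<integral>x. L n x * L n x \<partial>M) \<longlonglongrightarrow> (\<integral>x. Y x * Y x \<partial>M)"
      by (intro L2_tendsto_inner Sq Vq Y L)
    then have l: "(\<lambda>n. normal_moment_const r * (\<integral>x. (L n x)\<^sup>2 \<partial>M) ^ r) \<longlonglongrightarrow> normal_moment_const r * (\<integral>x. (Y x)\<^sup>2 \<partial>M) ^ r"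
      unfolding power2_eq_square by (intro tendsto_intros)
    have a: "AE x in M. (\<lambda>n. (L n x) ^ (2 * r)) \<longlonglongrightarrow> (Y x) ^ (2 * r)"
      using L(3) by eventually_elim (intro tendsto_intros)
    have nn: "0 \<le> (L n x) ^ (2 * r)" for n x by (simp add: power_mult)
    have Ym: "(\<lambda>x. (Y x) ^ (2 * r)) \<in> borel_measurable M"
      using Vq[OF Y] by (intro borel_measurable_power) (simp add: sq_integrable_def)
    note fatou_integrable[OF mom(2)[OF L(1)] nn Ym a order.eq_iff[THEN iffD1, THEN conjunct1, OF mom(3)[OF L(1)]] l]
    then show "integrable M (\<lambda>x. (Y x) ^ (2 * r))"
      "(\<integral>x. (Y x) ^ (2 * r) \<partial>M) \<le> normal_moment_const r * (\<integral>x. (Y x)\<^sup>2 \<partial>M) ^ r" by auto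
  qed
  then show "moment_space M (L2_closure M (centred_span I X \<mu>)) normal_moment_const" by (simp add: V_def S_def)
  show "(\<lambda>\<omega>. X z \<omega> - \<mu> z) \<in> L2_closure M (centred_span I X \<mu>)" if z: "z \<in> I" for z
    using centred_span_single[OF z, of X \<mu>] Sq unfolding L2_closure_def S_def
    by (auto intro!: bexI[of _ "\<lambda>\<omega>. X z \<omega> - \<mu> z"])
qed

theorem theorem2:
  fixes a b :: "real ^ 'n::{finite,linorder}"
    and \<beta> :: "'n \<Rightarrow> nat"
    and \<sigma> \<rho> :: "'n \<Rightarrow> real"
    and \<mu> :: "real ^ 'n::{finite,linorder} \<Rightarrow> real"
    and M :: "'w measure"
    and X :: "real ^ 'n::{finite,linorder} \<Rightarrow> 'w \<Rightarrow> real"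
  assumes "\<And>i. a $ i < b $ i"
    and "\<And>i. \<sigma> i > 0"
    and "\<And>i. \<rho> i > 0"
    and "\<mu> \<in> C_multi \<beta> (box a b)"
    and "bounded (\<mu> ` box a b)"
    and "gaussian_process M (box a b) X \<mu>
           (\<lambda>z z'. \<Prod>i\<in>UNIV. matern (\<beta> i) (\<sigma> i) (\<rho> i) (z $ i - z' $ i))"
  shows "\<exists>Y. modification M (box a b) X Y \<and>
           \<P>(\<omega> in M. (\<lambda>z. Y z \<omega>) \<in> C_multi \<beta> (box a b)) = 1"
proof -
  let ?I = "box a b"
  note gp = assms(6)
  define V where "V = L2_closure M (centred_span ?I X \<mu>)"
  interpret moment_space M V normal_moment_const
    unfolding V_def by (rule gaussian_process_moment_space(1)[OF gp])
  have Xm: "X z \<in> borel_measurable M" if "z \<in> ?I" for z using gp that by (simp add: gaussian_process_def)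
  have X: "(\<lambda>\<omega>. X z \<omega> - \<mu> z) \<in> V" if "z \<in> ?I" for z
    unfolding V_def by (rule gaussian_process_moment_space(2)[OF gp that])
  have cov: "(\<integral>\<omega>. (X z \<omega> - \<mu> z) * (X z' \<omega> - \<mu> z') \<partial>M) =
     (\<Prod>i\<in>UNIV. matern (\<beta> i) (\<sigma> i) (\<rho> i) (z $ i - z' $ i))" if "z \<in> ?I" "z' \<in> ?I" for z z'
    using gp that by (simp add: gaussian_process_def)
  have "\<exists>Y. (\<forall>z\<in>?I. Y z \<in> borel_measurable M \<and> (AE \<omega> in M. Y z \<omega> = X z \<omega> - \<mu> z)) \<and>
    (AE \<omega> in M. (\<lambda>z. \<mu> z + Y z \<omega>) \<in> C_multi \<beta> ?I)"
    by (rule matern_field_modification[of a b \<rho> \<mu> \<beta> "\<lambda>z \<omega>. X z \<omega> - \<mu> z" \<sigma>, OF assms(1,3,4) X cov])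
  then obtain Y where Y: "\<And>z. z \<in> ?I \<Longrightarrow> Y z \<in> borel_measurable M"
      "\<And>z. z \<in> ?I \<Longrightarrow> AE \<omega> in M. Y z \<omega> = X z \<omega> - \<mu> z"
      "AE \<omega> in M. (\<lambda>z. \<mu> z + Y z \<omega>) \<in> C_multi \<beta> ?I"
    by blast
  \<comment> \<open>The set of regular paths is not known to be measurable, so the bad ones are
    covered by a measurable null set.\<close>
  obtain N where N: "{\<omega> \<in> space M. (\<lambda>z. \<mu> z + Y z \<omega>) \<notin> C_multi \<beta> ?I} \<subseteq> N" "emeasure M N = 0" "N \<in> sets M"
    by (rule AE_E[OF Y(3)])
  have N_null: "AE \<omega> in M. \<omega> \<notin> N" using N by (intro AE_not_in null_setsI) auto
  \<comment> \<open>On \<open>N\<close> the path is replaced by the mean, which is in the class by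
    hypothesis. Every path is then regular and the event is the whole space; this matters because a
    set that is not measurable has measure 0 by convention.\<close>
  define W where "W = (\<lambda>z \<omega>. \<mu> z + (if \<omega> \<in> N then 0 else Y z \<omega>))"
  have Wm: "W z \<in> borel_measurable M" if "z \<in> ?I" for z
  proof -
    note [measurable] = Y(1)[OF that] N(3)
    show ?thesis unfolding W_def by measurable
  qed
  have "\<P>(\<omega> in M. X z \<omega> = W z \<omega>) = 1" if z: "z \<in> ?I" for z
  proof -
    note [measurable] = Wm[OF z] Xm[OF z]
    have "AE \<omega> in M. X z \<omega> = W z \<omega>"
      using Y(2)[OF z] N_null by eventually_elim (simp add: W_def)
    moreover have "{\<omega> \<in> space M. X z \<omega> = W z \<omega>} \<in> events" by measurable
    ultimately show ?thesis using prob_Collect_eq_1[of "\<lambda>\<omega>. X z \<omega> = W z \<omega>"] by simp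
  qed
  then have "modification M ?I X W" using Wm by (simp add: modification_def)
  moreover have "{\<omega> \<in> space M. (\<lambda>z. W z \<omega>) \<in> C_multi \<beta> ?I} = space M"
  proof (intro equalityI subsetI CollectI conjI)
    fix \<omega> assume "\<omega> \<in> space M"
    then show "(\<lambda>z. W z \<omega>) \<in> C_multi \<beta> ?I"
      using N(1) assms(4) by (cases "\<omega> \<in> N") (auto simp: W_def)
  qed auto
  then have "\<P>(\<omega> in M. (\<lambda>z. W z \<omega>) \<in> C_multi \<beta> ?I) = 1" by (simp add: prob_space)
  ultimately show ?thesis by blast
qed

end
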